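(* Let $\mathbb{G}_a$ act linearly and non-trivially on a complex affine space $V$, with moment map $\mu_{\mathbb{G}_a}: T^*V \to \mathbb{C}$ for the cotangent lift, and let $H_V(\xi) := \mu_{\mathbb{G}_a}^{-1}(\xi)$. For every $\xi \in \mathbb{C}^*$, the quotient $\mathcal{X}_\xi := H_V(\xi)/\mathbb{G}_a$ is an algebraic symplectic manifold with symplectic form $\omega_\xi$ induced by the Liouville form $\omega$ on $T^*V$. These form a 1-parameter family: with $H_V(\mathbb{C}^* ) := \mu_{\mathbb{G}_a}^{-1}(\mathbb{C}^* )$, the quotient $H_V(\mathbb{C}^* ) \to \mathcal{X} := H_V(\mathbb{C}^* )/\mathbb{G}_a$ is a trivial $\mathbb{G}_a$-torsor, and there is a morphism $\mathcal{X} \to \mathbb{C}^*$ (induced by $\mu_{\mathbb{G}_a}$) whose fibre over each $\xi \in \mathbb{C}^*$ is $\mathcal{X}_\xi$. Furthermore, for all $\xi_1, \xi_2 \in \mathbb{C}^*$ there is an isomorphism of algebraic varieties \[ \Phi_{\xi_1,\xi_2} : H_V(\xi_1)/\mathbb{G}_a \to H_V(\xi_2)/\mathbb{G}_a \] which scales the symplectic forms as follows: $\xi_2\, \omega_{\xi_1} = \xi_1\, \Phi_{\xi_1,\xi_2}^*\omega_{\xi_2}$.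
   Context: Everything is over $\mathbb{C}$. $\mathbb{G}_a$ is embedded in $\mathrm{SL}_2$ as the upper triangular unipotent subgroup. A linear $\mathbb{G}_a$-action on $V \cong \mathbb{A}^n$ extends to a representation $\rho: \mathrm{SL}_2 \to \mathrm{GL}(V)$; fix such an extension. Identify $T^*V \cong V \times V^*$ with coordinates $(x,\alpha)$; the Liouville form is $\omega = \sum_l dx_l \wedge d\alpha_l$ and the cotangent lift of the action is $g\cdot(x,\alpha) = (\rho(g)x, \alpha\rho(g)^{-1})$ ($x$ a column vector, $\alpha$ a row vector). The moment map of the $\mathbb{G}_a$-action on $T^*V$ is $\mu_{\mathbb{G}_a}(x,\alpha) = \alpha(\rho_*(E)x)$, where $E = \begin{pmatrix} 0&1\\0&0\end{pmatrix} \in \mathfrak{sl}_2$; it is $\mathbb{G}_a$-invariant. The quotients are locally trivial geometric quotients. An algebraic symplectic manifold is a smooth complex algebraic variety with a closed non-degenerate algebraic 2-form. That $\omega_\xi$ is induced by $\omega$ means $\pi_\xi^*\omega_\xi = i_\xi^*\omega$, where $\pi_\xi: H_V(\xi) \to H_V(\xi)/\mathbb{G}_a$ is the quotient map and $i_\xi : H_V(\xi) \hookrightarrow T^*V$ the inclusion. *)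

theory Defs
  imports "HOL-Analysis.Analysis"
begin

section \<open>Varieties over the complex numbers as spaces with functions\<close>

text \<open>
  A variety is a (reduced) ringed space whose structure sheaf consists of complex-valued
  functions, in the style of Borel and Springer. It need not be irreducible.
  \<open>regf X U\<close> is only meaningful for \<open>U\<close> open; its elements are total HOL functions of which
  only the values on \<open>U\<close> matter.
\<close>

record 'a fspace =
  topo :: "'a topology"
  regf :: "'a set \<Rightarrow> ('a \<Rightarrow> complex) set"

abbreviation pts :: "'a fspace \<Rightarrow> 'a set" where
  "pts X \<equiv> topspace (topo X)"

definition sheaf_of_functions :: "'a fspace \<Rightarrow> bool" where
  "sheaf_of_functions X \<longleftrightarrow>
     (\<forall>U W f. openin (topo X) U \<and> openin (topo X) W \<and> W \<subseteq> U \<and> f \<in> regf X U \<longrightarrow> f \<in> regf X W) \<and>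
     (\<forall>U f. openin (topo X) U \<and>
        (\<forall>x\<in>U. \<exists>W. openin (topo X) W \<and> x \<in> W \<and> W \<subseteq> U \<and> (\<exists>g\<in>regf X W. \<forall>y\<in>W. f y = g y))
        \<longrightarrow> f \<in> regf X U)"

text \<open>The induced structure on a locally closed subset: functions that locally extend to the
  ambient space. For open subsets this is restriction, for closed ones the reduced structure.\<close>

definition subspace_fs :: "'a fspace \<Rightarrow> 'a set \<Rightarrow> 'a fspace" where
  "subspace_fs X S = \<lparr> topo = subtopology (topo X) S,
     regf = (\<lambda>U. {f. \<forall>x\<in>U. \<exists>W. openin (topo X) W \<and> x \<in> W \<and>
                        (\<exists>g\<in>regf X W. \<forall>y\<in>W \<inter> U. f y = g y)}) \<rparr>"

definition morphism :: "'a fspace \<Rightarrow> 'b fspace \<Rightarrow> ('a \<Rightarrow> 'b) \<Rightarrow> bool" where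
  "morphism X Y \<phi> \<longleftrightarrow> continuous_map (topo X) (topo Y) \<phi> \<and>
     (\<forall>V f. openin (topo Y) V \<and> f \<in> regf Y V \<longrightarrow> f \<circ> \<phi> \<in> regf X {x \<in> pts X. \<phi> x \<in> V})"

definition isomorphism :: "'a fspace \<Rightarrow> 'b fspace \<Rightarrow> ('a \<Rightarrow> 'b) \<Rightarrow> bool" where
  "isomorphism X Y \<phi> \<longleftrightarrow> morphism X Y \<phi> \<and>
     (\<exists>\<psi>. morphism Y X \<psi> \<and> (\<forall>x\<in>pts X. \<psi> (\<phi> x) = x) \<and> (\<forall>y\<in>pts Y. \<phi> (\<psi> y) = y))"

text \<open>Polynomial functions in a set of coordinate functions.\<close>

inductive_set poly_functions :: "('a \<Rightarrow> complex) set \<Rightarrow> ('a \<Rightarrow> complex) set"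
  for C :: "('a \<Rightarrow> complex) set" where
  const: "(\<lambda>_. c) \<in> poly_functions C"
| coord: "f \<in> C \<Longrightarrow> f \<in> poly_functions C"
| add: "f \<in> poly_functions C \<Longrightarrow> g \<in> poly_functions C \<Longrightarrow> (\<lambda>x. f x + g x) \<in> poly_functions C"
| mult: "f \<in> poly_functions C \<Longrightarrow> g \<in> poly_functions C \<Longrightarrow> (\<lambda>x. f x * g x) \<in> poly_functions C"

text \<open>The affine space with point set \<open>S\<close> and coordinate functions \<open>C\<close>: Zariski topology, and
  functions that are locally quotients of polynomials.\<close>

definition affine_space :: "'a set \<Rightarrow> ('a \<Rightarrow> complex) set \<Rightarrow> 'a fspace" where
  "affine_space S C = (let T = topology_generated_by {{x \<in> S. p x \<noteq> 0} |p. p \<in> poly_functions C} in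
     \<lparr> topo = T,
       regf = (\<lambda>U. {f. \<forall>x\<in>U. \<exists>W. openin T W \<and> x \<in> W \<and> W \<subseteq> U \<and>
                 (\<exists>p\<in>poly_functions C. \<exists>q\<in>poly_functions C. \<forall>y\<in>W. q y \<noteq> 0 \<and> f y = p y / q y)}) \<rparr>)"

definition An_coords :: "nat \<Rightarrow> ((nat \<Rightarrow> complex) \<Rightarrow> complex) set" where
  "An_coords m = {(\<lambda>x. x i) |i. i < m}"

text \<open>Affine m-space, with m-tuples encoded as sequences vanishing from index m on.\<close>

definition An :: "nat \<Rightarrow> (nat \<Rightarrow> complex) fspace" where
  "An m = affine_space {x. \<forall>i\<ge>m. x i = 0} (An_coords m)"

definition Ga :: "complex fspace" where
  "Ga = affine_space UNIV {\<lambda>t. t}"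

definition Cstar :: "complex fspace" where
  "Cstar = subspace_fs Ga (- {0})"

text \<open>The product of varieties: basic open sets are the non-vanishing loci of sums of products
  of regular functions on products of open sets, and regular functions are locally quotients of
  such sums.\<close>

definition tensor_functions ::
  "'a fspace \<Rightarrow> 'b fspace \<Rightarrow> 'a set \<Rightarrow> 'b set \<Rightarrow> ('a \<times> 'b \<Rightarrow> complex) set" where
  "tensor_functions X Y U V =
     {(\<lambda>(x, y). \<Sum>i<n. f i x * g i y) |(n::nat) f g. \<forall>i<n. f i \<in> regf X U \<and> g i \<in> regf Y V}"

definition product_fs :: "'a fspace \<Rightarrow> 'b fspace \<Rightarrow> ('a \<times> 'b) fspace" where
  "product_fs X Y =
     \<lparr> topo = topology_generated_by {{z \<in> U \<times> V. k z \<noteq> 0} |U V k.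
                openin (topo X) U \<and> openin (topo Y) V \<and> k \<in> tensor_functions X Y U V},
       regf = (\<lambda>W. {F. \<forall>z\<in>W. \<exists>U V. openin (topo X) U \<and> openin (topo Y) V \<and>
                 (\<exists>h\<in>tensor_functions X Y U V. \<exists>k\<in>tensor_functions X Y U V.
                    z \<in> {w \<in> U \<times> V. k w \<noteq> 0} \<and> {w \<in> U \<times> V. k w \<noteq> 0} \<subseteq> W \<and>
                    (\<forall>w\<in>{w \<in> U \<times> V. k w \<noteq> 0}. F w = h w / k w))}) \<rparr>"

definition affine_variety :: "'a fspace \<Rightarrow> bool" where
  "affine_variety X \<longleftrightarrow>
     (\<exists>m Z \<phi>. closedin (topo (An m)) Z \<and> isomorphism X (subspace_fs (An m) Z) \<phi>)"

definition variety :: "'a fspace \<Rightarrow> bool" where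
  "variety X \<longleftrightarrow> sheaf_of_functions X \<and>
     (\<exists>\<U>. finite \<U> \<and> \<Union>\<U> = pts X \<and>
        (\<forall>U\<in>\<U>. openin (topo X) U \<and> affine_variety (subspace_fs X U))) \<and>
     closedin (topo (product_fs X X)) {(x, x) |x. x \<in> pts X}"

section \<open>Smoothness\<close>

definition partial_deriv :: "nat \<Rightarrow> ((nat \<Rightarrow> complex) \<Rightarrow> complex) \<Rightarrow> (nat \<Rightarrow> complex) \<Rightarrow> complex" where
  "partial_deriv i F x = deriv (\<lambda>t. F (x(i := t))) (x i)"

text \<open>Locally the variety is cut out in affine m-space by r polynomials whose Jacobian matrix
  has rank r at every point. (Such equations generate a radical ideal, so taking the reduced
  structure on their zero set loses nothing.)\<close>

definition smooth :: "'a fspace \<Rightarrow> bool" where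
  "smooth X \<longleftrightarrow> (\<forall>x\<in>pts X. \<exists>U m (r::nat) F Z \<phi>. openin (topo X) U \<and> x \<in> U \<and>
     (\<forall>j<r. F j \<in> poly_functions (An_coords m)) \<and>
     Z = {a \<in> pts (An m). \<forall>j<r. F j a = 0} \<and>
     isomorphism (subspace_fs X U) (subspace_fs (An m) Z) \<phi> \<and>
     (\<forall>a\<in>Z. \<forall>c. (\<forall>i<m. (\<Sum>j<r. c j * partial_deriv i (F j) a) = 0) \<longrightarrow> (\<forall>j<r. c j = 0)))"

section \<open>Tangent vectors and algebraic 2-forms\<close>

definition germs :: "'a fspace \<Rightarrow> 'a \<Rightarrow> ('a \<Rightarrow> complex) set" where
  "germs X x = {f. \<exists>U. openin (topo X) U \<and> x \<in> U \<and> f \<in> regf X U}"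

type_synonym 'a tvec = "('a \<Rightarrow> complex) \<Rightarrow> complex"

text \<open>The Zariski tangent space, as the space of derivations of the local ring at \<open>x\<close>;
  derivations are set to 0 on functions that are not regular near \<open>x\<close>.\<close>

definition tangent :: "'a fspace \<Rightarrow> 'a \<Rightarrow> 'a tvec set" where
  "tangent X x = {D.
     (\<forall>f. f \<notin> germs X x \<longrightarrow> D f = 0) \<and>
     (\<forall>f\<in>germs X x. \<forall>g\<in>germs X x.
        (\<exists>U. openin (topo X) U \<and> x \<in> U \<and> (\<forall>y\<in>U. f y = g y)) \<longrightarrow> D f = D g) \<and>
     (\<forall>f\<in>germs X x. \<forall>g\<in>germs X x. D (\<lambda>y. f y + g y) = D f + D g) \<and>
     (\<forall>c. \<forall>f\<in>germs X x. D (\<lambda>y. c * f y) = c * D f) \<and>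
     (\<forall>f\<in>germs X x. \<forall>g\<in>germs X x. D (\<lambda>y. f y * g y) = f x * D g + g x * D f)}"

definition push_forward :: "'b fspace \<Rightarrow> ('a \<Rightarrow> 'b) \<Rightarrow> 'a \<Rightarrow> 'a tvec \<Rightarrow> 'b tvec" where
  "push_forward Y \<phi> x D = (\<lambda>g. if g \<in> germs Y (\<phi> x) then D (g \<circ> \<phi>) else 0)"

type_synonym 'a form2 = "'a \<Rightarrow> 'a tvec \<Rightarrow> 'a tvec \<Rightarrow> complex"
type_synonym 'a form3 = "'a \<Rightarrow> 'a tvec \<Rightarrow> 'a tvec \<Rightarrow> 'a tvec \<Rightarrow> complex"

definition pullback_form :: "'b fspace \<Rightarrow> ('a \<Rightarrow> 'b) \<Rightarrow> 'b form2 \<Rightarrow> 'a form2" where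
  "pullback_form Y \<phi> \<omega> = (\<lambda>x D D'. \<omega> (\<phi> x) (push_forward Y \<phi> x D) (push_forward Y \<phi> x D'))"

definition wedge2 :: "('a \<Rightarrow> complex) \<Rightarrow> ('a \<Rightarrow> complex) \<Rightarrow> 'a tvec \<Rightarrow> 'a tvec \<Rightarrow> complex" where
  "wedge2 g h D1 D2 = D1 g * D2 h - D2 g * D1 h"

definition wedge3 :: "('a \<Rightarrow> complex) \<Rightarrow> ('a \<Rightarrow> complex) \<Rightarrow> ('a \<Rightarrow> complex) \<Rightarrow>
    'a tvec \<Rightarrow> 'a tvec \<Rightarrow> 'a tvec \<Rightarrow> complex" where
  "wedge3 f g h D1 D2 D3 = D1 f * wedge2 g h D2 D3 - D2 f * wedge2 g h D1 D3 + D3 f * wedge2 g h D1 D2"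

text \<open>\<open>local_expression X U \<omega> n f g h\<close>: the 2-form is the sum of the \<open>f i dg i \<and> dh i\<close> over \<open>U\<close>.\<close>

definition local_expression :: "'a fspace \<Rightarrow> 'a set \<Rightarrow> 'a form2 \<Rightarrow> nat \<Rightarrow>
    (nat \<Rightarrow> 'a \<Rightarrow> complex) \<Rightarrow> (nat \<Rightarrow> 'a \<Rightarrow> complex) \<Rightarrow> (nat \<Rightarrow> 'a \<Rightarrow> complex) \<Rightarrow> bool" where
  "local_expression X U \<omega> n f g h \<longleftrightarrow>
     (\<forall>i<n. f i \<in> regf X U \<and> g i \<in> regf X U \<and> h i \<in> regf X U) \<and>
     (\<forall>y\<in>U. \<forall>D1\<in>tangent X y. \<forall>D2\<in>tangent X y.
        \<omega> y D1 D2 = (\<Sum>i<n. f i y * wedge2 (g i) (h i) D1 D2))"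

definition algebraic_2form :: "'a fspace \<Rightarrow> 'a form2 \<Rightarrow> bool" where
  "algebraic_2form X \<omega> \<longleftrightarrow>
     (\<forall>x\<in>pts X. \<exists>U n f g h. openin (topo X) U \<and> x \<in> U \<and> local_expression X U \<omega> n f g h)"

text \<open>The exterior derivative of a sum of \<open>f dg \<and> dh\<close> is the sum of the \<open>df \<and> dg \<and> dh\<close>. On a
  smooth variety this does not depend on the local expression, because an algebraic form
  is there determined by its values on tangent vectors.\<close>

definition has_exterior_derivative :: "'a fspace \<Rightarrow> 'a form2 \<Rightarrow> 'a form3 \<Rightarrow> bool" where
  "has_exterior_derivative X \<omega> \<eta> \<longleftrightarrow>
     (\<forall>x\<in>pts X. \<exists>U n f g h. openin (topo X) U \<and> x \<in> U \<and> local_expression X U \<omega> n f g h \<and>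
        (\<forall>y\<in>U. \<forall>D1\<in>tangent X y. \<forall>D2\<in>tangent X y. \<forall>D3\<in>tangent X y.
           \<eta> y D1 D2 D3 = (\<Sum>i<n. wedge3 (f i) (g i) (h i) D1 D2 D3)))"

definition closed_2form :: "'a fspace \<Rightarrow> 'a form2 \<Rightarrow> bool" where
  "closed_2form X \<omega> \<longleftrightarrow> has_exterior_derivative X \<omega> (\<lambda>_ _ _ _. 0)"

definition nondegenerate :: "'a fspace \<Rightarrow> 'a form2 \<Rightarrow> bool" where
  "nondegenerate X \<omega> \<longleftrightarrow> (\<forall>x\<in>pts X. \<forall>D\<in>tangent X x.
     (\<forall>D'\<in>tangent X x. \<omega> x D D' = 0) \<longrightarrow> D = (\<lambda>_. 0))"

definition algebraic_symplectic :: "'a fspace \<Rightarrow> 'a form2 \<Rightarrow> bool" where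
  "algebraic_symplectic X \<omega> \<longleftrightarrow> variety X \<and> smooth X \<and>
     algebraic_2form X \<omega> \<and> closed_2form X \<omega> \<and> nondegenerate X \<omega>"

section \<open>Quotients and torsors\<close>

definition quotient_topology :: "'a topology \<Rightarrow> ('a \<Rightarrow> 'b) \<Rightarrow> 'b topology" where
  "quotient_topology T \<pi> =
     topology (\<lambda>U. U \<subseteq> \<pi> ` topspace T \<and> openin T {x \<in> topspace T. \<pi> x \<in> U})"

lemma openin_quotient_topology:
  "openin (quotient_topology T \<pi>) U \<longleftrightarrow>
     U \<subseteq> \<pi> ` topspace T \<and> openin T {x \<in> topspace T. \<pi> x \<in> U}"
proof -
  let ?P = "\<lambda>U. U \<subseteq> \<pi> ` topspace T \<and> openin T {x \<in> topspace T. \<pi> x \<in> U}"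
  have "?P (S \<inter> S')" if "?P S" "?P S'" for S S'
  proof -
    have "{x \<in> topspace T. \<pi> x \<in> S \<inter> S'} =
        {x \<in> topspace T. \<pi> x \<in> S} \<inter> {x \<in> topspace T. \<pi> x \<in> S'}" by auto
    then show ?thesis using that by auto
  qed
  moreover have "?P (\<Union>K)" if "\<forall>S\<in>K. ?P S" for K
  proof -
    have "{x \<in> topspace T. \<pi> x \<in> \<Union>K} = (\<Union>S\<in>K. {x \<in> topspace T. \<pi> x \<in> S})" by auto
    then show ?thesis using that by auto
  qed
  ultimately have "istopology ?P"
    unfolding istopology_def by blast
  then show ?thesis
    unfolding quotient_topology_def by (simp add: topology_inverse')
qed

text \<open>For \<open>\<pi>\<close> the map to the set of orbits of an action this is the quotient in the sense of
  geometric quotients: points are orbits, the topology is the quotient topology, and the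
  regular functions are the invariant regular functions.\<close>

definition quotient_fs :: "'a fspace \<Rightarrow> ('a \<Rightarrow> 'b) \<Rightarrow> 'b fspace" where
  "quotient_fs X \<pi> = \<lparr> topo = quotient_topology (topo X) \<pi>,
     regf = (\<lambda>U. {f. f \<circ> \<pi> \<in> regf X {x \<in> pts X. \<pi> x \<in> U}}) \<rparr>"

definition orbit :: "(complex \<Rightarrow> 'a \<Rightarrow> 'a) \<Rightarrow> 'a \<Rightarrow> 'a set" where
  "orbit act z = range (\<lambda>t. act t z)"

definition trivial_Ga_torsor ::
  "(complex \<Rightarrow> 'a \<Rightarrow> 'a) \<Rightarrow> 'a fspace \<Rightarrow> 'b fspace \<Rightarrow> ('a \<Rightarrow> 'b) \<Rightarrow> bool" where
  "trivial_Ga_torsor act P X \<pi> \<longleftrightarrow>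
     (\<exists>\<phi>. isomorphism (product_fs X Ga) P \<phi> \<and>
        (\<forall>x\<in>pts X. \<forall>t. \<pi> (\<phi> (x, t)) = x \<and> (\<forall>s. \<phi> (x, s + t) = act s (\<phi> (x, t)))))"

definition locally_trivial_Ga_torsor ::
  "(complex \<Rightarrow> 'a \<Rightarrow> 'a) \<Rightarrow> 'a fspace \<Rightarrow> 'b fspace \<Rightarrow> ('a \<Rightarrow> 'b) \<Rightarrow> bool" where
  "locally_trivial_Ga_torsor act P X \<pi> \<longleftrightarrow> morphism P X \<pi> \<and>
     (\<forall>x\<in>pts X. \<exists>U. openin (topo X) U \<and> x \<in> U \<and>
        trivial_Ga_torsor act (subspace_fs P {z \<in> pts P. \<pi> z \<in> U}) (subspace_fs X U) \<pi>)"

section \<open>Linear actions of the additive group and their cotangent lifts\<close>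

definition linear_Ga_action :: "(complex \<Rightarrow> complex^'n^'n) \<Rightarrow> bool" where
  "linear_Ga_action \<sigma> \<longleftrightarrow> \<sigma> 0 = mat 1 \<and> (\<forall>s t. \<sigma> (s + t) = \<sigma> s ** \<sigma> t) \<and>
     (\<forall>i j. (\<lambda>t. \<sigma> t $ i $ j) \<in> poly_functions {\<lambda>t. t})"

text \<open>A representation is only constrained on matrices of determinant 1. As such matrices have
  polynomial inverses, its matrix entries are polynomials in the entries of the argument.\<close>

definition SL2_representation :: "(complex^2^2 \<Rightarrow> complex^'n^'n) \<Rightarrow> bool" where
  "SL2_representation \<rho> \<longleftrightarrow> \<rho> (mat 1) = mat 1 \<and>
     (\<forall>g h. det g = 1 \<and> det h = 1 \<longrightarrow> \<rho> (g ** h) = \<rho> g ** \<rho> h) \<and>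
     (\<forall>i j. \<exists>p\<in>poly_functions {(\<lambda>g. g $ a $ b) |a b. True}. \<forall>g. det g = 1 \<longrightarrow> \<rho> g $ i $ j = p g)"

text \<open>The embedding of the additive group in SL2; \<open>unip t\<close> is the exponential of \<open>t E\<close>.\<close>

definition unip :: "complex \<Rightarrow> complex^2^2" where
  "unip t = vector [vector [1, t], vector [0, 1]]"

text \<open>The image of \<open>E\<close> under the differential of \<open>\<rho>\<close>, i.e. the derivative of \<open>\<rho> (exp (t E))\<close>
  at \<open>t = 0\<close>.\<close>

definition rho_E :: "(complex^2^2 \<Rightarrow> complex^'n^'n) \<Rightarrow> complex^'n^'n" where
  "rho_E \<rho> = (\<chi> i j. deriv (\<lambda>t. \<rho> (unip t) $ i $ j) 0)"

text \<open>The cotangent bundle of \<open>V = complex^'n\<close> is the space of pairs \<open>(x, \<alpha>)\<close>, with \<open>x\<close> a column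
  vector and \<open>\<alpha>\<close> a row vector.\<close>

type_synonym 'n cotangent = "(complex^'n) \<times> (complex^'n)"

definition TV :: "'n::finite cotangent fspace" where
  "TV = affine_space UNIV ({(\<lambda>(x, \<alpha>). x $ l) |l. True} \<union> {(\<lambda>(x, \<alpha>). \<alpha> $ l) |l. True})"

definition liouville :: "'n::finite cotangent form2" where
  "liouville = (\<lambda>z D1 D2. \<Sum>l\<in>UNIV. wedge2 (\<lambda>(x, \<alpha>). x $ l) (\<lambda>(x, \<alpha>). \<alpha> $ l) D1 D2)"

definition cotangent_lift ::
  "(complex \<Rightarrow> complex^'n^'n) \<Rightarrow> complex \<Rightarrow> 'n::finite cotangent \<Rightarrow> 'n cotangent" where
  "cotangent_lift \<sigma> t = (\<lambda>(x, \<alpha>). (\<sigma> t *v x, \<alpha> v* matrix_inv (\<sigma> t)))"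

definition moment :: "(complex^2^2 \<Rightarrow> complex^'n^'n) \<Rightarrow> 'n::finite cotangent \<Rightarrow> complex" where
  "moment \<rho> = (\<lambda>(x, \<alpha>). \<Sum>i\<in>UNIV. \<alpha> $ i * (rho_E \<rho> *v x) $ i)"

definition H_level :: "(complex^2^2 \<Rightarrow> complex^'n^'n) \<Rightarrow> complex \<Rightarrow> 'n::finite cotangent fspace" where
  "H_level \<rho> \<xi> = subspace_fs TV {z. moment \<rho> z = \<xi>}"

definition H_Cstar :: "(complex^2^2 \<Rightarrow> complex^'n^'n) \<Rightarrow> 'n::finite cotangent fspace" where
  "H_Cstar \<rho> = subspace_fs TV {z. moment \<rho> z \<noteq> 0}"

abbreviation Ga_orbit ::
  "(complex \<Rightarrow> complex^'n^'n) \<Rightarrow> 'n::finite cotangent \<Rightarrow> 'n cotangent set" where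
  "Ga_orbit \<sigma> \<equiv> orbit (cotangent_lift \<sigma>)"

definition X_level :: "(complex \<Rightarrow> complex^'n^'n) \<Rightarrow> (complex^2^2 \<Rightarrow> complex^'n^'n) \<Rightarrow>
    complex \<Rightarrow> 'n::finite cotangent set fspace" where
  "X_level \<sigma> \<rho> \<xi> = quotient_fs (H_level \<rho> \<xi>) (Ga_orbit \<sigma>)"

definition X_total :: "(complex \<Rightarrow> complex^'n^'n) \<Rightarrow> (complex^2^2 \<Rightarrow> complex^'n^'n) \<Rightarrow>
    'n::finite cotangent set fspace" where
  "X_total \<sigma> \<rho> = quotient_fs (H_Cstar \<rho>) (Ga_orbit \<sigma>)"

end

theory Submission
  imports Defs
begin

text \<open>
  Let \<open>H\<close> be the image of the semisimple element of \<open>sl\<^sub>2\<close> and put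
  \<open>nu (x, \<alpha>) = \<alpha> H x\<close>, \<open>mu (x, \<alpha>) = \<alpha> E x\<close>. Since \<open>[H, E] = 2 E\<close>, the additive group acts by
  \<open>nu (t z) = nu z + 2 t mu z\<close>. Hence on \<open>mu \<noteq> 0\<close> the function \<open>nu / (2 mu)\<close> trivialises the torsor,
  and the quotient is the slice \<open>{nu = 0}\<close>, an affine variety. In a level of \<open>mu\<close> the slice is cut
  out by two quadrics whose differentials are independent, as one sees by evaluating them on the
  velocity of the action and on the Euler field \<open>(x, 0)\<close>. The symplectic form is the restriction of the
  Liouville form to the slice. Moving a point along its orbit by a function \<open>t\<close> changes the
  Liouville form by a multiple of \<open>dt \<and> d mu\<close>, which vanishes on the levels of \<open>mu\<close>; so the form pulls
  back to the Liouville form on the level, where its kernel is spanned by the velocity of the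
  action. Scaling \<open>\<alpha>\<close> gives the isomorphisms between the levels.
\<close>

section \<open>Spaces whose regular functions form local rings\<close>

text \<open>A unipotent linear action has in general only local slices; the extension to SL_2
  supplies \<open>H\<close>, whose quadric meets every orbit with \<open>mu\<close> nonzero exactly
  once, and this makes the torsor globally trivial. The factor 2 is the weight of \<open>E\<close>
  under the torus. Points of the quotient are bare sets of orbits without coordinates, so each
  statement about them is transported to the slice by \<open>section_pt\<close> and back by
  \<open>orb\<close>. Tangent vectors are derivations of local rings, and nondegeneracy is obtained
  without counting dimensions: a null vector of the quotient is lifted along the section and tested
  against the velocities of explicit curves in the level. It is then proportional to the velocity of
  the action, along which \<open>nu\<close> changes at rate 2 \<open>mu\<close>, whereas a lifted
  vector must annihilate \<open>nu\<close>.\<close>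

text \<open>Invertibility where a function does not vanish, on an open set, makes the germs at a
  point a local ring with residue field the complex numbers. Affine spaces, subspaces, quotients and
  products all have this property, so it serves as the standing hypothesis in place of
  \<open>variety\<close>.\<close>

definition ringed_fs :: "'a fspace \<Rightarrow> bool" where
  "ringed_fs X \<longleftrightarrow> sheaf_of_functions X \<and>
     (\<forall>U. openin (topo X) U \<longrightarrow>
        (\<forall>c. (\<lambda>_. c) \<in> regf X U) \<and>
        (\<forall>f\<in>regf X U. \<forall>g\<in>regf X U.
           (\<lambda>x. f x + g x) \<in> regf X U \<and> (\<lambda>x. f x * g x) \<in> regf X U) \<and>
        (\<forall>f\<in>regf X U. openin (topo X) {x \<in> U. f x \<noteq> 0} \<and>
           (\<lambda>x. inverse (f x)) \<in> regf X {x \<in> U. f x \<noteq> 0}))"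

lemma ringed_fsI:
  assumes "\<And>U W f. openin (topo X) U \<Longrightarrow> openin (topo X) W \<Longrightarrow> W \<subseteq> U \<Longrightarrow> f \<in> regf X U \<Longrightarrow> f \<in> regf X W"
    and "\<And>U f. openin (topo X) U \<Longrightarrow>
      (\<And>x. x \<in> U \<Longrightarrow> \<exists>W g. openin (topo X) W \<and> x \<in> W \<and> W \<subseteq> U \<and> g \<in> regf X W \<and> (\<forall>y\<in>W. f y = g y)) \<Longrightarrow>
      f \<in> regf X U"
    and "\<And>U c. openin (topo X) U \<Longrightarrow> (\<lambda>_. c) \<in> regf X U"
    and "\<And>U f g. openin (topo X) U \<Longrightarrow> f \<in> regf X U \<Longrightarrow> g \<in> regf X U \<Longrightarrow> (\<lambda>x. f x + g x) \<in> regf X U"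
    and "\<And>U f g. openin (topo X) U \<Longrightarrow> f \<in> regf X U \<Longrightarrow> g \<in> regf X U \<Longrightarrow> (\<lambda>x. f x * g x) \<in> regf X U"
    and "\<And>U f. openin (topo X) U \<Longrightarrow> f \<in> regf X U \<Longrightarrow> openin (topo X) {x \<in> U. f x \<noteq> 0}"
    and "\<And>U f. openin (topo X) U \<Longrightarrow> f \<in> regf X U \<Longrightarrow>
      (\<lambda>x. inverse (f x)) \<in> regf X {x \<in> U. f x \<noteq> 0}"
  shows "ringed_fs X"
  unfolding ringed_fs_def sheaf_of_functions_def
proof (intro conjI allI impI ballI)
  fix U f
  assume "openin (topo X) U \<and> (\<forall>x\<in>U. \<exists>W. openin (topo X) W \<and> x \<in> W \<and> W \<subseteq> U \<and> (\<exists>g\<in>regf X W. \<forall>y\<in>W. f y = g y))"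
  then show "f \<in> regf X U" by (intro assms(2)) blast+
qed ((elim conjE)?, (rule assms(1) assms(3-7); assumption))+

lemma
  assumes "ringed_fs X"
  shows ringed_fs_sheaf: "sheaf_of_functions X"
    and regf_restrict: "f \<in> regf X U \<Longrightarrow> openin (topo X) U \<Longrightarrow> openin (topo X) W \<Longrightarrow> W \<subseteq> U \<Longrightarrow> f \<in> regf X W"
    and regf_const: "openin (topo X) U \<Longrightarrow> (\<lambda>_. c) \<in> regf X U"
    and regf_add: "openin (topo X) U \<Longrightarrow> f \<in> regf X U \<Longrightarrow> g \<in> regf X U \<Longrightarrow> (\<lambda>x. f x + g x) \<in> regf X U"
    and regf_mult: "openin (topo X) U \<Longrightarrow> f \<in> regf X U \<Longrightarrow> g \<in> regf X U \<Longrightarrow> (\<lambda>x. f x * g x) \<in> regf X U"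
    and openin_nonzero: "openin (topo X) U \<Longrightarrow> f \<in> regf X U \<Longrightarrow> openin (topo X) {x \<in> U. f x \<noteq> 0}"
    and regf_inverse_nonzero: "openin (topo X) U \<Longrightarrow> f \<in> regf X U \<Longrightarrow>
      (\<lambda>x. inverse (f x)) \<in> regf X {x \<in> U. f x \<noteq> 0}"
proof -
  note ring = assms[unfolded ringed_fs_def, THEN conjunct2, rule_format]
  show sheaf: "sheaf_of_functions X"
    using assms by (simp add: ringed_fs_def)
  show "f \<in> regf X W" if "f \<in> regf X U" "openin (topo X) U" "openin (topo X) W" "W \<subseteq> U"
    using sheaf[unfolded sheaf_of_functions_def, THEN conjunct1] that by blast
  assume U: "openin (topo X) U"
  note ring = ring[OF U]
  show "(\<lambda>_. c) \<in> regf X U" using ring by blast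
  show "(\<lambda>x. f x + g x) \<in> regf X U" "(\<lambda>x. f x * g x) \<in> regf X U" if "f \<in> regf X U" "g \<in> regf X U"
    using ring that by blast+
  show "openin (topo X) {x \<in> U. f x \<noteq> 0}" "(\<lambda>x. inverse (f x)) \<in> regf X {x \<in> U. f x \<noteq> 0}"
    if "f \<in> regf X U"
    using ring that by blast+
qed

lemma regf_local:
  assumes "ringed_fs X" "openin (topo X) U"
    and "\<And>x. x \<in> U \<Longrightarrow> \<exists>W g. openin (topo X) W \<and> x \<in> W \<and> W \<subseteq> U \<and> g \<in> regf X W \<and> (\<forall>y\<in>W. f y = g y)"
  shows "f \<in> regf X U"
proof -
  have "\<forall>x\<in>U. \<exists>W. openin (topo X) W \<and> x \<in> W \<and> W \<subseteq> U \<and> (\<exists>g\<in>regf X W. \<forall>y\<in>W. f y = g y)"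
  proof
    fix x assume "x \<in> U"
    from assms(3)[OF this] show "\<exists>W. openin (topo X) W \<and> x \<in> W \<and> W \<subseteq> U \<and> (\<exists>g\<in>regf X W. \<forall>y\<in>W. f y = g y)"
      by (elim exE) (rule exI, blast)
  qed
  then show ?thesis
    using ringed_fs_sheaf[OF assms(1)] assms(2) unfolding sheaf_of_functions_def by blast
qed

text \<open>Members of \<open>regf X U\<close> are total functions, and the gluing axiom shows that
  only their values on \<open>U\<close> decide membership.\<close>

lemma regf_cong:
  assumes "ringed_fs X" "openin (topo X) U" "f \<in> regf X U" "\<And>x. x \<in> U \<Longrightarrow> f x = g x"
  shows "g \<in> regf X U"
  by (rule regf_local) (use assms in force)+

lemma regf_inverse:
  assumes "ringed_fs X" "openin (topo X) U" "f \<in> regf X U" "\<And>x. x \<in> U \<Longrightarrow> f x \<noteq> 0"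
  shows "(\<lambda>x. inverse (f x)) \<in> regf X U"
proof -
  have "{x \<in> U. f x \<noteq> 0} = U" using assms(4) by auto
  then show ?thesis using regf_inverse_nonzero[OF assms(1-3)] by simp
qed

lemma regf_divide:
  assumes "ringed_fs X" "openin (topo X) U" "f \<in> regf X U" "g \<in> regf X U" "\<And>x. x \<in> U \<Longrightarrow> g x \<noteq> 0"
  shows "(\<lambda>x. f x / g x) \<in> regf X U"
  using regf_mult[OF assms(1-3) regf_inverse[OF assms(1,2,4,5)]] by (simp add: divide_inverse)

lemma regf_uminus:
  assumes "ringed_fs X" "openin (topo X) U" "f \<in> regf X U"
  shows "(\<lambda>x. - f x) \<in> regf X U"
  using regf_mult[OF assms(1,2) regf_const[OF assms(1,2), of "-1"] assms(3)] by simp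

lemma regf_sum:
  assumes "ringed_fs X" "openin (topo X) U" "\<And>i. i \<in> I \<Longrightarrow> f i \<in> regf X U"
  shows "(\<lambda>x. \<Sum>i\<in>I. f i x) \<in> regf X U"
  using assms(3)
  by (induction I rule: infinite_finite_induct) (auto intro: regf_const[OF assms(1,2)] regf_add[OF assms(1,2)])

lemma regf_poly_functions:
  assumes "ringed_fs X" "openin (topo X) U" "p \<in> poly_functions C" "\<And>c. c \<in> C \<Longrightarrow> (\<lambda>x. c (\<phi> x)) \<in> regf X U"
  shows "(\<lambda>x. p (\<phi> x)) \<in> regf X U"
  using assms(3)
  by induction (auto intro: assms(4) regf_const[OF assms(1,2)] regf_add[OF assms(1,2)] regf_mult[OF assms(1,2)])

section \<open>Closure properties of polynomial functions\<close>

lemma poly_functions_uminus: "p \<in> poly_functions C \<Longrightarrow> (\<lambda>x. - p x) \<in> poly_functions C"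
  using poly_functions.mult[OF poly_functions.const[of "-1"], of p] by simp

lemma poly_functions_diff:
  "p \<in> poly_functions C \<Longrightarrow> q \<in> poly_functions C \<Longrightarrow> (\<lambda>x. p x - q x) \<in> poly_functions C"
  using poly_functions.add[OF _ poly_functions_uminus, of p C q] by simp

lemma poly_functions_sum:
  assumes "\<And>i. i \<in> I \<Longrightarrow> f i \<in> poly_functions C"
  shows "(\<lambda>x. \<Sum>i\<in>I. f i x) \<in> poly_functions C"
  using assms by (induction I rule: infinite_finite_induct) (auto intro: poly_functions.intros)

lemma poly_functions_compose:
  assumes "p \<in> poly_functions C" "\<And>c. c \<in> C \<Longrightarrow> (\<lambda>x. c (\<phi> x)) \<in> poly_functions C'"
  shows "(\<lambda>x. p (\<phi> x)) \<in> poly_functions C'"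
  using assms(1) by induction (auto intro: assms(2) poly_functions.intros)

section \<open>Affine spaces with the Zariski topology\<close>

lemma pts_affine_space [simp]: "pts (affine_space S C) = S"
proof -
  have "\<exists>p\<in>poly_functions C. p x \<noteq> 0" for x
    by (rule bexI[OF _ poly_functions.const[of 1]]) simp
  then show ?thesis by (simp add: affine_space_def Let_def) blast
qed

lemma openin_affine_nonzero:
  assumes "p \<in> poly_functions C"
  shows "openin (topo (affine_space S C)) {x \<in> S. p x \<noteq> 0}"
  using assms by (auto simp: affine_space_def Let_def intro!: topology_generated_by_Basis)

lemma regf_affineI:
  assumes "\<And>x. x \<in> U \<Longrightarrow> \<exists>W p q. openin (topo (affine_space S C)) W \<and> x \<in> W \<and> W \<subseteq> U \<and>
     p \<in> poly_functions C \<and> q \<in> poly_functions C \<and> (\<forall>y\<in>W. q y \<noteq> 0 \<and> f y = p y / q y)"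
  shows "f \<in> regf (affine_space S C) U"
  unfolding affine_space_def Let_def fspace.simps mem_Collect_eq
proof
  fix x assume "x \<in> U"
  from assms[OF this] show "\<exists>W. openin (topology_generated_by {{x \<in> S. p x \<noteq> 0} |p. p \<in> poly_functions C}) W \<and>
      x \<in> W \<and> W \<subseteq> U \<and> (\<exists>p\<in>poly_functions C. \<exists>q\<in>poly_functions C. \<forall>y\<in>W. q y \<noteq> 0 \<and> f y = p y / q y)"
    unfolding affine_space_def Let_def fspace.simps by (elim exE) (rule exI, blast)
qed

lemma regf_affineE:
  assumes "f \<in> regf (affine_space S C) U" "x \<in> U"
  obtains W p q where "openin (topo (affine_space S C)) W" "x \<in> W" "W \<subseteq> U"
    "p \<in> poly_functions C" "q \<in> poly_functions C" "\<forall>y\<in>W. q y \<noteq> 0 \<and> f y = p y / q y"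
  using assms(1)[unfolded affine_space_def Let_def fspace.simps mem_Collect_eq, rule_format, OF assms(2)]
  unfolding affine_space_def Let_def fspace.simps by blast

lemma regf_affine_poly:
  assumes "openin (topo (affine_space S C)) U" "p \<in> poly_functions C"
  shows "p \<in> regf (affine_space S C) U" proof (rule regf_affineI)
  fix x assume "x \<in> U"
  show "\<exists>W p' q. openin (topo (affine_space S C)) W \<and> x \<in> W \<and> W \<subseteq> U \<and>
     p' \<in> poly_functions C \<and> q \<in> poly_functions C \<and> (\<forall>y\<in>W. q y \<noteq> 0 \<and> p y = p' y / q y)"
    by (rule exI[of _ U], rule exI[of _ p], rule exI[of _ "\<lambda>_. 1"])
       (use assms \<open>x \<in> U\<close> in \<open>auto intro: poly_functions.const\<close>)
qed

lemma ringed_affine_space: "ringed_fs (affine_space S C)"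
proof -
  let ?A = "affine_space S C"
  have sub: "U \<subseteq> S" if "openin (topo ?A) U" for U
    using openin_subset[OF that] by simp
  have restrict: "f \<in> regf ?A W" if W: "openin (topo ?A) W" and WU: "W \<subseteq> U" and f: "f \<in> regf ?A U" for U W f proof (rule regf_affineI)
    fix x assume "x \<in> W"
    obtain W' p q where "openin (topo ?A) W'" "x \<in> W'" "W' \<subseteq> U" "p \<in> poly_functions C"
      "q \<in> poly_functions C" "\<forall>y\<in>W'. q y \<noteq> 0 \<and> f y = p y / q y"
      by (rule regf_affineE[OF f subsetD[OF WU \<open>x \<in> W\<close>]])
    then show "\<exists>W' p q. openin (topo ?A) W' \<and> x \<in> W' \<and> W' \<subseteq> W \<and>
        p \<in> poly_functions C \<and> q \<in> poly_functions C \<and> (\<forall>y\<in>W'. q y \<noteq> 0 \<and> f y = p y / q y)"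
      by (intro exI[of _ "W' \<inter> W"] exI[of _ p] exI[of _ q])
         (use \<open>x \<in> W\<close> W in auto)
  qed
  \<comment> \<open>One neighbourhood on which both functions are fractions; sums and products then
    only need arithmetic of fractions.\<close>
  have binop: "\<exists>W p q p' q'. openin (topo ?A) W \<and> x \<in> W \<and> W \<subseteq> U \<and>
      p \<in> poly_functions C \<and> q \<in> poly_functions C \<and> p' \<in> poly_functions C \<and> q' \<in> poly_functions C \<and>
      (\<forall>y\<in>W. q y \<noteq> 0 \<and> f y = p y / q y \<and> q' y \<noteq> 0 \<and> g y = p' y / q' y)"
    if f: "f \<in> regf ?A U" and g: "g \<in> regf ?A U" and x: "x \<in> U" for f g U x
  proof -
    obtain W p q where 1: "openin (topo ?A) W" "x \<in> W" "W \<subseteq> U" "p \<in> poly_functions C"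
      "q \<in> poly_functions C" "\<forall>y\<in>W. q y \<noteq> 0 \<and> f y = p y / q y"
      by (rule regf_affineE[OF f x])
    obtain W' p' q' where 2: "openin (topo ?A) W'" "x \<in> W'" "W' \<subseteq> U" "p' \<in> poly_functions C"
      "q' \<in> poly_functions C" "\<forall>y\<in>W'. q' y \<noteq> 0 \<and> g y = p' y / q' y"
      by (rule regf_affineE[OF g x])
    show ?thesis
    proof (intro exI conjI ballI)
      show "openin (topo ?A) (W \<inter> W')" "x \<in> W \<inter> W'" "W \<inter> W' \<subseteq> U" using 1(1-3) 2(1-3) by auto
      show "p \<in> poly_functions C" "q \<in> poly_functions C" "p' \<in> poly_functions C" "q' \<in> poly_functions C"
        by (fact 1 2)+
      fix y assume "y \<in> W \<inter> W'"
      then have y: "y \<in> W" "y \<in> W'" by auto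
      show "q y \<noteq> 0" "f y = p y / q y" using bspec[OF 1(6) y(1)] by auto
      show "q' y \<noteq> 0" "g y = p' y / q' y" using bspec[OF 2(6) y(2)] by auto
    qed
  qed
  have nonzero: "openin (topo ?A) {x \<in> U. f x \<noteq> 0}" if U: "openin (topo ?A) U" and f: "f \<in> regf ?A U" for U f
  proof (subst openin_subopen, intro ballI)
    fix x assume x: "x \<in> {x \<in> U. f x \<noteq> 0}"
    obtain W p q where 1: "openin (topo ?A) W" "x \<in> W" "W \<subseteq> U" "p \<in> poly_functions C"
      "q \<in> poly_functions C" "\<forall>y\<in>W. q y \<noteq> 0 \<and> f y = p y / q y"
      using x by (auto elim: regf_affineE[OF f])
    have "openin (topo ?A) (W \<inter> {x \<in> S. p x \<noteq> 0})"
      using 1 openin_affine_nonzero by blast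
    then show "\<exists>T. openin (topo ?A) T \<and> x \<in> T \<and> T \<subseteq> {x \<in> U. f x \<noteq> 0}"
      by (intro exI[of _ "W \<inter> {x \<in> S. p x \<noteq> 0}"]) (use 1 x sub[OF 1(1)] in auto)
  qed
  show ?thesis
  proof (rule ringed_fsI)
    show "f \<in> regf ?A W" if "openin (topo ?A) W" "W \<subseteq> U" "f \<in> regf ?A U" for U W f
      using restrict that by blast
  next
    fix U f
    assume U: "openin (topo ?A) U" and loc: "\<And>x. x \<in> U \<Longrightarrow> \<exists>W g. openin (topo ?A) W \<and> x \<in> W \<and> W \<subseteq> U \<and> g \<in> regf ?A W \<and> (\<forall>y\<in>W. f y = g y)"
    show "f \<in> regf ?A U" proof (rule regf_affineI)
      fix x assume "x \<in> U"
      then obtain W g where W: "openin (topo ?A) W" "x \<in> W" "W \<subseteq> U" "g \<in> regf ?A W" "\<forall>y\<in>W. f y = g y"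
        using loc by blast
      obtain W' p q where "openin (topo ?A) W'" "x \<in> W'" "W' \<subseteq> W" "p \<in> poly_functions C"
        "q \<in> poly_functions C" "\<forall>y\<in>W'. q y \<noteq> 0 \<and> g y = p y / q y"
        by (rule regf_affineE[OF W(4,2) ])
      then show "\<exists>W p q. openin (topo ?A) W \<and> x \<in> W \<and> W \<subseteq> U \<and>
          p \<in> poly_functions C \<and> q \<in> poly_functions C \<and> (\<forall>y\<in>W. q y \<noteq> 0 \<and> f y = p y / q y)"
        by (intro exI[of _ W'] exI[of _ p] exI[of _ q]) (use W in auto)
    qed
  next
    show "(\<lambda>_. c) \<in> regf ?A U" if "openin (topo ?A) U" for U c
      by (rule regf_affine_poly[OF that poly_functions.const])
  next
    fix U f g assume fg: "f \<in> regf ?A U" "g \<in> regf ?A U"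
    show "(\<lambda>x. f x + g x) \<in> regf ?A U" proof (rule regf_affineI)
      fix x assume "x \<in> U"
      from binop[OF fg this] obtain W p q p' q' where W: "openin (topo ?A) W" "x \<in> W" "W \<subseteq> U"
         "p \<in> poly_functions C" "q \<in> poly_functions C" "p' \<in> poly_functions C" "q' \<in> poly_functions C"
         "\<forall>y\<in>W. q y \<noteq> 0 \<and> f y = p y / q y \<and> q' y \<noteq> 0 \<and> g y = p' y / q' y" by blast
      then show "\<exists>W a b. openin (topo ?A) W \<and> x \<in> W \<and> W \<subseteq> U \<and>
         a \<in> poly_functions C \<and> b \<in> poly_functions C \<and> (\<forall>y\<in>W. b y \<noteq> 0 \<and> f y + g y = a y / b y)"
        by (intro exI[of _ W] exI[of _ "\<lambda>y. p y * q' y + p' y * q y"] exI[of _ "\<lambda>y. q y * q' y"])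
           (auto intro!: poly_functions.add poly_functions.mult simp: add_frac_eq)
    qed
    show "(\<lambda>x. f x * g x) \<in> regf ?A U" proof (rule regf_affineI)
      fix x assume "x \<in> U"
      from binop[OF fg this] obtain W p q p' q' where W: "openin (topo ?A) W" "x \<in> W" "W \<subseteq> U"
         "p \<in> poly_functions C" "q \<in> poly_functions C" "p' \<in> poly_functions C" "q' \<in> poly_functions C"
         "\<forall>y\<in>W. q y \<noteq> 0 \<and> f y = p y / q y \<and> q' y \<noteq> 0 \<and> g y = p' y / q' y" by blast
      then show "\<exists>W a b. openin (topo ?A) W \<and> x \<in> W \<and> W \<subseteq> U \<and>
         a \<in> poly_functions C \<and> b \<in> poly_functions C \<and> (\<forall>y\<in>W. b y \<noteq> 0 \<and> f y * g y = a y / b y)"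
        by (intro exI[of _ W] exI[of _ "\<lambda>y. p y * p' y"] exI[of _ "\<lambda>y. q y * q' y"])
           (auto intro!: poly_functions.mult)
    qed
  next
    show "openin (topo ?A) {x \<in> U. f x \<noteq> 0}" if "openin (topo ?A) U" "f \<in> regf ?A U" for U f
      by (rule nonzero[OF that])
    fix U f assume U: "openin (topo ?A) U" and f: "f \<in> regf ?A U"
    let ?U = "{x \<in> U. f x \<noteq> 0}"
    have f': "f \<in> regf ?A ?U" using restrict[OF nonzero[OF U f] _ f] by auto
    show "(\<lambda>x. inverse (f x)) \<in> regf ?A ?U" proof (rule regf_affineI)
      fix x assume "x \<in> ?U"
      then obtain W p q where W: "openin (topo ?A) W" "x \<in> W" "W \<subseteq> ?U" "p \<in> poly_functions C"
        "q \<in> poly_functions C" "\<forall>y\<in>W. q y \<noteq> 0 \<and> f y = p y / q y"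
        by (rule regf_affineE[OF f'])
      then have "\<forall>y\<in>W. p y \<noteq> 0" by force
      with W show "\<exists>W a b. openin (topo ?A) W \<and> x \<in> W \<and> W \<subseteq> ?U \<and>
         a \<in> poly_functions C \<and> b \<in> poly_functions C \<and> (\<forall>y\<in>W. b y \<noteq> 0 \<and> inverse (f y) = a y / b y)"
        by (intro exI[of _ W] exI[of _ q] exI[of _ p]) auto
    qed
  qed
qed

section \<open>Induced structures on subsets\<close>

lemma topo_subspace_fs [simp]: "topo (subspace_fs X S) = subtopology (topo X) S"
  by (simp add: subspace_fs_def)

lemma regf_subspaceI:
  assumes "\<And>x. x \<in> U \<Longrightarrow> \<exists>W g. openin (topo X) W \<and> x \<in> W \<and> g \<in> regf X W \<and> (\<forall>y\<in>W \<inter> U. f y = g y)"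
  shows "f \<in> regf (subspace_fs X S) U"
  unfolding subspace_fs_def fspace.simps mem_Collect_eq
proof
  fix x assume "x \<in> U"
  from assms[OF this] show "\<exists>W. openin (topo X) W \<and> x \<in> W \<and> (\<exists>g\<in>regf X W. \<forall>y\<in>W \<inter> U. f y = g y)"
    by (elim exE) (rule exI, blast)
qed

lemma regf_subspaceE:
  assumes "f \<in> regf (subspace_fs X S) U" "x \<in> U"
  obtains W g where "openin (topo X) W" "x \<in> W" "g \<in> regf X W" "\<forall>y\<in>W \<inter> U. f y = g y"
  using assms(1)[unfolded subspace_fs_def fspace.simps mem_Collect_eq, rule_format, OF assms(2)] by blast

lemma ringed_subspace:
  assumes X: "ringed_fs X"
  shows "ringed_fs (subspace_fs X S)"
proof -
  let ?Y = "subspace_fs X S"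
  have restrict: "f \<in> regf ?Y W" if WU: "W \<subseteq> U" and f: "f \<in> regf ?Y U" for U W f proof (rule regf_subspaceI)
    fix x assume "x \<in> W"
    obtain W' g where "openin (topo X) W'" "x \<in> W'" "g \<in> regf X W'" "\<forall>y\<in>W' \<inter> U. f y = g y"
      by (rule regf_subspaceE[OF f subsetD[OF WU \<open>x \<in> W\<close>]])
    then show "\<exists>W' g. openin (topo X) W' \<and> x \<in> W' \<and> g \<in> regf X W' \<and> (\<forall>y\<in>W' \<inter> W. f y = g y)"
      using that by blast
  qed
  have binop: "\<exists>W f' g'. openin (topo X) W \<and> x \<in> W \<and> f' \<in> regf X W \<and> g' \<in> regf X W \<and>
      (\<forall>y\<in>W \<inter> U. f y = f' y \<and> g y = g' y)"
    if f: "f \<in> regf ?Y U" and g: "g \<in> regf ?Y U" and x: "x \<in> U" for f g U x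
  proof -
    obtain W f' where 1: "openin (topo X) W" "x \<in> W" "f' \<in> regf X W" "\<forall>y\<in>W \<inter> U. f y = f' y"
      by (rule regf_subspaceE[OF f x])
    obtain W' g' where 2: "openin (topo X) W'" "x \<in> W'" "g' \<in> regf X W'" "\<forall>y\<in>W' \<inter> U. g y = g' y"
      by (rule regf_subspaceE[OF g x])
    show ?thesis
      by (rule exI[of _ "W \<inter> W'"], intro exI[of _ f'] exI[of _ g'])
         (use 1 2 in \<open>auto intro: regf_restrict[OF X]\<close>)
  qed
  have nonzero: "openin (topo ?Y) {x \<in> U. f x \<noteq> 0}" if U: "openin (topo ?Y) U" and f: "f \<in> regf ?Y U" for U f
  proof (subst openin_subopen, intro ballI)
    fix x assume x: "x \<in> {x \<in> U. f x \<noteq> 0}"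
    obtain W g where 1: "openin (topo X) W" "x \<in> W" "g \<in> regf X W" "\<forall>y\<in>W \<inter> U. f y = g y"
      using x by (auto elim: regf_subspaceE[OF f])
    obtain U' where U': "openin (topo X) U'" "U = U' \<inter> S"
      using U by (auto simp: openin_subtopology)
    have "openin (topo X) (U' \<inter> {x \<in> W. g x \<noteq> 0})"
      using U' 1 openin_nonzero[OF X] by blast
    moreover have "{x \<in> W. g x \<noteq> 0} \<inter> U = (U' \<inter> {x \<in> W. g x \<noteq> 0}) \<inter> S" using U' by auto
    ultimately have "openin (topo ?Y) ({x \<in> W. g x \<noteq> 0} \<inter> U)"
      by (auto simp: openin_subtopology)
    then show "\<exists>T. openin (topo ?Y) T \<and> x \<in> T \<and> T \<subseteq> {x \<in> U. f x \<noteq> 0}"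
      by (intro exI[of _ "{x \<in> W. g x \<noteq> 0} \<inter> U"]) (use 1 x in auto)
  qed
  show ?thesis
  proof (rule ringed_fsI)
    show "f \<in> regf ?Y W" if "W \<subseteq> U" "f \<in> regf ?Y U" for U W f
      using restrict that by blast
  next
    fix U f
    assume U: "openin (topo ?Y) U" and loc: "\<And>x. x \<in> U \<Longrightarrow> \<exists>W g. openin (topo ?Y) W \<and> x \<in> W \<and> W \<subseteq> U \<and> g \<in> regf ?Y W \<and> (\<forall>y\<in>W. f y = g y)"
    show "f \<in> regf ?Y U" proof (rule regf_subspaceI)
      fix x assume "x \<in> U"
      then obtain W g where W: "openin (topo ?Y) W" "x \<in> W" "W \<subseteq> U" "g \<in> regf ?Y W" "\<forall>y\<in>W. f y = g y"
        using loc by blast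
      obtain W' g' where W': "openin (topo X) W'" "x \<in> W'" "g' \<in> regf X W'" "\<forall>y\<in>W' \<inter> W. g y = g' y"
        by (rule regf_subspaceE[OF W(4,2) ])
      obtain W0 where W0: "openin (topo X) W0" "W = W0 \<inter> S"
        using W by (auto simp: openin_subtopology)
      \<comment> \<open>\<open>g'\<close> represents \<open>f\<close> only on
        \<open>W' \<inter> W\<close>; as \<open>U\<close> lies in \<open>S\<close>, the trace of
        \<open>W0\<close> on \<open>U\<close> is contained in \<open>W\<close>.\<close>
      have "U \<subseteq> S" using openin_subset[OF U] by auto
      show "\<exists>W g. openin (topo X) W \<and> x \<in> W \<and> g \<in> regf X W \<and> (\<forall>y\<in>W \<inter> U. f y = g y)"
        by (intro exI[of _ "W0 \<inter> W'"] exI[of _ g'])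
           (use W W' W0 \<open>U \<subseteq> S\<close> in \<open>auto intro: regf_restrict[OF X]\<close>)
    qed
  next
    show "(\<lambda>_. c) \<in> regf ?Y U" if "openin (topo ?Y) U" for U c proof (rule regf_subspaceI)
      fix x assume "x \<in> U"
      then have "x \<in> pts X" using openin_subset[OF that] by auto
      then show "\<exists>W g. openin (topo X) W \<and> x \<in> W \<and> g \<in> regf X W \<and> (\<forall>y\<in>W \<inter> U. c = g y)"
        using regf_const[OF X openin_topspace] by blast
    qed
  next
    fix U f g assume fg: "f \<in> regf ?Y U" "g \<in> regf ?Y U"
    show "(\<lambda>x. f x + g x) \<in> regf ?Y U" proof (rule regf_subspaceI)
      fix x assume "x \<in> U"
      from binop[OF fg this] obtain W f' g' where "openin (topo X) W" "x \<in> W" "f' \<in> regf X W" "g' \<in> regf X W"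
         "\<forall>y\<in>W \<inter> U. f y = f' y \<and> g y = g' y" by blast
      then show "\<exists>W k. openin (topo X) W \<and> x \<in> W \<and> k \<in> regf X W \<and> (\<forall>y\<in>W \<inter> U. f y + g y = k y)"
        by (intro exI[of _ W] exI[of _ "\<lambda>y. f' y + g' y"]) (auto intro: regf_add[OF X])
    qed
    show "(\<lambda>x. f x * g x) \<in> regf ?Y U" proof (rule regf_subspaceI)
      fix x assume "x \<in> U"
      from binop[OF fg this] obtain W f' g' where "openin (topo X) W" "x \<in> W" "f' \<in> regf X W" "g' \<in> regf X W"
         "\<forall>y\<in>W \<inter> U. f y = f' y \<and> g y = g' y" by blast
      then show "\<exists>W k. openin (topo X) W \<and> x \<in> W \<and> k \<in> regf X W \<and> (\<forall>y\<in>W \<inter> U. f y * g y = k y)"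
        by (intro exI[of _ W] exI[of _ "\<lambda>y. f' y * g' y"]) (auto intro: regf_mult[OF X])
    qed
  next
    show "openin (topo ?Y) {x \<in> U. f x \<noteq> 0}" if "openin (topo ?Y) U" "f \<in> regf ?Y U" for U f
      by (rule nonzero[OF that])
    fix U f assume U: "openin (topo ?Y) U" and f: "f \<in> regf ?Y U"
    show "(\<lambda>x. inverse (f x)) \<in> regf ?Y {x \<in> U. f x \<noteq> 0}" proof (rule regf_subspaceI)
      fix x assume x: "x \<in> {x \<in> U. f x \<noteq> 0}"
      then obtain W g where W: "openin (topo X) W" "x \<in> W" "g \<in> regf X W" "\<forall>y\<in>W \<inter> U. f y = g y"
        by (auto elim: regf_subspaceE[OF f])
      then show "\<exists>W g. openin (topo X) W \<and> x \<in> W \<and> g \<in> regf X W \<and>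
          (\<forall>y\<in>W \<inter> {x \<in> U. f x \<noteq> 0}. inverse (f y) = g y)"
        by (intro exI[of _ "{x \<in> W. g x \<noteq> 0}"] exI[of _ "\<lambda>y. inverse (g y)"])
           (use x in \<open>auto intro: openin_nonzero[OF X] regf_inverse_nonzero[OF X]\<close>)
    qed
  qed
qed

section \<open>Quotient structures\<close>

lemma topo_quotient_fs [simp]: "topo (quotient_fs X \<pi>) = quotient_topology (topo X) \<pi>"
  by (simp add: quotient_fs_def)

lemma regf_quotient_iff:
  "f \<in> regf (quotient_fs X \<pi>) U \<longleftrightarrow> (\<lambda>x. f (\<pi> x)) \<in> regf X {x \<in> pts X. \<pi> x \<in> U}"
  by (simp add: quotient_fs_def comp_def)

lemma topspace_quotient_topology [simp]: "topspace (quotient_topology T \<pi>) = \<pi> ` topspace T"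
proof
  show "topspace (quotient_topology T \<pi>) \<subseteq> \<pi> ` topspace T"
    using openin_topspace[of "quotient_topology T \<pi>"] unfolding openin_quotient_topology by blast
  have "{x \<in> topspace T. \<pi> x \<in> \<pi> ` topspace T} = topspace T" by auto
  then have "openin (quotient_topology T \<pi>) (\<pi> ` topspace T)" by (simp add: openin_quotient_topology)
  then show "\<pi> ` topspace T \<subseteq> topspace (quotient_topology T \<pi>)" by (rule openin_subset)
qed

lemma ringed_quotient:
  assumes X: "ringed_fs X"
  shows "ringed_fs (quotient_fs X \<pi>)"
proof (rule ringed_fsI)
  let ?Q = "quotient_fs X \<pi>" and ?P = "\<lambda>U. {x \<in> pts X. \<pi> x \<in> U}"
  have P: "openin (topo X) (?P U)" if "openin (topo ?Q) U" for U
    using that by (simp add: openin_quotient_topology)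
  have Pnz: "?P {y \<in> U. f y \<noteq> 0} = {x \<in> ?P U. f (\<pi> x) \<noteq> 0}" for U f by auto
  {
    fix U W f assume "openin (topo ?Q) U" "openin (topo ?Q) W" "W \<subseteq> U" "f \<in> regf ?Q U"
    then show "f \<in> regf ?Q W" unfolding regf_quotient_iff
      by (rule_tac regf_restrict[OF X _ P P]) auto
  next
    fix U f
    assume U: "openin (topo ?Q) U" and loc: "\<And>x. x \<in> U \<Longrightarrow> \<exists>W g. openin (topo ?Q) W \<and> x \<in> W \<and> W \<subseteq> U \<and> g \<in> regf ?Q W \<and> (\<forall>y\<in>W. f y = g y)"
    show "f \<in> regf ?Q U" unfolding regf_quotient_iff
    proof (rule regf_local[OF X P[OF U]])
      fix x assume "x \<in> ?P U"
      then obtain W g where W: "openin (topo ?Q) W" "\<pi> x \<in> W" "W \<subseteq> U" "g \<in> regf ?Q W" "\<forall>y\<in>W. f y = g y"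
        using loc[of "\<pi> x"] by blast
      then show "\<exists>W g. openin (topo X) W \<and> x \<in> W \<and> W \<subseteq> ?P U \<and> g \<in> regf X W \<and> (\<forall>y\<in>W. f (\<pi> y) = g y)"
        by (intro exI[of _ "?P W"] exI[of _ "\<lambda>y. g (\<pi> y)"])
           (use \<open>x \<in> ?P U\<close> in \<open>auto simp: P regf_quotient_iff openin_quotient_topology\<close>)
    qed
  next
    show "(\<lambda>_. c) \<in> regf ?Q U" if "openin (topo ?Q) U" for U c
      unfolding regf_quotient_iff using regf_const[OF X P[OF that]] .
    show "(\<lambda>x. f x + g x) \<in> regf ?Q U" "(\<lambda>x. f x * g x) \<in> regf ?Q U"
      if "openin (topo ?Q) U" "f \<in> regf ?Q U" "g \<in> regf ?Q U" for U f g
      using that P unfolding regf_quotient_iff by (auto intro: regf_add[OF X] regf_mult[OF X])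
    show "(\<lambda>x. inverse (f x)) \<in> regf ?Q {y \<in> U. f y \<noteq> 0}"
      if "openin (topo ?Q) U" "f \<in> regf ?Q U" for U f
      using regf_inverse_nonzero[OF X P[OF that(1)]] that(2) unfolding regf_quotient_iff Pnz by blast
    show "openin (topo ?Q) {y \<in> U. f y \<noteq> 0}"
      if U: "openin (topo ?Q) U" "f \<in> regf ?Q U" for U f
      using openin_nonzero[OF X P[OF that(1)]] that unfolding regf_quotient_iff
      by (auto simp only: topo_quotient_fs openin_quotient_topology Pnz)
  }
qed

section \<open>Morphisms\<close>

lemma morphismI:
  assumes "continuous_map (topo X) (topo Y) \<phi>"
    and "\<And>V f. openin (topo Y) V \<Longrightarrow> f \<in> regf Y V \<Longrightarrow> (\<lambda>x. f (\<phi> x)) \<in> regf X {x \<in> pts X. \<phi> x \<in> V}"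
  shows "morphism X Y \<phi>"
  using assms by (auto simp: morphism_def comp_def)

lemma
  assumes "morphism X Y \<phi>"
  shows morphism_continuous: "continuous_map (topo X) (topo Y) \<phi>"
    and morphism_regf: "openin (topo Y) V \<Longrightarrow> f \<in> regf Y V \<Longrightarrow> (\<lambda>x. f (\<phi> x)) \<in> regf X {x \<in> pts X. \<phi> x \<in> V}"
    and morphism_openin: "openin (topo Y) V \<Longrightarrow> openin (topo X) {x \<in> pts X. \<phi> x \<in> V}"
    and morphism_pts: "x \<in> pts X \<Longrightarrow> \<phi> x \<in> pts Y"
  using assms by (auto simp: morphism_def comp_def continuous_map_def)

lemma morphism_regf_global:
  assumes "morphism X Y \<phi>" "f \<in> regf Y (pts Y)"
  shows "(\<lambda>x. f (\<phi> x)) \<in> regf X (pts X)"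
proof -
  have "{x \<in> pts X. \<phi> x \<in> pts Y} = pts X" using morphism_pts[OF assms(1)] by auto
  then show ?thesis using morphism_regf[OF assms(1) openin_topspace assms(2)] by simp
qed

lemma morphism_compose:
  assumes "morphism X Y \<phi>" "morphism Y Z \<psi>"
  shows "morphism X Z (\<lambda>x. \<psi> (\<phi> x))"
proof (rule morphismI)
  show "continuous_map (topo X) (topo Z) (\<lambda>x. \<psi> (\<phi> x))"
    using continuous_map_compose[OF morphism_continuous[OF assms(1)] morphism_continuous[OF assms(2)]]
    by (simp add: comp_def)
  fix V f assume V: "openin (topo Z) V" "f \<in> regf Z V"
  have "{x \<in> pts X. \<phi> x \<in> {y \<in> pts Y. \<psi> y \<in> V}} = {x \<in> pts X. \<psi> (\<phi> x) \<in> V}"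
    using morphism_pts[OF assms(1)] by auto
  then show "(\<lambda>x. f (\<psi> (\<phi> x))) \<in> regf X {x \<in> pts X. \<psi> (\<phi> x) \<in> V}"
    using morphism_regf[OF assms(1) morphism_openin[OF assms(2) V(1)] morphism_regf[OF assms(2) V]] by simp
qed

lemma morphism_cong:
  assumes "ringed_fs X" "morphism X Y \<phi>" "\<And>x. x \<in> pts X \<Longrightarrow> \<phi> x = \<psi> x"
  shows "morphism X Y \<psi>"
proof (rule morphismI)
  show "continuous_map (topo X) (topo Y) \<psi>"
    using continuous_map_eq[OF morphism_continuous[OF assms(2)]] assms(3) by blast
  fix V f assume V: "openin (topo Y) V" "f \<in> regf Y V"
  have eq: "{x \<in> pts X. \<psi> x \<in> V} = {x \<in> pts X. \<phi> x \<in> V}" using assms(3) by auto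
  show "(\<lambda>x. f (\<psi> x)) \<in> regf X {x \<in> pts X. \<psi> x \<in> V}"
    unfolding eq
    by (rule regf_cong[OF assms(1) morphism_openin[OF assms(2) V(1)] morphism_regf[OF assms(2) V]])
       (use assms(3) in auto)
qed

lemma morphism_inclusion: "morphism (subspace_fs X S) X (\<lambda>x. x)"
  by (rule morphismI) (auto intro!: regf_subspaceI)

text \<open>Universal property of the induced structure: a function on the subset extends locally to
  the ambient space, where \<open>\<phi>\<close> can pull it back.\<close>

lemma morphism_to_subspace:
  assumes X: "ringed_fs X" and \<phi>: "morphism X Y \<phi>" and S: "\<And>x. x \<in> pts X \<Longrightarrow> \<phi> x \<in> S"
  shows "morphism X (subspace_fs Y S) \<phi>"
proof (rule morphismI)
  show cont: "continuous_map (topo X) (topo (subspace_fs Y S)) \<phi>"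
    using morphism_continuous[OF \<phi>] S by (auto simp: continuous_map_in_subtopology)
  fix V f assume V: "openin (topo (subspace_fs Y S)) V" "f \<in> regf (subspace_fs Y S) V"
  let ?U = "{x \<in> pts X. \<phi> x \<in> V}"
  have U: "openin (topo X) ?U" using cont V(1) by (auto simp: continuous_map_def)
  show "(\<lambda>x. f (\<phi> x)) \<in> regf X ?U"
  proof (rule regf_local[OF X U])
    fix x assume x: "x \<in> ?U"
    then obtain W g where W: "openin (topo Y) W" "\<phi> x \<in> W" "g \<in> regf Y W" "\<forall>y\<in>W \<inter> V. f y = g y"
      by (auto elim: regf_subspaceE[OF V(2)])
    have "(\<lambda>x. g (\<phi> x)) \<in> regf X {x \<in> pts X. \<phi> x \<in> W}" by (rule morphism_regf[OF \<phi> W(1,3)])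
    then have "(\<lambda>x. g (\<phi> x)) \<in> regf X ({x \<in> pts X. \<phi> x \<in> W} \<inter> ?U)"
      by (rule regf_restrict[OF X]) (use morphism_openin[OF \<phi> W(1)] U in auto)
    then show "\<exists>W g. openin (topo X) W \<and> x \<in> W \<and> W \<subseteq> ?U \<and> g \<in> regf X W \<and> (\<forall>y\<in>W. f (\<phi> y) = g y)"
      by (intro exI[of _ "{x \<in> pts X. \<phi> x \<in> W} \<inter> ?U"] exI[of _ "\<lambda>x. g (\<phi> x)"])
         (use W x U morphism_openin[OF \<phi> W(1)] in auto)
  qed
qed

lemma morphism_quotient: "morphism X (quotient_fs X \<pi>) \<pi>"
  by (rule morphismI) (auto simp: regf_quotient_iff continuous_map_def openin_quotient_topology)

text \<open>Universal property of the quotient. It gives morphisms out of an orbit space without any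
  description of the invariant functions.\<close>

lemma morphism_from_quotient:
  assumes "morphism X Y (\<lambda>x. \<phi> (\<pi> x))"
  shows "morphism (quotient_fs X \<pi>) Y \<phi>"
proof -
  have eq: "{x \<in> pts X. \<pi> x \<in> {y \<in> pts (quotient_fs X \<pi>). \<phi> y \<in> V}} = {x \<in> pts X. \<phi> (\<pi> x) \<in> V}" for V
    by auto
  show ?thesis
  proof (rule morphismI)
    show "continuous_map (topo (quotient_fs X \<pi>)) (topo Y) \<phi>"
      unfolding continuous_map_def using morphism_pts[OF assms] morphism_openin[OF assms] eq
      by (auto simp: openin_quotient_topology Pi_iff)
    show "(\<lambda>x. f (\<phi> x)) \<in> regf (quotient_fs X \<pi>) {x \<in> pts (quotient_fs X \<pi>). \<phi> x \<in> V}"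
      if "openin (topo Y) V" "f \<in> regf Y V" for V f
      unfolding regf_quotient_iff eq by (rule morphism_regf[OF assms that])
  qed
qed

text \<open>Regular coordinates suffice: polynomials in them are regular, so basic open sets have
  open preimages and local quotients of polynomials pull back to local quotients of regular
  functions.\<close>

lemma morphism_to_affine:
  assumes X: "ringed_fs X" and S: "\<And>x. x \<in> pts X \<Longrightarrow> \<phi> x \<in> S"
    and C: "\<And>c. c \<in> C \<Longrightarrow> (\<lambda>x. c (\<phi> x)) \<in> regf X (pts X)"
  shows "morphism X (affine_space S C) \<phi>"
proof -
  have poly: "(\<lambda>x. p (\<phi> x)) \<in> regf X (pts X)" if "p \<in> poly_functions C" for p
    by (rule regf_poly_functions[OF X openin_topspace that C])
  have cont: "continuous_map (topo X) (topo (affine_space S C)) \<phi>"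
    unfolding affine_space_def Let_def fspace.simps
  proof (rule continuous_on_generated_topo)
    fix U assume "U \<in> {{x \<in> S. p x \<noteq> 0} |p. p \<in> poly_functions C}"
    then obtain p where p: "p \<in> poly_functions C" "U = {x \<in> S. p x \<noteq> 0}" by blast
    have "\<phi> -` U \<inter> pts X = {x \<in> pts X. p (\<phi> x) \<noteq> 0}" using p S by auto
    then show "openin (topo X) (\<phi> -` U \<inter> pts X)"
      using openin_nonzero[OF X openin_topspace poly[OF p(1)]] by simp
  next
    show "\<phi> ` pts X \<subseteq> \<Union> {{x \<in> S. p x \<noteq> 0} |p. p \<in> poly_functions C}"
      using S pts_affine_space[of S C] by (force simp: affine_space_def Let_def)
  qed
  show ?thesis
  proof (rule morphismI[OF cont])
    fix V f assume V: "openin (topo (affine_space S C)) V" "f \<in> regf (affine_space S C) V"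
    let ?P = "\<lambda>V. {x \<in> pts X. \<phi> x \<in> V}"
    have P: "openin (topo X) (?P V)" if "openin (topo (affine_space S C)) V" for V
      using cont that by (auto simp: continuous_map_def)
    show "(\<lambda>x. f (\<phi> x)) \<in> regf X (?P V)"
    proof (rule regf_local[OF X P[OF V(1)]])
      fix x assume x: "x \<in> ?P V"
      obtain W p q where W: "openin (topo (affine_space S C)) W" "\<phi> x \<in> W" "W \<subseteq> V" "p \<in> poly_functions C"
        "q \<in> poly_functions C" "\<forall>y\<in>W. q y \<noteq> 0 \<and> f y = p y / q y"
        using x by (auto elim: regf_affineE[OF V(2)])
      have "(\<lambda>x. p (\<phi> x) / q (\<phi> x)) \<in> regf X (?P W)"
        by (rule regf_divide[OF X P[OF W(1)]])
           (use W P[OF W(1)] in \<open>auto intro: regf_restrict[OF X poly openin_topspace]\<close>)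
      then show "\<exists>W g. openin (topo X) W \<and> x \<in> W \<and> W \<subseteq> ?P V \<and> g \<in> regf X W \<and> (\<forall>y\<in>W. f (\<phi> y) = g y)"
        by (intro exI[of _ "?P W"] exI[of _ "\<lambda>x. p (\<phi> x) / q (\<phi> x)"]) (use W x P[OF W(1)] in auto)
    qed
  qed
qed

lemma isomorphismI:
  assumes "morphism X Y \<phi>" "morphism Y X \<psi>" "\<And>x. x \<in> pts X \<Longrightarrow> \<psi> (\<phi> x) = x" "\<And>y. y \<in> pts Y \<Longrightarrow> \<phi> (\<psi> y) = y"
  shows "isomorphism X Y \<phi>"
  using assms by (auto simp: isomorphism_def)

section \<open>Products\<close>

lemma tensor_pure: "f \<in> regf X U \<Longrightarrow> g \<in> regf Y V \<Longrightarrow> (\<lambda>(x, y). f x * g y) \<in> tensor_functions X Y U V"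
  unfolding tensor_functions_def
  by (intro CollectI exI[of _ 1] exI[of _ "\<lambda>_. f"] exI[of _ "\<lambda>_. g"]) auto

lemma tensor_zero: "(\<lambda>_. 0) \<in> tensor_functions X Y U V"
  unfolding tensor_functions_def
  by (intro CollectI exI[of _ 0]) auto

lemma tensor_functionsE:
  assumes "h \<in> tensor_functions X Y U V"
  obtains f g and n :: nat where "h = (\<lambda>(x, y). \<Sum>i<n. f i x * g i y)"
    "\<forall>i<n. f i \<in> regf X U \<and> g i \<in> regf Y V"
proof -
  obtain f g and n :: nat where "h = (\<lambda>(x, y). \<Sum>i<n. f i x * g i y) \<and> (\<forall>i<n. f i \<in> regf X U \<and> g i \<in> regf Y V)"
    using assms[unfolded tensor_functions_def, THEN CollectD] by (elim exE)
  then show thesis by (intro that[where n = n and f = f and g = g]) auto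
qed

lemma tensor_add:
  assumes "h \<in> tensor_functions X Y U V" "k \<in> tensor_functions X Y U V"
  shows "(\<lambda>z. h z + k z) \<in> tensor_functions X Y U V"
proof -
  obtain f g and n :: nat where h: "h = (\<lambda>(x, y). \<Sum>i<n. f i x * g i y)"
    and fg: "\<forall>i<n. f i \<in> regf X U \<and> g i \<in> regf Y V"
    by (rule tensor_functionsE[OF assms(1)])
  obtain f' g' and m :: nat where k: "k = (\<lambda>(x, y). \<Sum>i<m. f' i x * g' i y)"
    and fg': "\<forall>i<m. f' i \<in> regf X U \<and> g' i \<in> regf Y V"
    by (rule tensor_functionsE[OF assms(2)])
  \<comment> \<open>The two families of summands are concatenated, the second one shifted by
    \<open>n\<close>.\<close>
  let ?F = "\<lambda>i. if i < n then f i else f' (i - n)" and ?G = "\<lambda>i. if i < n then g i else g' (i - n)"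
  have "(\<Sum>i<n+m. ?F i x * ?G i y) = (\<Sum>i<n. f i x * g i y) + (\<Sum>i<m. f' i x * g' i y)" for x y
    by (induction m) auto
  then have "(\<lambda>z. h z + k z) = (\<lambda>(x, y). \<Sum>i<n+m. ?F i x * ?G i y)"
    by (auto simp: h k)
  then show ?thesis
    unfolding tensor_functions_def using fg fg'
    by (intro CollectI exI[of _ "n + m"] exI[of _ ?F] exI[of _ ?G]) auto
qed

lemma tensor_sum:
  assumes "\<And>i. i \<in> I \<Longrightarrow> f i \<in> tensor_functions X Y U V"
  shows "(\<lambda>z. \<Sum>i\<in>I. f i z) \<in> tensor_functions X Y U V"
  using assms by (induction I rule: infinite_finite_induct) (auto intro: tensor_add tensor_zero)

lemma tensor_mult:
  assumes X: "ringed_fs X" and Y: "ringed_fs Y" and UV: "openin (topo X) U" "openin (topo Y) V"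
    and "h \<in> tensor_functions X Y U V" "k \<in> tensor_functions X Y U V"
  shows "(\<lambda>z. h z * k z) \<in> tensor_functions X Y U V"
proof -
  obtain f g and n :: nat where h: "h = (\<lambda>(x, y). \<Sum>i<n. f i x * g i y)"
    and fg: "\<forall>i<n. f i \<in> regf X U \<and> g i \<in> regf Y V"
    by (rule tensor_functionsE[OF assms(5)])
  obtain f' g' and m :: nat where k: "k = (\<lambda>(x, y). \<Sum>i<m. f' i x * g' i y)"
    and fg': "\<forall>i<m. f' i \<in> regf X U \<and> g' i \<in> regf Y V"
    by (rule tensor_functionsE[OF assms(6)])
  have "(\<lambda>z. h z * k z) = (\<lambda>z. \<Sum>i<n. \<Sum>j<m. (\<lambda>(x, y). (f i x * f' j x) * (g i y * g' j y)) z)"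
    by (rule ext) (simp add: h k sum_product split_beta, simp add: ac_simps)
  moreover have "\<dots> \<in> tensor_functions X Y U V"
    by (intro tensor_sum tensor_pure regf_mult[OF X UV(1)] regf_mult[OF Y UV(2)]) (use fg fg' in auto)
  ultimately show ?thesis by simp
qed

lemma tensor_restrict:
  assumes "ringed_fs X" "ringed_fs Y" "h \<in> tensor_functions X Y U V"
    and "openin (topo X) U" "openin (topo Y) V" "openin (topo X) U'" "openin (topo Y) V'" "U' \<subseteq> U" "V' \<subseteq> V"
  shows "h \<in> tensor_functions X Y U' V'"
proof -
  obtain f g and n :: nat where h: "h = (\<lambda>(x, y). \<Sum>i<n. f i x * g i y)"
    and fg: "\<forall>i<n. f i \<in> regf X U \<and> g i \<in> regf Y V"
    by (rule tensor_functionsE[OF assms(3)])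
  show ?thesis
    unfolding tensor_functions_def
    by (intro CollectI exI[of _ n] exI[of _ f] exI[of _ g])
       (use h fg assms in \<open>auto intro: regf_restrict\<close>)
qed

lemma tensor_const:
  assumes "ringed_fs X" "ringed_fs Y" "openin (topo X) U" "openin (topo Y) V"
  shows "(\<lambda>_. c) \<in> tensor_functions X Y U V"
  using tensor_pure[OF regf_const[OF assms(1,3), of c] regf_const[OF assms(2,4), of 1]]
  by (simp add: case_prod_beta')

abbreviation product_basic :: "'a set \<Rightarrow> 'b set \<Rightarrow> ('a \<times> 'b \<Rightarrow> complex) \<Rightarrow> ('a \<times> 'b) set" where
  "product_basic U V k \<equiv> {z \<in> U \<times> V. k z \<noteq> 0}"

lemma openin_product_basic:
  assumes "openin (topo X) U" "openin (topo Y) V" "k \<in> tensor_functions X Y U V"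
  shows "openin (topo (product_fs X Y)) (product_basic U V k)"
  unfolding product_fs_def fspace.simps by (rule topology_generated_by_Basis) (use assms in blast)

text \<open>A generating family closed under binary intersections is already a basis, so no finite
  intersections occur in the conclusion. It is applied to products and to the Zariski topology,
  where non-vanishing loci intersect in that of the product function.\<close>

lemma openin_generated_basis:
  assumes "openin (topology_generated_by B) W" "x \<in> W" and Int: "\<And>a b. a \<in> B \<Longrightarrow> b \<in> B \<Longrightarrow> a \<inter> b \<in> B"
  obtains b where "b \<in> B" "x \<in> b" "b \<subseteq> W"
proof -
  have "generate_topology_on B W"
    using assms(1) by (rule openin_topology_generated_by)
  then have "\<forall>x\<in>W. \<exists>b\<in>B. x \<in> b \<and> b \<subseteq> W"
  proof induction
    case (Int U V)
    show ?case
    proof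
      fix x assume x: "x \<in> U \<inter> V"
      then obtain a where a: "a \<in> B" "x \<in> a" "a \<subseteq> U" using Int.IH(1) by blast
      obtain b where b: "b \<in> B" "x \<in> b" "b \<subseteq> V" using Int.IH(2) x by blast
      from a b show "\<exists>b\<in>B. x \<in> b \<and> b \<subseteq> U \<inter> V"
        by (intro bexI[of _ "a \<inter> b"] assms(3)) auto
    qed
  next
    case (UN K)
    then show ?case by (meson Union_iff Union_upper subset_trans)
  next
    case (Basis b)
    then show ?case by auto
  qed simp
  then show thesis using assms(2) that by blast
qed

lemma openin_productE:
  assumes X: "ringed_fs X" and Y: "ringed_fs Y" and W: "openin (topo (product_fs X Y)) W" and z: "z \<in> W"
  obtains U V k where "openin (topo X) U" "openin (topo Y) V" "k \<in> tensor_functions X Y U V"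
    "z \<in> product_basic U V k" "product_basic U V k \<subseteq> W"
proof -
  let ?B = "{product_basic U V k |U V k.
                openin (topo X) U \<and> openin (topo Y) V \<and> k \<in> tensor_functions X Y U V}"
  have Int: "a \<inter> b \<in> ?B" if a: "a \<in> ?B" and b: "b \<in> ?B" for a b
  proof -
    obtain U V k where 1: "a = product_basic U V k \<and> openin (topo X) U \<and> openin (topo Y) V \<and> k \<in> tensor_functions X Y U V"
      using CollectD[OF a] by (elim exE)
    obtain U' V' k' where 2: "b = product_basic U' V' k' \<and> openin (topo X) U' \<and> openin (topo Y) V' \<and> k' \<in> tensor_functions X Y U' V'"
      using CollectD[OF b] by (elim exE)
    show ?thesis
    proof (intro CollectI exI conjI)
      show "a \<inter> b = product_basic (U \<inter> U') (V \<inter> V') (\<lambda>z. k z * k' z)" using 1 2 by auto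
      show UV: "openin (topo X) (U \<inter> U')" "openin (topo Y) (V \<inter> V')" using 1 2 by auto
      show "(\<lambda>z. k z * k' z) \<in> tensor_functions X Y (U \<inter> U') (V \<inter> V')"
        by (intro tensor_mult[OF X Y UV] tensor_restrict[OF X Y _ _ _ UV]) (use 1 2 in auto)
    qed
  qed
  obtain b where b: "b \<in> ?B" "z \<in> b" "b \<subseteq> W"
    by (rule openin_generated_basis[OF W[unfolded product_fs_def fspace.simps] z Int])
  obtain U V k where 1: "b = product_basic U V k \<and> openin (topo X) U \<and> openin (topo Y) V \<and> k \<in> tensor_functions X Y U V"
    using CollectD[OF b(1)] by (elim exE)
  show thesis by (rule that[of U V k]) (use 1 b(2,3) in simp_all)
qed

lemma regf_productI:
  assumes "\<And>z. z \<in> W \<Longrightarrow> \<exists>U V h k. openin (topo X) U \<and> openin (topo Y) V \<and>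
     h \<in> tensor_functions X Y U V \<and> k \<in> tensor_functions X Y U V \<and>
     z \<in> product_basic U V k \<and> product_basic U V k \<subseteq> W \<and> (\<forall>w\<in>product_basic U V k. F w = h w / k w)"
  shows "F \<in> regf (product_fs X Y) W"
  unfolding product_fs_def fspace.simps mem_Collect_eq
proof
  fix z assume "z \<in> W"
  from assms[OF this] show "\<exists>U V. openin (topo X) U \<and> openin (topo Y) V \<and>
     (\<exists>h\<in>tensor_functions X Y U V. \<exists>k\<in>tensor_functions X Y U V.
       (z \<in> U \<times> V \<and> k z \<noteq> 0) \<and> product_basic U V k \<subseteq> W \<and> (\<forall>w\<in>product_basic U V k. F w = h w / k w))"
    unfolding mem_Collect_eq by (elim exE conjE) (intro exI conjI bexI)
qed

lemma regf_productE:
  assumes "F \<in> regf (product_fs X Y) W" "z \<in> W"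
  obtains U V h k where "openin (topo X) U" "openin (topo Y) V"
    "h \<in> tensor_functions X Y U V" "k \<in> tensor_functions X Y U V"
    "z \<in> product_basic U V k" "product_basic U V k \<subseteq> W" "\<forall>w\<in>product_basic U V k. F w = h w / k w"
proof -
  have "\<exists>U V. openin (topo X) U \<and> openin (topo Y) V \<and>
     (\<exists>h\<in>tensor_functions X Y U V. \<exists>k\<in>tensor_functions X Y U V.
       z \<in> product_basic U V k \<and> product_basic U V k \<subseteq> W \<and> (\<forall>w\<in>product_basic U V k. F w = h w / k w))"
    using assms(1)[unfolded product_fs_def fspace.simps, THEN CollectD, THEN bspec, OF assms(2)] .
  then show thesis by (elim exE bexE conjE) (rule that)
qed

lemma pts_product:
  assumes X: "ringed_fs X" and Y: "ringed_fs Y"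
  shows "pts (product_fs X Y) = pts X \<times> pts Y"
proof
  show "pts (product_fs X Y) \<subseteq> pts X \<times> pts Y"
  proof
    fix z assume "z \<in> pts (product_fs X Y)"
    from openin_productE[OF X Y openin_topspace this] obtain U V k where
      UV: "openin (topo X) U" "openin (topo Y) V" "z \<in> product_basic U V k" .
    show "z \<in> pts X \<times> pts Y" using openin_subset[OF UV(1)] openin_subset[OF UV(2)] UV(3) by auto
  qed
  have "openin (topo (product_fs X Y)) (product_basic (pts X) (pts Y) (\<lambda>_. 1))"
    by (intro openin_product_basic tensor_const[OF X Y]) auto
  then show "pts X \<times> pts Y \<subseteq> pts (product_fs X Y)" using openin_subset by fastforce
qed

lemma ringed_product:
  assumes X: "ringed_fs X" and Y: "ringed_fs Y"
  shows "ringed_fs (product_fs X Y)"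
proof -
  let ?P = "product_fs X Y" and ?T = "tensor_functions X Y"
  note mult = tensor_mult[OF X Y] and restr = tensor_restrict[OF X Y]
  \<comment> \<open>Two regular functions as fractions on one basic set. The denominators are
    multiplied because the basic set must lie in the non-vanishing locus of each; it is contained in
    the domain of the first function.\<close>
  have common: "\<exists>U V h k h' k'. openin (topo X) U \<and> openin (topo Y) V \<and>
      h \<in> ?T U V \<and> k \<in> ?T U V \<and> h' \<in> ?T U V \<and> k' \<in> ?T U V \<and>
      z \<in> product_basic U V (\<lambda>z. k z * k' z) \<and> product_basic U V (\<lambda>z. k z * k' z) \<subseteq> W \<and>
      (\<forall>w\<in>product_basic U V (\<lambda>z. k z * k' z). F w = h w / k w \<and> G w = h' w / k' w)"
    if F: "F \<in> regf ?P W" and G: "G \<in> regf ?P W'" and z: "z \<in> W" "z \<in> W'" for F G W W' z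
  proof -
    obtain U V h k where 1: "openin (topo X) U" "openin (topo Y) V" "h \<in> ?T U V" "k \<in> ?T U V"
      "z \<in> product_basic U V k" "product_basic U V k \<subseteq> W" "\<forall>w\<in>product_basic U V k. F w = h w / k w"
      by (rule regf_productE[OF F z(1)])
    obtain U' V' h' k' where 2: "openin (topo X) U'" "openin (topo Y) V'" "h' \<in> ?T U' V'" "k' \<in> ?T U' V'"
      "z \<in> product_basic U' V' k'" "product_basic U' V' k' \<subseteq> W'" "\<forall>w\<in>product_basic U' V' k'. G w = h' w / k' w"
      by (rule regf_productE[OF G z(2)])
    let ?U = "U \<inter> U'" and ?V = "V \<inter> V'"
    have sub: "product_basic ?U ?V (\<lambda>z. k z * k' z) \<subseteq> product_basic U V k"
      "product_basic ?U ?V (\<lambda>z. k z * k' z) \<subseteq> product_basic U' V' k'" by auto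
    show ?thesis
    proof (intro exI conjI ballI)
      show "openin (topo X) ?U" "openin (topo Y) ?V" using 1 2 by auto
      show "h \<in> ?T ?U ?V" "k \<in> ?T ?U ?V" using 1 2 by (auto intro: restr)
      show "h' \<in> ?T ?U ?V" "k' \<in> ?T ?U ?V" using 1 2 by (auto intro: restr)
      show "z \<in> product_basic ?U ?V (\<lambda>z. k z * k' z)" using 1(5) 2(5) by auto
      show "product_basic ?U ?V (\<lambda>z. k z * k' z) \<subseteq> W" using sub(1) 1(6) by blast
      fix w assume w: "w \<in> product_basic ?U ?V (\<lambda>z. k z * k' z)"
      show "F w = h w / k w" by (rule bspec[OF 1(7) subsetD[OF sub(1) w]])
      show "G w = h' w / k' w" by (rule bspec[OF 2(7) subsetD[OF sub(2) w]])
    qed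
  qed
  \<comment> \<open>Feeding the constant 1 on a smaller open set into \<open>common\<close> as the
    first function cuts the basic set down to that open set; this is how restriction is
    proved.\<close>
  have indicator: "(\<lambda>_. 1) \<in> regf ?P W" if W: "openin (topo ?P) W" for W
  proof (rule regf_productI)
    fix z assume z: "z \<in> W"
    obtain U V k where "openin (topo X) U" "openin (topo Y) V" "k \<in> ?T U V"
      "z \<in> product_basic U V k" "product_basic U V k \<subseteq> W"
      by (rule openin_productE[OF X Y W z])
    then show "\<exists>U V h k. openin (topo X) U \<and> openin (topo Y) V \<and> h \<in> ?T U V \<and> k \<in> ?T U V \<and>
      z \<in> product_basic U V k \<and> product_basic U V k \<subseteq> W \<and> (\<forall>w\<in>product_basic U V k. 1 = h w / k w)"
      by (intro exI[of _ U] exI[of _ V] exI[of _ k]) auto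
  qed
  have restrict: "F \<in> regf ?P W" if W: "openin (topo ?P) W" "W \<subseteq> W'" and F: "F \<in> regf ?P W'" for W W' F
  proof (rule regf_productI)
    fix z assume z: "z \<in> W"
    obtain U V h k h' k' where 1: "openin (topo X) U" "openin (topo Y) V" "h \<in> ?T U V" "k \<in> ?T U V" "k' \<in> ?T U V"
      "z \<in> product_basic U V (\<lambda>z. k' z * k z)" "product_basic U V (\<lambda>z. k' z * k z) \<subseteq> W"
      "\<forall>w\<in>product_basic U V (\<lambda>z. k' z * k z). 1 = h' w / k' w \<and> F w = h w / k w"
      using common[OF indicator[OF W(1)] F z] W(2) z by blast
    show "\<exists>U V h k. openin (topo X) U \<and> openin (topo Y) V \<and> h \<in> ?T U V \<and> k \<in> ?T U V \<and>
      z \<in> product_basic U V k \<and> product_basic U V k \<subseteq> W \<and> (\<forall>w\<in>product_basic U V k. F w = h w / k w)"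
    proof (intro exI conjI ballI)
      show "(\<lambda>w. k' w * h w) \<in> ?T U V" "(\<lambda>w. k' w * k w) \<in> ?T U V" by (intro mult 1)+
      show "F w = k' w * h w / (k' w * k w)" if "w \<in> product_basic U V (\<lambda>w. k' w * k w)" for w
        using 1(8) that by auto
    qed (use 1 in auto)
  qed
  have nonzero: "openin (topo ?P) {z \<in> W. F z \<noteq> 0}" if W: "openin (topo ?P) W" and F: "F \<in> regf ?P W" for W F
  proof (subst openin_subopen, intro ballI)
    fix z assume z: "z \<in> {z \<in> W. F z \<noteq> 0}"
    then have "z \<in> W" by blast
    obtain U V h k where 1: "openin (topo X) U" "openin (topo Y) V" "h \<in> ?T U V" "k \<in> ?T U V"
      "z \<in> product_basic U V k" "product_basic U V k \<subseteq> W" "\<forall>w\<in>product_basic U V k. F w = h w / k w"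
      by (rule regf_productE[OF F \<open>z \<in> W\<close>])
    have "openin (topo ?P) (product_basic U V (\<lambda>z. h z * k z))"
      by (intro openin_product_basic mult 1)
    moreover have "product_basic U V (\<lambda>z. h z * k z) \<subseteq> {z \<in> W. F z \<noteq> 0}"
      using 1(6,7) by auto
    moreover have "z \<in> product_basic U V (\<lambda>z. h z * k z)" using 1(5,7) z by force
    ultimately show "\<exists>T. openin (topo ?P) T \<and> z \<in> T \<and> T \<subseteq> {z \<in> W. F z \<noteq> 0}" by blast
  qed
  show ?thesis
  proof (rule ringed_fsI)
    show "F \<in> regf ?P W" if "openin (topo ?P) W" "W \<subseteq> W'" "F \<in> regf ?P W'" for W W' F
      by (rule restrict[OF that])
  next
    fix W F
    assume W: "openin (topo ?P) W" and loc: "\<And>x. x \<in> W \<Longrightarrow> \<exists>W' g. openin (topo ?P) W' \<and> x \<in> W' \<and> W' \<subseteq> W \<and> g \<in> regf ?P W' \<and> (\<forall>y\<in>W'. F y = g y)"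
    show "F \<in> regf ?P W"
    proof (rule regf_productI)
      fix z assume "z \<in> W"
      from loc[OF this] obtain W' g where W': "openin (topo ?P) W'" "z \<in> W'" "W' \<subseteq> W" "g \<in> regf ?P W'" "\<forall>y\<in>W'. F y = g y"
        by blast
      obtain U V h k where 1: "openin (topo X) U" "openin (topo Y) V" "h \<in> ?T U V" "k \<in> ?T U V"
        "z \<in> product_basic U V k" "product_basic U V k \<subseteq> W'" "\<forall>w\<in>product_basic U V k. g w = h w / k w"
        by (rule regf_productE[OF W'(4,2)])
      show "\<exists>U V h k. openin (topo X) U \<and> openin (topo Y) V \<and> h \<in> ?T U V \<and> k \<in> ?T U V \<and>
        z \<in> product_basic U V k \<and> product_basic U V k \<subseteq> W \<and> (\<forall>w\<in>product_basic U V k. F w = h w / k w)"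
      proof (intro exI conjI ballI)
        show "product_basic U V k \<subseteq> W" using 1(6) W'(3) by blast
        show "F w = h w / k w" if "w \<in> product_basic U V k" for w
          using 1(6,7) that W'(5) by (metis (no_types, lifting) subsetD)
      qed (use 1 in auto)
    qed
  next
    fix W and c :: complex assume W: "openin (topo ?P) W"
    show "(\<lambda>_. c) \<in> regf ?P W"
    proof (rule regf_productI)
      fix z assume z: "z \<in> W"
      obtain U V k where 1: "openin (topo X) U" "openin (topo Y) V" "k \<in> ?T U V"
        "z \<in> product_basic U V k" "product_basic U V k \<subseteq> W"
        by (rule openin_productE[OF X Y W z])
      show "\<exists>U V h k. openin (topo X) U \<and> openin (topo Y) V \<and> h \<in> ?T U V \<and> k \<in> ?T U V \<and>
        z \<in> product_basic U V k \<and> product_basic U V k \<subseteq> W \<and> (\<forall>w\<in>product_basic U V k. c = h w / k w)"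
        by (intro exI[of _ U] exI[of _ V] exI[of _ "\<lambda>z. c * k z"] exI[of _ k])
           (use 1 in \<open>auto intro: mult tensor_const[OF X Y]\<close>)
    qed
  next
    fix W F G assume F: "F \<in> regf ?P W" and G: "G \<in> regf ?P W"
    have *: "\<exists>U V h k h' k'. openin (topo X) U \<and> openin (topo Y) V \<and>
      h \<in> ?T U V \<and> k \<in> ?T U V \<and> h' \<in> ?T U V \<and> k' \<in> ?T U V \<and>
      z \<in> product_basic U V (\<lambda>z. k z * k' z) \<and> product_basic U V (\<lambda>z. k z * k' z) \<subseteq> W \<and>
      (\<forall>w\<in>product_basic U V (\<lambda>z. k z * k' z). F w = h w / k w \<and> G w = h' w / k' w)" if "z \<in> W" for z
      by (rule common[OF F G that that])
    show "(\<lambda>x. F x + G x) \<in> regf ?P W"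
    proof (rule regf_productI)
      fix z assume "z \<in> W"
      from *[OF this] obtain U V h k h' k' where 1: "openin (topo X) U" "openin (topo Y) V"
        "h \<in> ?T U V" "k \<in> ?T U V" "h' \<in> ?T U V" "k' \<in> ?T U V"
        "z \<in> product_basic U V (\<lambda>z. k z * k' z)" "product_basic U V (\<lambda>z. k z * k' z) \<subseteq> W"
        "\<forall>w\<in>product_basic U V (\<lambda>z. k z * k' z). F w = h w / k w \<and> G w = h' w / k' w"
        by (elim exE conjE)
      show "\<exists>U V h k. openin (topo X) U \<and> openin (topo Y) V \<and> h \<in> ?T U V \<and> k \<in> ?T U V \<and>
        z \<in> product_basic U V k \<and> product_basic U V k \<subseteq> W \<and> (\<forall>w\<in>product_basic U V k. F w + G w = h w / k w)"
      proof (intro exI conjI ballI)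
        show "(\<lambda>z. h z * k' z + h' z * k z) \<in> ?T U V" by (intro mult tensor_add 1)
        show "(\<lambda>z. k z * k' z) \<in> ?T U V" by (intro mult 1)
        show "F w + G w = (h w * k' w + h' w * k w) / (k w * k' w)" if "w \<in> product_basic U V (\<lambda>z. k z * k' z)" for w
          using 1(9) that by (auto simp: add_frac_eq)
      qed (use 1 in auto)
    qed
    show "(\<lambda>x. F x * G x) \<in> regf ?P W"
    proof (rule regf_productI)
      fix z assume "z \<in> W"
      from *[OF this] obtain U V h k h' k' where 1: "openin (topo X) U" "openin (topo Y) V"
        "h \<in> ?T U V" "k \<in> ?T U V" "h' \<in> ?T U V" "k' \<in> ?T U V"
        "z \<in> product_basic U V (\<lambda>z. k z * k' z)" "product_basic U V (\<lambda>z. k z * k' z) \<subseteq> W"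
        "\<forall>w\<in>product_basic U V (\<lambda>z. k z * k' z). F w = h w / k w \<and> G w = h' w / k' w"
        by (elim exE conjE)
      show "\<exists>U V h k. openin (topo X) U \<and> openin (topo Y) V \<and> h \<in> ?T U V \<and> k \<in> ?T U V \<and>
        z \<in> product_basic U V k \<and> product_basic U V k \<subseteq> W \<and> (\<forall>w\<in>product_basic U V k. F w * G w = h w / k w)"
      proof (intro exI conjI ballI)
        show "(\<lambda>z. h z * h' z) \<in> ?T U V" by (intro mult 1)
        show "(\<lambda>z. k z * k' z) \<in> ?T U V" by (intro mult 1)
        show "F w * G w = (h w * h' w) / (k w * k' w)" if "w \<in> product_basic U V (\<lambda>z. k z * k' z)" for w
          using 1(9) that by auto
      qed (use 1 in auto)
    qed
  next
    show "openin (topo ?P) {z \<in> W. F z \<noteq> 0}" if "openin (topo ?P) W" "F \<in> regf ?P W" for W F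
      by (rule nonzero[OF that])
    fix W F assume W: "openin (topo ?P) W" and F: "F \<in> regf ?P W"
    show "(\<lambda>z. inverse (F z)) \<in> regf ?P {z \<in> W. F z \<noteq> 0}"
    proof (rule regf_productI)
      fix z assume z: "z \<in> {z \<in> W. F z \<noteq> 0}"
      then have "z \<in> W" by blast
      obtain U V h k where 1: "openin (topo X) U" "openin (topo Y) V" "h \<in> ?T U V" "k \<in> ?T U V"
        "z \<in> product_basic U V k" "product_basic U V k \<subseteq> W" "\<forall>w\<in>product_basic U V k. F w = h w / k w"
        by (rule regf_productE[OF F \<open>z \<in> W\<close>])
      show "\<exists>U V h k. openin (topo X) U \<and> openin (topo Y) V \<and> h \<in> ?T U V \<and> k \<in> ?T U V \<and>
        z \<in> product_basic U V k \<and> product_basic U V k \<subseteq> {z \<in> W. F z \<noteq> 0} \<and>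
        (\<forall>w\<in>product_basic U V k. inverse (F w) = h w / k w)"
      proof (intro exI conjI ballI)
        \<comment> \<open>The inverse of \<open>h / k\<close> is expanded by \<open>k\<close>, so
          that the new denominator \<open>h * k\<close> is nonzero only where the old fraction is
          defined.\<close>
        show "(\<lambda>z. k z * k z) \<in> ?T U V" by (intro mult 1)
        show "(\<lambda>z. h z * k z) \<in> ?T U V" by (intro mult 1)
        show "inverse (F w) = (k w * k w) / (h w * k w)" if "w \<in> product_basic U V (\<lambda>z. h z * k z)" for w
          using 1(7) that by auto
        show "product_basic U V (\<lambda>z. h z * k z) \<subseteq> {z \<in> W. F z \<noteq> 0}" using 1(6,7) by auto
        show "z \<in> product_basic U V (\<lambda>z. h z * k z)" using 1(5,7) z by force
      qed (use 1 in auto)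
    qed
  qed
qed

lemma regf_product_tensor:
  assumes X: "ringed_fs X" and Y: "ringed_fs Y" and U: "openin (topo X) U" and V: "openin (topo Y) V"
    and "h \<in> tensor_functions X Y U V"
  shows "h \<in> regf (product_fs X Y) (U \<times> V)"
proof (rule regf_productI)
  fix z assume "z \<in> U \<times> V"
  then show "\<exists>U' V' h' k. openin (topo X) U' \<and> openin (topo Y) V' \<and>
     h' \<in> tensor_functions X Y U' V' \<and> k \<in> tensor_functions X Y U' V' \<and>
     z \<in> product_basic U' V' k \<and> product_basic U' V' k \<subseteq> U \<times> V \<and> (\<forall>w\<in>product_basic U' V' k. h w = h' w / k w)"
    by (intro exI[of _ U] exI[of _ V] exI[of _ h] exI[of _ "\<lambda>_. 1"])
       (use assms in \<open>auto intro: tensor_const\<close>)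
qed

lemma morphism_fst:
  assumes X: "ringed_fs X" and Y: "ringed_fs Y"
  shows "morphism (product_fs X Y) X fst"
proof (rule morphismI)
  have eq: "{z \<in> pts (product_fs X Y). fst z \<in> U} = U \<times> pts Y" if "openin (topo X) U" for U
    using openin_subset[OF that] by (auto simp: pts_product[OF X Y])
  have "openin (topo (product_fs X Y)) (U \<times> pts Y)" if "openin (topo X) U" for U
    using openin_product_basic[OF that openin_topspace tensor_const[OF X Y that openin_topspace, of 1]] by simp
  then show "continuous_map (topo (product_fs X Y)) (topo X) fst"
    by (auto simp: continuous_map_def pts_product[OF X Y] eq[unfolded pts_product[OF X Y]])
  fix V f assume V: "openin (topo X) V" "f \<in> regf X V"
  show "(\<lambda>z. f (fst z)) \<in> regf (product_fs X Y) {z \<in> pts (product_fs X Y). fst z \<in> V}"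
    unfolding eq[OF V(1)]
    using regf_product_tensor[OF X Y V(1) openin_topspace tensor_pure[OF V(2) regf_const[OF Y openin_topspace, of 1]]]
    by (simp add: case_prod_beta')
qed

lemma morphism_snd:
  assumes X: "ringed_fs X" and Y: "ringed_fs Y"
  shows "morphism (product_fs X Y) Y snd"
proof (rule morphismI)
  have eq: "{z \<in> pts (product_fs X Y). snd z \<in> U} = pts X \<times> U" if "openin (topo Y) U" for U
    using openin_subset[OF that] by (auto simp: pts_product[OF X Y])
  have "openin (topo (product_fs X Y)) (pts X \<times> U)" if "openin (topo Y) U" for U
    using openin_product_basic[OF openin_topspace that tensor_const[OF X Y openin_topspace that, of 1]] by simp
  then show "continuous_map (topo (product_fs X Y)) (topo Y) snd"
    by (auto simp: continuous_map_def pts_product[OF X Y] eq[unfolded pts_product[OF X Y]])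
  fix V f assume V: "openin (topo Y) V" "f \<in> regf Y V"
  show "(\<lambda>z. f (snd z)) \<in> regf (product_fs X Y) {z \<in> pts (product_fs X Y). snd z \<in> V}"
    unfolding eq[OF V(1)]
    using regf_product_tensor[OF X Y openin_topspace V(1) tensor_pure[OF regf_const[OF X openin_topspace, of 1] V(2)]]
    by (simp add: case_prod_beta')
qed

text \<open>Universal property of the product: a tensor pulls back to a sum of products of regular
  functions, hence basic open sets and fractions pull back as well.\<close>

lemma morphism_Pair:
  assumes Z: "ringed_fs Z" and X: "ringed_fs X" and Y: "ringed_fs Y" and a: "morphism Z X a" and b: "morphism Z Y b"
  shows "morphism Z (product_fs X Y) (\<lambda>z. (a z, b z))"
proof -
  let ?c = "\<lambda>z. (a z, b z)" and ?N = "\<lambda>U V. {z \<in> pts Z. a z \<in> U} \<inter> {z \<in> pts Z. b z \<in> V}"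
  have N: "openin (topo Z) (?N U V)" if "openin (topo X) U" "openin (topo Y) V" for U V
    by (intro openin_Int morphism_openin[OF a] morphism_openin[OF b] that)
  have tensor: "(\<lambda>z. k (?c z)) \<in> regf Z (?N U V)"
    if U: "openin (topo X) U" and V: "openin (topo Y) V" and k0: "k \<in> tensor_functions X Y U V" for U V k
  proof -
    obtain f g and n :: nat where k: "k = (\<lambda>(x, y). \<Sum>i<n. f i x * g i y)"
      and fg: "\<forall>i<n. f i \<in> regf X U \<and> g i \<in> regf Y V"
      by (rule tensor_functionsE[OF k0])
    have "(\<lambda>z. \<Sum>i<n. f i (a z) * g i (b z)) \<in> regf Z (?N U V)"
      by (intro regf_sum[OF Z N[OF U V]] regf_mult[OF Z N[OF U V]]
            regf_restrict[OF Z morphism_regf[OF a U] morphism_openin[OF a U] N[OF U V]]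
            regf_restrict[OF Z morphism_regf[OF b V] morphism_openin[OF b V] N[OF U V]])
         (use fg in auto)
    then show ?thesis by (simp add: k)
  qed
  have basic: "openin (topo Z) {z \<in> ?N U V. k (?c z) \<noteq> 0}"
    if "openin (topo X) U" "openin (topo Y) V" "k \<in> tensor_functions X Y U V" for U V k
    by (rule openin_nonzero[OF Z N[OF that(1,2)] tensor[OF that]])
  have cont: "continuous_map (topo Z) (topo (product_fs X Y)) ?c"
    unfolding product_fs_def fspace.simps
  proof (rule continuous_on_generated_topo)
    fix B assume "B \<in> {product_basic U V k |U V k.
                openin (topo X) U \<and> openin (topo Y) V \<and> k \<in> tensor_functions X Y U V}"
    then obtain U V k where "B = product_basic U V k \<and> openin (topo X) U \<and> openin (topo Y) V \<and> k \<in> tensor_functions X Y U V"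
      unfolding mem_Collect_eq by (elim exE)
    then have B: "openin (topo X) U" "openin (topo Y) V" "k \<in> tensor_functions X Y U V"
      "B = product_basic U V k" by simp_all
    have "?c -` B \<inter> pts Z = {z \<in> ?N U V. k (?c z) \<noteq> 0}" using B(4) by auto
    then show "openin (topo Z) (?c -` B \<inter> pts Z)" using basic[OF B(1-3)] by simp
  next
    have "?c ` pts Z \<subseteq> product_basic (pts X) (pts Y) (\<lambda>_. 1)"
      using morphism_pts[OF a] morphism_pts[OF b] by auto
    moreover have "product_basic (pts X) (pts Y) (\<lambda>_. 1) \<in> {product_basic U V k |U V k.
                openin (topo X) U \<and> openin (topo Y) V \<and> k \<in> tensor_functions X Y U V}"
      by (intro CollectI exI conjI) (rule refl openin_topspace tensor_const[OF X Y openin_topspace openin_topspace])+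
    ultimately show "?c ` pts Z \<subseteq> \<Union> {product_basic U V k |U V k.
                openin (topo X) U \<and> openin (topo Y) V \<and> k \<in> tensor_functions X Y U V}" by blast
  qed
  show ?thesis
  proof (rule morphismI[OF cont])
    fix W F assume W: "openin (topo (product_fs X Y)) W" and F: "F \<in> regf (product_fs X Y) W"
    let ?W = "{z \<in> pts Z. ?c z \<in> W}"
    have oW: "openin (topo Z) ?W" using cont W by (auto simp: continuous_map_def)
    show "(\<lambda>z. F (?c z)) \<in> regf Z ?W"
    proof (rule regf_local[OF Z oW])
      fix z assume z: "z \<in> ?W"
      then have "?c z \<in> W" by blast
      obtain U V h k where 1: "openin (topo X) U" "openin (topo Y) V"
        "h \<in> tensor_functions X Y U V" "k \<in> tensor_functions X Y U V"
        "?c z \<in> product_basic U V k" "product_basic U V k \<subseteq> W" "\<forall>w\<in>product_basic U V k. F w = h w / k w"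
        by (rule regf_productE[OF F \<open>?c z \<in> W\<close>])
      let ?B = "{z \<in> ?N U V. k (?c z) \<noteq> 0}"
      have B: "openin (topo Z) ?B" by (rule basic[OF 1(1,2,4)])
      have "(\<lambda>z. h (?c z) / k (?c z)) \<in> regf Z ?B"
        by (rule regf_divide[OF Z B regf_restrict[OF Z tensor[OF 1(1-3)] N[OF 1(1,2)] B]
              regf_restrict[OF Z tensor[OF 1(1,2,4)] N[OF 1(1,2)] B]]) auto
      moreover have "z \<in> ?B" using 1(5) z by auto
      moreover have "?B \<subseteq> ?W" using 1(6) by auto
      moreover have "\<forall>y\<in>?B. F (?c y) = h (?c y) / k (?c y)" using 1(7) by blast
      ultimately show "\<exists>W g. openin (topo Z) W \<and> z \<in> W \<and> W \<subseteq> ?W \<and> g \<in> regf Z W \<and> (\<forall>y\<in>W. F (?c y) = g y)"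
        using B by blast
    qed
  qed
qed

text \<open>If global functions separate points, the locus where \<open>f x - f y\<close> is nonzero
  is a basic open neighbourhood of a given off-diagonal point that avoids the diagonal.\<close>

lemma closedin_diagonal:
  assumes X: "ringed_fs X"
    and sep: "\<And>x y. x \<in> pts X \<Longrightarrow> y \<in> pts X \<Longrightarrow> x \<noteq> y \<Longrightarrow> \<exists>f\<in>regf X (pts X). f x \<noteq> f y"
  shows "closedin (topo (product_fs X X)) {(x, x) |x. x \<in> pts X}"
  unfolding closedin_def
proof
  let ?D = "{(x, x) |x. x \<in> pts X}"
  show "?D \<subseteq> pts (product_fs X X)" by (auto simp: pts_product[OF X X])
  show "openin (topo (product_fs X X)) (pts (product_fs X X) - ?D)"
    unfolding pts_product[OF X X]
  proof (subst openin_subopen, intro ballI)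
    fix z assume "z \<in> pts X \<times> pts X - ?D"
    then obtain x y where z: "z = (x, y)" "x \<in> pts X" "y \<in> pts X" "x \<noteq> y" by auto
    then obtain f where f: "f \<in> regf X (pts X)" "f x \<noteq> f y" using sep by blast
    \<comment> \<open>The difference \<open>f x - f y\<close> written as a sum of two pure
      tensors.\<close>
    let ?k = "\<lambda>w. (\<lambda>(x, y). f x * 1) w + (\<lambda>(x, y). - 1 * f y) w"
    have "?k \<in> tensor_functions X X (pts X) (pts X)"
      by (intro tensor_add tensor_pure f(1) regf_const[OF X openin_topspace])
    then have "openin (topo (product_fs X X)) (product_basic (pts X) (pts X) ?k)"
      by (intro openin_product_basic openin_topspace)
    then show "\<exists>T. openin (topo (product_fs X X)) T \<and> z \<in> T \<and> T \<subseteq> pts X \<times> pts X - ?D"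
      by (rule exI[of _ "product_basic (pts X) (pts X) ?k", OF conjI]) (use z f in auto)
  qed
qed

text \<open>\<open>variety\<close> and \<open>smooth\<close> ask for charts on
  \<open>subspace_fs X U\<close>. This adapts a global chart to the choice \<open>U = pts X\<close>,
  for which the induced structure need not be literally \<open>X\<close>.\<close>

lemma isomorphism_subspace_pts:
  assumes "isomorphism X Y \<phi>" "ringed_fs Y"
  shows "isomorphism (subspace_fs X (pts X)) Y \<phi>"
proof -
  obtain \<psi> where \<psi>: "morphism X Y \<phi>" "morphism Y X \<psi>" "\<forall>x\<in>pts X. \<psi> (\<phi> x) = x" "\<forall>y\<in>pts Y. \<phi> (\<psi> y) = y"
    using assms(1) by (auto simp: isomorphism_def)
  show ?thesis
  proof (rule isomorphismI)
    show "morphism (subspace_fs X (pts X)) Y \<phi>" by (rule morphism_compose[OF morphism_inclusion \<psi>(1)])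
    show "morphism Y (subspace_fs X (pts X)) \<psi>"
      by (rule morphism_to_subspace[OF assms(2) \<psi>(2) morphism_pts[OF \<psi>(2)]])
  qed (use \<psi> in auto)
qed

lemma variety_affineI:
  assumes X: "ringed_fs X" and Z: "closedin (topo (An m)) Z" and iso: "isomorphism X (subspace_fs (An m) Z) \<phi>"
    and sep: "\<And>x y. x \<in> pts X \<Longrightarrow> y \<in> pts X \<Longrightarrow> x \<noteq> y \<Longrightarrow> \<exists>f\<in>regf X (pts X). f x \<noteq> f y"
  shows "variety X"
  unfolding variety_def
proof (intro conjI ringed_fs_sheaf[OF X] closedin_diagonal[OF X sep] exI[of _ "{pts X}"])
  have "isomorphism (subspace_fs X (pts X)) (subspace_fs (An m) Z) \<phi>"
    by (rule isomorphism_subspace_pts[OF iso]) (simp add: An_def ringed_subspace ringed_affine_space)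
  then show "\<forall>U\<in>{pts X}. openin (topo X) U \<and> affine_variety (subspace_fs X U)"
    unfolding affine_variety_def using Z by blast
qed auto

lemma pts_An [simp]: "pts (An m) = {x. \<forall>i\<ge>m. x i = 0}" and ringed_An: "ringed_fs (An m)"
  by (simp_all add: An_def ringed_affine_space)

lemma closedin_zero_set:
  fixes r :: nat
  assumes "\<And>j. j < r \<Longrightarrow> F j \<in> poly_functions (An_coords m)"
  shows "closedin (topo (An m)) {a \<in> pts (An m). \<forall>j<r. F j a = 0}"
proof -
  have "closedin (topo (An m)) {a \<in> pts (An m). F j a = 0}" if "j < r" for j
  proof -
    have "pts (An m) - {a \<in> pts (An m). F j a = 0} = {a \<in> {x. \<forall>i\<ge>m. x i = 0}. F j a \<noteq> 0}"
      by (auto simp: An_def)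
    then show ?thesis
      using openin_affine_nonzero[OF assms[OF that], of "{x. \<forall>i\<ge>m. x i = 0}"] by (auto simp: closedin_def An_def)
  qed
  moreover have "{a \<in> pts (An m). \<forall>j<r. F j a = 0} =
      pts (An m) \<inter> \<Inter> ((\<lambda>j. {a \<in> pts (An m). F j a = 0}) ` {..<r})" by auto
  moreover have "closedin (topo (An m)) (pts (An m) \<inter> \<Inter> ((\<lambda>j. {a \<in> pts (An m). F j a = 0}) ` {..<r}))"
    if "r > 0"
    using calculation(1) that by (intro closedin_Int closedin_topspace closedin_Inter) auto
  \<comment> \<open>For \<open>r = 0\<close> the family of closed sets is empty, and the zero set is
    the whole affine space.\<close>
  ultimately show ?thesis using closedin_topspace[of "topo (An m)"] by (cases "r = 0") auto
qed

section \<open>Bilinear pairing and the cotangent space\<close>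

text \<open>Evaluation of a covector on a vector: complex bilinear, with no conjugation.\<close>

definition pairing :: "complex^'n \<Rightarrow> complex^'n::finite \<Rightarrow> complex" where
  "pairing a b = (\<Sum>i\<in>UNIV. a $ i * b $ i)"

lemma pairing_add_left: "pairing (a + b) c = pairing a c + pairing b c"
  and pairing_add_right: "pairing a (b + c) = pairing a b + pairing a c"
  and pairing_diff_left: "pairing (a - b) c = pairing a c - pairing b c"
  and pairing_diff_right: "pairing a (b - c) = pairing a b - pairing a c"
  and pairing_minus_left: "pairing (- a) c = - pairing a c"
  and pairing_minus_right: "pairing a (- c) = - pairing a c"
  and pairing_scale_left: "pairing (k *s a) c = k * pairing a c"
  and pairing_scale_right: "pairing a (k *s c) = k * pairing a c"
  and pairing_0_left [simp]: "pairing 0 c = 0"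
  and pairing_0_right [simp]: "pairing a 0 = 0"
  by (simp_all add: pairing_def algebra_simps sum.distrib sum_subtractf sum_distrib_left sum_negf)

lemmas pairing_simps = pairing_add_left pairing_add_right pairing_diff_left pairing_diff_right
  pairing_minus_left pairing_minus_right pairing_scale_left pairing_scale_right

lemma pairing_commute: "pairing a b = pairing b a"
  by (simp add: pairing_def mult.commute)

lemma pairing_vector_matrix: "pairing (a v* M) b = pairing a (M *v b)"
  unfolding pairing_def vector_matrix_mult_def matrix_vector_mult_def
  by (simp add: sum_distrib_left sum_distrib_right mult.assoc) (rule sum.swap)

lemma pairing_axis: "pairing (axis l 1) b = b $ l" "pairing b (axis l 1) = b $ l"
  by (simp_all add: pairing_def axis_def if_distrib if_distribR cong: if_cong)

lemma matrix_vector_scale: "M *v (k *s x) = k *s (M *v x)" for M :: "complex^'n::finite^'m"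
  by (simp add: vec_eq_iff matrix_vector_mult_def sum_distrib_left algebra_simps)

section \<open>The cotangent space as an affine space\<close>

definition TV_coords :: "('n::finite cotangent \<Rightarrow> complex) set" where
  "TV_coords = {(\<lambda>(x, \<alpha>). x $ l) |l. True} \<union> {(\<lambda>(x, \<alpha>). \<alpha> $ l) |l. True}"

lemma TV_eq: "TV = affine_space UNIV TV_coords"
  by (simp add: TV_def TV_coords_def)

lemma pts_TV [simp]: "pts TV = UNIV"
  by (simp add: TV_eq)

lemma ringed_TV: "ringed_fs TV"
  by (simp add: TV_eq ringed_affine_space)

lemma TV_coords_fst: "(\<lambda>z. fst z $ l) \<in> TV_coords" and TV_coords_snd: "(\<lambda>z. snd z $ l) \<in> TV_coords"
  by (auto simp: TV_coords_def case_prod_beta' intro: exI[of _ l])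

lemma TV_coords_cases:
  assumes "c \<in> TV_coords"
  obtains l where "c = (\<lambda>z. fst z $ l)" | l where "c = (\<lambda>z. snd z $ l)"
  using assms by (auto simp: TV_coords_def case_prod_beta')

lemma regf_TV_poly: "p \<in> poly_functions TV_coords \<Longrightarrow> p \<in> regf TV (pts TV)"
  unfolding TV_eq by (rule regf_affine_poly[OF openin_topspace])

lemma regf_TV_fst: "(\<lambda>z. fst z $ l) \<in> regf TV (pts TV)" and regf_TV_snd: "(\<lambda>z. snd z $ l) \<in> regf TV (pts TV)"
  by (intro regf_TV_poly poly_functions.coord TV_coords_fst TV_coords_snd)+

lemma morphism_TV_iff:
  assumes "ringed_fs X"
  shows "morphism X TV \<phi> \<longleftrightarrow> (\<forall>l. (\<lambda>x. fst (\<phi> x) $ l) \<in> regf X (pts X) \<and> (\<lambda>x. snd (\<phi> x) $ l) \<in> regf X (pts X))"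
proof
  assume "morphism X TV \<phi>"
  then show "\<forall>l. (\<lambda>x. fst (\<phi> x) $ l) \<in> regf X (pts X) \<and> (\<lambda>x. snd (\<phi> x) $ l) \<in> regf X (pts X)"
    using morphism_regf_global[of X TV \<phi>] regf_TV_fst regf_TV_snd by blast
next
  assume *: "\<forall>l. (\<lambda>x. fst (\<phi> x) $ l) \<in> regf X (pts X) \<and> (\<lambda>x. snd (\<phi> x) $ l) \<in> regf X (pts X)"
  show "morphism X TV \<phi>"
    unfolding TV_eq by (rule morphism_to_affine[OF assms]) (use * in \<open>auto elim!: TV_coords_cases\<close>)
qed

lemma poly_pairing: "(\<lambda>z. pairing (snd z) (M *v fst z)) \<in> poly_functions TV_coords"
  unfolding pairing_def matrix_vector_mult_def vec_lambda_beta
  by (intro poly_functions_sum poly_functions.mult poly_functions.const poly_functions.coord TV_coords_fst TV_coords_snd)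

text \<open>The coordinates of \<open>V\<close> are indexed by an arbitrary finite type, those of
  \<open>An\<close> by numbers; a fixed enumeration connects the two.\<close>

definition coord_index :: "'n::finite \<Rightarrow> nat" where
  "coord_index = (SOME h. bij_betw h UNIV {0..<CARD('n)})"

lemma bij_coord_index: "bij_betw (coord_index :: 'n::finite \<Rightarrow> nat) UNIV {0..<CARD('n)}"
  unfolding coord_index_def by (rule someI_ex[OF ex_bij_betw_finite_nat]) simp

lemma coord_index_less [simp]: "coord_index (l :: 'n::finite) < CARD('n)"
  using bij_betwE[OF bij_coord_index, rule_format, of l] by simp

lemma inv_coord_index [simp]: "inv coord_index (coord_index l) = l" for l :: "'n::finite"
  using bij_coord_index[where 'n='n] by (auto simp: bij_betw_def)

lemma coord_index_inv: "i < CARD('n) \<Longrightarrow> coord_index (inv coord_index i :: 'n::finite) = i"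
  using bij_coord_index[where 'n='n] by (intro f_inv_into_f) (auto simp: bij_betw_def)

definition decode :: "(nat \<Rightarrow> complex) \<Rightarrow> 'n::finite cotangent" where
  "decode a = (\<chi> l. a (coord_index l), \<chi> l. a (CARD('n) + coord_index l))"

text \<open>The slot after the \<open>2 * CARD('n)\<close> cotangent coordinates holds an additional
  value \<open>r\<close>. In the chart of the total space it will be the inverse of
  \<open>mu\<close>; with \<open>r = 0\<close> the result lies in affine space of dimension
  \<open>2 * CARD('n)\<close>.\<close>

definition encode :: "complex \<Rightarrow> 'n::finite cotangent \<Rightarrow> nat \<Rightarrow> complex" where
  "encode r z i = (if i < CARD('n) then fst z $ inv coord_index i
     else if i < 2 * CARD('n) then snd z $ inv coord_index (i - CARD('n))
     else if i = 2 * CARD('n) then r else 0)"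

lemma fst_decode [simp]: "fst (decode a) $ l = a (coord_index l)"
  and snd_decode [simp]: "snd (decode a :: 'n::finite cotangent) $ l = a (CARD('n) + coord_index l)"
  by (simp_all add: decode_def)

lemma decode_encode [simp]: "decode (encode r z) = z"
  for z :: "'n::finite cotangent"
proof -
  have "CARD('n) + coord_index l < 2 * CARD('n)" for l :: 'n using coord_index_less[of l] by linarith
  then show ?thesis by (simp add: prod_eq_iff vec_eq_iff encode_def)
qed

lemma encode_decode:
  assumes "\<And>i. i > 2 * CARD('n) \<Longrightarrow> a i = 0"
  shows "encode (a (2 * CARD('n))) (decode a :: 'n::finite cotangent) = a"
  by (rule ext) (use assms in \<open>auto simp: encode_def coord_index_inv\<close>)

lemma poly_decode:
  assumes "p \<in> poly_functions (TV_coords :: ('n::finite cotangent \<Rightarrow> complex) set)" "2 * CARD('n) \<le> m"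
  shows "(\<lambda>a. p (decode a)) \<in> poly_functions (An_coords m)"
proof (rule poly_functions_compose[OF assms(1)])
  have less: "coord_index l < m" "CARD('n) + coord_index l < m" for l :: 'n
    using coord_index_less[of l] assms(2) by linarith+
  fix c :: "'n cotangent \<Rightarrow> complex" assume "c \<in> TV_coords"
  then show "(\<lambda>a. c (decode a)) \<in> poly_functions (An_coords m)"
    by (cases rule: TV_coords_cases) (auto simp: An_coords_def intro!: poly_functions.coord less)
qed

lemma morphism_decode:
  assumes "2 * CARD('n) \<le> m"
  shows "morphism (An m) (TV :: 'n::finite cotangent fspace) decode"
proof -
  have *: "(\<lambda>x. c (decode x)) \<in> regf (An m) (pts (An m))" if "c \<in> TV_coords" for c :: "'n cotangent \<Rightarrow> complex"
    unfolding An_def by (rule regf_affine_poly[OF openin_topspace poly_decode[OF poly_functions.coord[OF that] assms]])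
  show ?thesis
    unfolding TV_eq by (rule morphism_to_affine[OF ringed_An UNIV_I *])
qed

lemma morphism_encode:
  assumes X: "ringed_fs X" and \<phi>: "morphism X (TV :: 'n::finite cotangent fspace) \<phi>" and r: "r \<in> regf X (pts X)"
    and m: "\<And>x. x \<in> pts X \<Longrightarrow> encode (r x) (\<phi> x) \<in> pts (An m)"
  shows "morphism X (An m) (\<lambda>x. encode (r x) (\<phi> x))"
  unfolding An_def
proof (rule morphism_to_affine[OF X])
  show "encode (r x) (\<phi> x) \<in> {x. \<forall>i\<ge>m. x i = 0}" if "x \<in> pts X" for x
    using m[OF that] by (simp add: An_def)
  fix c assume "c \<in> An_coords m"
  then obtain i where c: "c = (\<lambda>x. x i)" by (auto simp: An_coords_def)
  have "(\<lambda>x. encode (r x) (\<phi> x) i) \<in> regf X (pts X)"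
    unfolding encode_def using \<phi>[unfolded morphism_TV_iff[OF X]] r regf_const[OF X openin_topspace, of 0]
    by (cases "i < CARD('n)"; cases "i < 2 * CARD('n)"; cases "i = 2 * CARD('n)") simp_all
  then show "(\<lambda>x. c (encode (r x) (\<phi> x))) \<in> regf X (pts X)" by (simp add: c)
qed

text \<open>The differential of \<open>(x, \<alpha>) \<mapsto> \<alpha> M x\<close> at
  \<open>z\<close>, evaluated on \<open>v\<close>.\<close>

definition bilinear_derivative :: "complex^'n^'n \<Rightarrow> 'n::finite cotangent \<Rightarrow> 'n cotangent \<Rightarrow> complex" where
  "bilinear_derivative M z v = pairing (snd v) (M *v fst z) + pairing (snd z) (M *v fst v)"

lemma decode_update:
  "decode (a(i := t)) = (fst (decode a) + (t - a i) *s fst (decode (\<lambda>j. if j = i then 1 else 0)),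
     snd (decode a) + (t - a i) *s snd (decode (\<lambda>j. if j = i then 1 else 0)))"
  by (simp add: prod_eq_iff vec_eq_iff)

text \<open>Along a coordinate line the function is exactly a quadratic polynomial in
  \<open>t - a i\<close>; its linear coefficient is the differential on the corresponding basis
  vector.\<close>

lemma partial_deriv_bilinear:
  "partial_deriv i (\<lambda>a. pairing (snd (decode a)) (M *v fst (decode a)) - k) a =
     bilinear_derivative M (decode a) (decode (\<lambda>j. if j = i then 1 else 0))"
proof -
  let ?z = "decode a" and ?e = "decode (\<lambda>j. if j = i then 1 else 0)"
  have "(\<lambda>t. pairing (snd (decode (a(i := t)))) (M *v fst (decode (a(i := t)))) - k) =
     (\<lambda>t. pairing (snd ?z) (M *v fst ?z) - k + (t - a i) * bilinear_derivative M ?z ?e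
        + (t - a i) * (t - a i) * pairing (snd ?e) (M *v fst ?e))"
    unfolding decode_update
    by (rule ext) (simp add: bilinear_derivative_def pairing_simps matrix_vector_right_distrib matrix_vector_scale algebra_simps)
  moreover have "(\<dots> has_field_derivative bilinear_derivative M ?z ?e) (at (a i))"
    by (auto intro!: derivative_eq_intros)
  ultimately show ?thesis unfolding partial_deriv_def by (simp add: DERIV_imp_deriv)
qed

text \<open>A vector is the combination of the coordinate vectors with its own coordinates as
  coefficients. Thereby a linear relation between rows of the Jacobian matrix can be evaluated on
  any convenient direction.\<close>

lemma bilinear_derivative_encode:
  fixes v :: "'n::finite cotangent"
  shows "(\<Sum>i<2 * CARD('n). encode 0 v i * bilinear_derivative M z (decode (\<lambda>j. if j = i then 1 else 0))) =
    bilinear_derivative M z v"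
proof -
  have less: "CARD('n) + coord_index l < 2 * CARD('n)" "coord_index l < 2 * CARD('n)" for l :: 'n
    using coord_index_less[of l] by linarith+
  let ?e = "\<lambda>i. decode (\<lambda>j. if j = i then 1 else 0) :: 'n cotangent" and ?c = "encode 0 v"
  have f: "(\<Sum>i<2 * CARD('n). ?c i *s fst (?e i)) = fst v" and s: "(\<Sum>i<2 * CARD('n). ?c i *s snd (?e i)) = snd v"
    by (simp_all add: vec_eq_iff if_distrib less sum.delta cong: if_cong)
       (metis decode_encode fst_decode snd_decode)+
  have "(\<Sum>i\<in>I. ?c i * bilinear_derivative M z (?e i)) =
    bilinear_derivative M z (\<Sum>i\<in>I. ?c i *s fst (?e i), \<Sum>i\<in>I. ?c i *s snd (?e i))" if "finite I" for I
    using that by (induction I)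
      (simp_all add: bilinear_derivative_def pairing_simps matrix_vector_right_distrib matrix_vector_scale algebra_simps)
  from this[of "{..<2 * CARD('n)}"] show ?thesis by (simp add: f s)
qed

section \<open>The slice\<close>

text \<open>What the geometry uses of the representation: \<open>E\<close> generates the
  one-parameter group \<open>\<sigma>\<close>, \<open>H_E\<close> is the relation
  \<open>[H, E] = 2 E\<close>, and \<open>H_sigma\<close> is the same relation integrated along the
  group.\<close>

locale slice_data =
  fixes \<sigma> :: "complex \<Rightarrow> complex^'n::finite^'n" and E H :: "complex^'n^'n"
  assumes sigma_0: "\<sigma> 0 = mat 1"
    and sigma_add: "\<sigma> (s + t) = \<sigma> s ** \<sigma> t"
    and sigma_poly: "(\<lambda>t. \<sigma> t $ i $ j) \<in> poly_functions {\<lambda>t. t}"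
    and sigma_deriv: "((\<lambda>t. \<sigma> t $ i $ j) has_field_derivative (\<sigma> t ** E) $ i $ j) (at t)"
    and E_sigma: "E ** \<sigma> t = \<sigma> t ** E"
    and H_sigma: "H *v (\<sigma> t *v x) = \<sigma> t *v (H *v x) + (2 * t) *s (E *v (\<sigma> t *v x))"
    and H_E: "H *v (E *v x) = E *v (H *v x) + 2 *s (E *v x)"
begin

abbreviation act :: "complex \<Rightarrow> 'n cotangent \<Rightarrow> 'n cotangent" where
  "act \<equiv> cotangent_lift \<sigma>"

abbreviation orb :: "'n cotangent \<Rightarrow> 'n cotangent set" where
  "orb \<equiv> Ga_orbit \<sigma>"

definition mu :: "'n cotangent \<Rightarrow> complex" where
  "mu z = pairing (snd z) (E *v fst z)"

definition nu :: "'n cotangent \<Rightarrow> complex" where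
  "nu z = pairing (snd z) (H *v fst z)"

lemma sigma_uminus: "\<sigma> (- t) ** \<sigma> t = mat 1" "\<sigma> t ** \<sigma> (- t) = mat 1"
  using sigma_add[of "- t" t] sigma_add[of t "- t"] by (simp_all add: sigma_0)

lemma matrix_inv_sigma: "matrix_inv (\<sigma> t) = \<sigma> (- t)"
  unfolding matrix_inv_def
proof (rule some_equality)
  show "\<sigma> t ** \<sigma> (- t) = mat 1 \<and> \<sigma> (- t) ** \<sigma> t = mat 1" by (simp add: sigma_uminus)
  fix A assume "\<sigma> t ** A = mat 1 \<and> A ** \<sigma> t = mat 1"
  then have "\<sigma> (- t) ** (\<sigma> t ** A) = \<sigma> (- t)" by simp
  then show "A = \<sigma> (- t)" by (simp add: matrix_mul_assoc sigma_uminus)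
qed

lemma act_eq: "act t z = (\<sigma> t *v fst z, snd z v* \<sigma> (- t))"
  by (simp add: cotangent_lift_def matrix_inv_sigma case_prod_beta)

lemma act_0 [simp]: "act 0 z = z"
  by (simp add: act_eq sigma_0)

lemma act_act: "act s (act t z) = act (s + t) z"
  by (simp add: act_eq sigma_add[symmetric] matrix_vector_mul_assoc vector_matrix_mul_assoc add.commute)

lemma mu_act [simp]: "mu (act t z) = mu z"
  by (simp add: mu_def act_eq pairing_vector_matrix matrix_vector_mul_assoc E_sigma)
     (simp add: matrix_mul_assoc sigma_uminus)

lemma nu_act: "nu (act t z) = nu z + 2 * t * mu z"
proof -
  have "\<sigma> (- t) *v (\<sigma> t *v x) = x" for x by (simp add: matrix_vector_mul_assoc sigma_uminus)
  moreover have "\<sigma> (- t) *v (E *v (\<sigma> t *v x)) = E *v x" for x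
    by (simp add: matrix_vector_mul_assoc E_sigma) (simp add: matrix_mul_assoc sigma_uminus)
  ultimately show ?thesis
    by (simp add: nu_def mu_def act_eq pairing_vector_matrix H_sigma matrix_vector_right_distrib
        matrix_vector_scale pairing_simps)
qed

lemma orb_act [simp]: "orb (act t z) = orb z"
proof -
  have "act s z = act (s - t) (act t z)" for s by (simp add: act_act)
  then have "act s z \<in> range (\<lambda>s. act s (act t z))" for s by (metis rangeI)
  moreover have "act s (act t z) \<in> range (\<lambda>s. act s z)" for s by (simp add: act_act)
  ultimately show ?thesis unfolding orbit_def by blast
qed

text \<open>On the locus where \<open>mu\<close> does not vanish, \<open>tau\<close> is an equivariant map to the additive group
  acting on itself by translation; so \<open>{nu = 0}\<close> meets each orbit exactly once.\<close>

definition tau :: "'n cotangent \<Rightarrow> complex" where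
  "tau z = nu z / (2 * mu z)"

lemma tau_act: "mu z \<noteq> 0 \<Longrightarrow> tau (act t z) = tau z + t"
  by (simp add: tau_def nu_act add_divide_distrib)

definition to_slice :: "'n cotangent \<Rightarrow> 'n cotangent" where
  "to_slice z = act (- tau z) z"

lemma mu_to_slice [simp]: "mu (to_slice z) = mu z"
  by (simp add: to_slice_def)

lemma orb_to_slice [simp]: "orb (to_slice z) = orb z"
  by (simp add: to_slice_def)

lemma nu_to_slice: "mu z \<noteq> 0 \<Longrightarrow> nu (to_slice z) = 0"
  by (simp add: to_slice_def nu_act tau_def)

lemma to_slice_act: "mu z \<noteq> 0 \<Longrightarrow> to_slice (act t z) = to_slice z"
  by (simp add: to_slice_def tau_act act_act)

lemma to_slice_id: "nu z = 0 \<Longrightarrow> to_slice z = z"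
  by (simp add: to_slice_def tau_def)

text \<open>An arbitrary representative may be chosen, because \<open>to_slice\<close> is constant
  on orbits with \<open>mu\<close> nonzero; thus a choice operator still defines an algebraic
  section.\<close>

definition section_pt :: "'n cotangent set \<Rightarrow> 'n cotangent" where
  "section_pt y = to_slice (SOME z. z \<in> y)"

lemma section_pt_orb:
  assumes "mu z \<noteq> 0"
  shows "section_pt (orb z) = to_slice z"
proof -
  have "z \<in> orb z" unfolding orbit_def by (rule range_eqI[of _ _ 0]) simp
  then have "(SOME z'. z' \<in> orb z) \<in> orb z" by (rule someI)
  then obtain t where "(SOME z'. z' \<in> orb z) = act t z" by (auto simp: orbit_def)
  then show ?thesis using assms by (simp add: section_pt_def to_slice_act)
qed

text \<open>The level sets (\<open>B = {\<xi>}\<close>) and the total space (\<open>B = -{0}\<close>) are treated uniformly.\<close>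

definition P :: "complex set \<Rightarrow> 'n cotangent fspace" where
  "P B = subspace_fs TV {z. mu z \<in> B}"

definition X :: "complex set \<Rightarrow> 'n cotangent set fspace" where
  "X B = quotient_fs (P B) orb"

lemma pts_P [simp]: "pts (P B) = {z. mu z \<in> B}"
  by (simp add: P_def)

lemma pts_X [simp]: "pts (X B) = orb ` {z. mu z \<in> B}"
  by (simp add: X_def)

lemma ringed_P: "ringed_fs (P B)"
  by (simp add: P_def ringed_subspace ringed_TV)

lemma ringed_X: "ringed_fs (X B)"
  by (simp add: X_def ringed_quotient ringed_P)

lemma mu_poly: "mu \<in> poly_functions TV_coords" and nu_poly: "nu \<in> poly_functions TV_coords"
  unfolding mu_def[abs_def] nu_def[abs_def] by (rule poly_pairing)+

lemma morphism_P_TV: "morphism (P B) TV (\<lambda>z. z)"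
  unfolding P_def by (rule morphism_inclusion)

lemma morphism_to_P: "ringed_fs Y \<Longrightarrow> morphism Y TV \<phi> \<Longrightarrow> (\<And>y. y \<in> pts Y \<Longrightarrow> mu (\<phi> y) \<in> B) \<Longrightarrow> morphism Y (P B) \<phi>"
  unfolding P_def by (rule morphism_to_subspace) auto

lemma regf_mu_compose: "morphism Y TV \<phi> \<Longrightarrow> (\<lambda>y. mu (\<phi> y)) \<in> regf Y (pts Y)"
  and regf_nu_compose: "morphism Y TV \<phi> \<Longrightarrow> (\<lambda>y. nu (\<phi> y)) \<in> regf Y (pts Y)"
  by (erule morphism_regf_global, intro regf_TV_poly mu_poly nu_poly)+

lemma regf_tau: "0 \<notin> B \<Longrightarrow> tau \<in> regf (P B) (pts (P B))"
  unfolding tau_def[abs_def]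
  by (intro regf_divide[OF ringed_P] regf_mult[OF ringed_P] regf_const[OF ringed_P] openin_topspace
      regf_mu_compose[OF morphism_P_TV] regf_nu_compose[OF morphism_P_TV]) auto

lemma regf_sigma:
  assumes "ringed_fs Y" "t \<in> regf Y (pts Y)"
  shows "(\<lambda>y. \<sigma> (t y) $ i $ j) \<in> regf Y (pts Y)"
  by (rule regf_poly_functions[OF assms(1) openin_topspace sigma_poly]) (use assms(2) in simp)

text \<open>The time may vary with the point. This covers the projection to the slice, with time
  \<open>- tau\<close>, and the trivialisation of the torsor, with the second coordinate as
  time.\<close>

lemma morphism_act:
  assumes Y: "ringed_fs Y" and t: "t \<in> regf Y (pts Y)" and \<phi>: "morphism Y TV \<phi>"
  shows "morphism Y TV (\<lambda>y. act (t y) (\<phi> y))"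
  unfolding morphism_TV_iff[OF Y] act_eq matrix_vector_mult_def vector_matrix_mult_def fst_conv snd_conv vec_lambda_beta
  using \<phi>[unfolded morphism_TV_iff[OF Y]]
  by (intro conjI allI regf_sum[OF Y] regf_mult[OF Y] regf_sigma[OF Y] t openin_topspace regf_uminus[OF Y]) auto

lemma morphism_to_slice: "0 \<notin> B \<Longrightarrow> morphism (P B) TV to_slice"
  unfolding to_slice_def[abs_def]
  by (intro morphism_act ringed_P regf_uminus[OF ringed_P] regf_tau morphism_P_TV openin_topspace)

lemma morphism_orb: "morphism (P B) (X B) orb"
  unfolding X_def by (rule morphism_quotient)

lemma X_cases:
  assumes "y \<in> pts (X B)" "0 \<notin> B"
  obtains z where "y = orb z" "mu z \<in> B" "nu z = 0" "section_pt y = z"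
proof -
  obtain z where z: "y = orb z" "mu z \<in> B" using assms(1) by auto
  then have "mu z \<noteq> 0" using assms(2) by auto
  then show thesis
    by (intro that[of "to_slice z"]) (use z in \<open>simp_all add: nu_to_slice section_pt_orb\<close>)
qed

lemma
  assumes "y \<in> pts (X B)" "0 \<notin> B"
  shows mu_section_pt: "mu (section_pt y) \<in> B"
    and nu_section_pt: "nu (section_pt y) = 0"
    and orb_section_pt: "orb (section_pt y) = y"
  using X_cases[OF assms] by metis+

text \<open>Composed with \<open>orb\<close> the section becomes \<open>to_slice\<close>, which is
  algebraic upstairs; the universal property of the quotient does the rest.\<close>

lemma morphism_section_TV:
  assumes "0 \<notin> B"
  shows "morphism (X B) TV section_pt"
  unfolding X_def
proof (rule morphism_from_quotient, rule morphism_cong[OF ringed_P morphism_to_slice[OF assms]])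
  fix z assume "z \<in> pts (P B)"
  then have "mu z \<noteq> 0" using assms by auto
  then show "to_slice z = section_pt (orb z)" by (simp add: section_pt_orb)
qed

lemma morphism_section:
  assumes "0 \<notin> B"
  shows "morphism (X B) (P B) section_pt"
  by (rule morphism_to_P[OF ringed_X morphism_section_TV[OF assms]]) (rule mu_section_pt[OF _ assms])

lemma trivial_torsor:
  assumes "0 \<notin> B"
  shows "trivial_Ga_torsor act (P B) (X B) orb"
  unfolding trivial_Ga_torsor_def
proof (intro exI conjI ballI allI)
  \<comment> \<open>Start on the slice and flow for the given time. The inverse reads off the orbit
    of a point and its \<open>tau\<close>.\<close>
  let ?\<phi> = "\<lambda>z. act (snd z) (section_pt (fst z))"
  have Ga: "ringed_fs Ga" by (simp add: Ga_def ringed_affine_space)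
  have prod: "ringed_fs (product_fs (X B) Ga)" by (rule ringed_product[OF ringed_X Ga])
  have snd: "snd \<in> regf (product_fs (X B) Ga) (pts (product_fs (X B) Ga))"
    using morphism_regf_global[OF morphism_snd[OF ringed_X Ga], of "\<lambda>t. t"]
    unfolding Ga_def by (simp add: regf_affine_poly[OF openin_topspace, simplified] poly_functions.coord)
  show "isomorphism (product_fs (X B) Ga) (P B) ?\<phi>"
  proof (rule isomorphismI)
    show "morphism (product_fs (X B) Ga) (P B) ?\<phi>"
    proof (rule morphism_to_P[OF prod])
      show "morphism (product_fs (X B) Ga) TV ?\<phi>"
        by (rule morphism_act[OF prod snd morphism_compose[OF morphism_fst[OF ringed_X Ga] morphism_section_TV[OF assms]]])
    qed (auto simp: pts_product[OF ringed_X Ga] simp del: pts_X intro: mu_section_pt[OF _ assms])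
    have tau: "morphism (P B) Ga tau"
      unfolding Ga_def by (rule morphism_to_affine[OF ringed_P]) (use regf_tau[OF assms] in auto)
    show "morphism (P B) (product_fs (X B) Ga) (\<lambda>z. (orb z, tau z))"
      by (rule morphism_Pair[OF ringed_P ringed_X Ga morphism_orb tau])
    show "(orb (?\<phi> w), tau (?\<phi> w)) = w" if w: "w \<in> pts (product_fs (X B) Ga)" for w
    proof -
      have "fst w \<in> pts (X B)" using w by (auto simp: pts_product[OF ringed_X Ga])
      then obtain z where z: "fst w = orb z" "mu z \<in> B" "nu z = 0" "section_pt (fst w) = z"
        using assms by (rule X_cases)
      then have "mu z \<noteq> 0" using assms by auto
      then have "tau (act (snd w) z) = snd w" using z(3) by (simp add: tau_act) (simp add: tau_def)
      then show ?thesis unfolding z(4) using z(1) by (simp add: prod_eq_iff)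
    qed
    show "?\<phi> (orb z, tau z) = z" if "z \<in> pts (P B)" for z
    proof -
      have "mu z \<noteq> 0" using that assms by auto
      then show ?thesis by (simp add: section_pt_orb to_slice_def act_act)
    qed
  qed
  fix y assume "y \<in> pts (X B)"
  then obtain z where z: "y = orb z" "mu z \<in> B" "nu z = 0" "section_pt y = z" using assms by (rule X_cases)
  fix t show "orb (?\<phi> (y, t)) = y" by (simp add: z(1)[symmetric] z(4))
  fix s show "?\<phi> (y, s + t) = act s (?\<phi> (y, t))" by (simp add: act_act)
qed

text \<open>\<open>subspace_fs\<close> changes the values of \<open>regf\<close> at non-open sets only, which neither products nor
  morphisms see.\<close>

lemma product_fs_subspace_pts:
  assumes "ringed_fs Y"
  shows "product_fs (subspace_fs Y (pts Y)) Z = product_fs Y Z"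
proof -
  have top: "topo (subspace_fs Y (pts Y)) = topo Y" by simp
  have regf: "regf (subspace_fs Y (pts Y)) U = regf Y U" if U: "openin (topo Y) U" for U
  proof (intro equalityI subsetI)
    fix f assume f: "f \<in> regf (subspace_fs Y (pts Y)) U"
    show "f \<in> regf Y U"
    proof (rule regf_local[OF assms U])
      fix y assume "y \<in> U"
      from regf_subspaceE[OF f this] obtain W g where W: "openin (topo Y) W" "y \<in> W" "g \<in> regf Y W" "\<forall>y\<in>W \<inter> U. f y = g y" .
      then show "\<exists>W g. openin (topo Y) W \<and> y \<in> W \<and> W \<subseteq> U \<and> g \<in> regf Y W \<and> (\<forall>y\<in>W. f y = g y)"
        by (intro exI[of _ "W \<inter> U"] exI[of _ g])
           (use U \<open>y \<in> U\<close> in \<open>auto intro: regf_restrict[OF assms]\<close>)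
    qed
  next
    fix f assume "f \<in> regf Y U"
    then show "f \<in> regf (subspace_fs Y (pts Y)) U" by (intro regf_subspaceI) (use U in blast)
  qed
  have tens: "tensor_functions (subspace_fs Y (pts Y)) Z U V = tensor_functions Y Z U V" if "openin (topo Y) U" for U V
    by (simp add: tensor_functions_def regf[OF that])
  show ?thesis
    unfolding product_fs_def top
    by (simp add: tens cong: conj_cong)
qed

lemma locally_trivial_torsor:
  assumes "0 \<notin> B"
  shows "locally_trivial_Ga_torsor act (P B) (X B) orb"
  unfolding locally_trivial_Ga_torsor_def
proof (intro conjI morphism_orb ballI exI)
  fix y assume y: "y \<in> pts (X B)"
  show "openin (topo (X B)) (pts (X B))" "y \<in> pts (X B)" using y openin_topspace by blast+
  \<comment> \<open>The trivialising open set is the entire quotient; what remains is to pass to the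
    induced structures on full point sets.\<close>
  have P: "{z \<in> pts (P B). orb z \<in> pts (X B)} = pts (P B)" by auto
  obtain \<phi> where \<phi>: "isomorphism (product_fs (X B) Ga) (P B) \<phi>"
     "\<forall>x\<in>pts (X B). \<forall>t. orb (\<phi> (x, t)) = x \<and> (\<forall>s. \<phi> (x, s + t) = act s (\<phi> (x, t)))"
    using trivial_torsor[OF assms] unfolding trivial_Ga_torsor_def by blast
  obtain \<psi> where \<psi>: "morphism (product_fs (X B) Ga) (P B) \<phi>" "morphism (P B) (product_fs (X B) Ga) \<psi>"
     "\<forall>x\<in>pts (product_fs (X B) Ga). \<psi> (\<phi> x) = x" "\<forall>y\<in>pts (P B). \<phi> (\<psi> y) = y"
    using \<phi>(1) unfolding isomorphism_def by blast
  have prod: "ringed_fs (product_fs (X B) Ga)"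
    by (intro ringed_product ringed_X) (simp add: Ga_def ringed_affine_space)
  have "isomorphism (product_fs (subspace_fs (X B) (pts (X B))) Ga) (subspace_fs (P B) (pts (P B))) \<phi>"
    unfolding product_fs_subspace_pts[OF ringed_X]
  proof (rule isomorphismI)
    show "morphism (product_fs (X B) Ga) (subspace_fs (P B) (pts (P B))) \<phi>"
      by (rule morphism_to_subspace[OF prod \<psi>(1) morphism_pts[OF \<psi>(1)]])
    show "morphism (subspace_fs (P B) (pts (P B))) (product_fs (X B) Ga) \<psi>"
      by (rule morphism_compose[OF morphism_inclusion \<psi>(2)])
  qed (use \<psi> in auto)
  then show "trivial_Ga_torsor act (subspace_fs (P B) {z \<in> pts (P B). orb z \<in> pts (X B)})
     (subspace_fs (X B) (pts (X B))) orb"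
    unfolding P trivial_Ga_torsor_def using \<phi>(2) by (intro exI[of _ \<phi>]) simp
qed

text \<open>The chart is the section followed by \<open>encode\<close>, its inverse
  \<open>decode\<close> followed by \<open>orb\<close>. The two admissible values of
  \<open>m\<close> allow for leaving out or including the slot that records
  \<open>r\<close>.\<close>

lemma X_isomorphism_zero_set:
  assumes B: "0 \<notin> B" and m: "2 * CARD('n) \<le> m" "m \<le> 2 * CARD('n) + 1"
    and r: "r \<in> regf (X B) (pts (X B))"
    and Z: "Z \<subseteq> pts (An m)"
    and fwd: "\<And>z. mu z \<in> B \<Longrightarrow> nu z = 0 \<Longrightarrow> encode (r (orb z)) z \<in> Z"
    and bwd: "\<And>a. a \<in> Z \<Longrightarrow> mu (decode a) \<in> B \<and> nu (decode a) = 0 \<and> r (orb (decode a)) = a (2 * CARD('n))"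
  shows "isomorphism (X B) (subspace_fs (An m) Z) (\<lambda>y. encode (r y) (section_pt y))"
proof (rule isomorphismI)
  have in_Z: "encode (r y) (section_pt y) \<in> Z" if y: "y \<in> pts (X B)" for y
    using X_cases[OF y B] fwd by metis
  show "morphism (X B) (subspace_fs (An m) Z) (\<lambda>y. encode (r y) (section_pt y))"
    by (intro morphism_to_subspace[OF ringed_X] morphism_encode[OF ringed_X morphism_section_TV[OF B] r])
       (use in_Z Z in blast)+
  have "morphism (subspace_fs (An m) Z) (P B) decode"
    by (rule morphism_to_P[OF ringed_subspace[OF ringed_An] morphism_compose[OF morphism_inclusion morphism_decode[OF m(1)]]])
       (use bwd in auto)
  then show "morphism (subspace_fs (An m) Z) (X B) (\<lambda>a. orb (decode a))"
    by (rule morphism_compose[OF _ morphism_orb])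
  show "orb (decode (encode (r y) (section_pt y))) = y" if y: "y \<in> pts (X B)" for y
    using X_cases[OF y B] by (metis decode_encode)
  fix a assume "a \<in> pts (subspace_fs (An m) Z)"
  then have a: "a \<in> Z" by auto
  then have "mu (decode a) \<noteq> 0" using bwd[OF a] B by auto
  then have "section_pt (orb (decode a)) = decode a"
    using bwd[OF a] by (simp add: section_pt_orb to_slice_id)
  moreover have "encode (a (2 * CARD('n))) (decode a :: 'n cotangent) = a"
    \<comment> \<open>The upper bound on \<open>m\<close> makes all entries beyond the extra slot
      vanish.\<close>
    by (rule encode_decode) (use a Z m in auto)
  ultimately show "encode (r (orb (decode a))) (section_pt (orb (decode a))) = a"
    using bwd[OF a] by simp
qed

text \<open>The section is injective, so some coordinate of it tells two given orbits apart.\<close>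

lemma X_separated:
  assumes B: "0 \<notin> B" and xy: "x \<in> pts (X B)" "y \<in> pts (X B)" "x \<noteq> y"
  shows "\<exists>f\<in>regf (X B) (pts (X B)). f x \<noteq> f y"
proof -
  have "section_pt x \<noteq> section_pt y"
    using X_cases[OF xy(1) B] X_cases[OF xy(2) B] xy(3) by metis
  then consider l where "fst (section_pt x) $ l \<noteq> fst (section_pt y) $ l"
    | l where "snd (section_pt x) $ l \<noteq> snd (section_pt y) $ l"
    by (auto simp: prod_eq_iff vec_eq_iff)
  then show ?thesis
  proof cases
    case 1
    then show ?thesis using morphism_section_TV[OF B] unfolding morphism_TV_iff[OF ringed_X]
      by (intro bexI[of _ "\<lambda>y. fst (section_pt y) $ l"]) auto
  next
    case 2
    then show ?thesis using morphism_section_TV[OF B] unfolding morphism_TV_iff[OF ringed_X]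
      by (intro bexI[of _ "\<lambda>y. snd (section_pt y) $ l"]) auto
  qed
qed

text \<open>The trick of Rabinowitsch: \<open>mu \<noteq> 0\<close> becomes the closed condition
  \<open>mu * s = 1\<close> with an additional coordinate \<open>s\<close>, the last one of affine
  space of dimension \<open>2 * CARD('n) + 1\<close>.\<close>

lemma variety_total: "variety (X (- {0}))"
proof -
  let ?N = "2 * CARD('n)" and ?B = "- {0 :: complex}"
  let ?F = "\<lambda>j a. if j = 0 then nu (decode a) else mu (decode a) * a ?N - 1"
  let ?Z = "{a \<in> pts (An (?N + 1)). \<forall>j<2::nat. ?F j a = 0}"
  let ?r = "\<lambda>y. 1 / mu (section_pt y)"
  have B: "0 \<notin> ?B" by simp
  have Z: "closedin (topo (An (?N + 1))) ?Z"
  proof (rule closedin_zero_set)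
    fix j :: nat
    have "(\<lambda>a. nu (decode a)) \<in> poly_functions (An_coords (?N + 1))" "(\<lambda>a. mu (decode a)) \<in> poly_functions (An_coords (?N + 1))"
      by (simp_all add: poly_decode[OF nu_poly] poly_decode[OF mu_poly])
    moreover have "(\<lambda>a. a ?N) \<in> poly_functions (An_coords (?N + 1))"
      by (intro poly_functions.coord) (auto simp: An_coords_def)
    ultimately show "?F j \<in> poly_functions (An_coords (?N + 1))"
      by (cases "j = 0") (auto intro!: poly_functions_diff poly_functions.mult poly_functions.const[of 1])
  qed
  have F: "(\<forall>j<2::nat. ?F j a = 0) \<longleftrightarrow> nu (decode a) = 0 \<and> mu (decode a) * a ?N = 1" for a
    by (auto simp: less_2_cases_iff)
  have "isomorphism (X ?B) (subspace_fs (An (?N + 1)) ?Z) (\<lambda>y. encode (?r y) (section_pt y))"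
  proof (rule X_isomorphism_zero_set[OF B])
    show "?r \<in> regf (X ?B) (pts (X ?B))"
      by (intro regf_divide[OF ringed_X] regf_const[OF ringed_X] regf_mu_compose morphism_section_TV B openin_topspace)
         (use mu_section_pt[OF _ B] in \<open>simp del: pts_X\<close>)
    show "encode (?r (orb z)) z \<in> ?Z" if "mu z \<in> ?B" "nu z = 0" for z
      using that unfolding F mem_Collect_eq by (auto simp: section_pt_orb encode_def)
    show "mu (decode a) \<in> ?B \<and> nu (decode a) = 0 \<and> ?r (orb (decode a)) = a ?N" if "a \<in> ?Z" for a
    proof -
      have *: "nu (decode a) = 0" "mu (decode a) * a ?N = 1" using that unfolding F mem_Collect_eq by auto
      then have "mu (decode a) \<noteq> 0" by auto
      then show ?thesis using * by (auto simp: section_pt_orb field_simps)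
    qed
  qed auto
  then show ?thesis
    by (rule variety_affineI[OF ringed_X Z _ X_separated[OF B]])
qed

text \<open>Index 0 stands for \<open>nu\<close>, index 1 for \<open>mu - \<xi>\<close>. Both are
  written as a single \<open>pairing\<close> minus a constant, the shape to which
  \<open>partial_deriv_bilinear\<close> applies.\<close>

abbreviation level_eqs :: "complex \<Rightarrow> nat \<Rightarrow> (nat \<Rightarrow> complex) \<Rightarrow> complex" where
  "level_eqs \<xi> j a \<equiv> pairing (snd (decode a)) ((if j = 0 then H else E) *v fst (decode a :: 'n cotangent)) - (if j = 0 then 0 else \<xi>)"

abbreviation level_zeros :: "complex \<Rightarrow> (nat \<Rightarrow> complex) set" where
  "level_zeros \<xi> \<equiv> {a \<in> pts (An (2 * CARD('n))). \<forall>j<2. level_eqs \<xi> j a = 0}"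

lemma level_eqs_iff: "(\<forall>j<2. level_eqs \<xi> j a = 0) \<longleftrightarrow> nu (decode a) = 0 \<and> mu (decode a) = \<xi>"
  by (auto simp: less_2_cases_iff nu_def mu_def)

lemma level_eqs_poly: "level_eqs \<xi> j \<in> poly_functions (An_coords (2 * CARD('n)))"
  by (intro poly_functions_diff poly_functions.const poly_decode[OF poly_pairing]) simp

lemma level_isomorphism:
  assumes "\<xi> \<noteq> 0"
  shows "isomorphism (X {\<xi>}) (subspace_fs (An (2 * CARD('n))) (level_zeros \<xi>)) (\<lambda>y. encode 0 (section_pt y))"
proof (rule X_isomorphism_zero_set)
  show "(\<lambda>y. 0) \<in> regf (X {\<xi>}) (pts (X {\<xi>}))" by (intro regf_const[OF ringed_X] openin_topspace)
  show "encode 0 z \<in> level_zeros \<xi>" if "mu z \<in> {\<xi>}" "nu z = 0" for z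
    using that unfolding mem_Collect_eq level_eqs_iff by (auto simp: encode_def)
  show "mu (decode a) \<in> {\<xi>} \<and> nu (decode a) = 0 \<and> 0 = a (2 * CARD('n))" if "a \<in> level_zeros \<xi>" for a
    using that unfolding mem_Collect_eq level_eqs_iff by auto
qed (use assms in auto)

lemma variety_level: "\<xi> \<noteq> 0 \<Longrightarrow> variety (X {\<xi>})"
  by (rule variety_affineI[OF ringed_X closedin_zero_set[OF level_eqs_poly] level_isomorphism X_separated]) auto

lemma smooth_level:
  assumes "\<xi> \<noteq> 0"
  shows "smooth (X {\<xi>})"
  unfolding smooth_def
proof (intro ballI exI conjI allI impI)
  fix y assume "y \<in> pts (X {\<xi>})"
  then show "openin (topo (X {\<xi>})) (pts (X {\<xi>}))" "y \<in> pts (X {\<xi>})" using openin_topspace by blast+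
  show "level_eqs \<xi> j \<in> poly_functions (An_coords (2 * CARD('n)))" for j by (rule level_eqs_poly)
  show "level_zeros \<xi> = level_zeros \<xi>" by (rule refl)
  show "isomorphism (subspace_fs (X {\<xi>}) (pts (X {\<xi>}))) (subspace_fs (An (2 * CARD('n))) (level_zeros \<xi>))
     (\<lambda>y. encode 0 (section_pt y))"
    by (intro isomorphism_subspace_pts level_isomorphism assms ringed_subspace ringed_An)
next
  fix a c and j :: nat
  assume "a \<in> level_zeros \<xi>"
    and c: "\<forall>i<2 * CARD('n). (\<Sum>j<2. c j * partial_deriv i (level_eqs \<xi> j) a) = 0" and j: "j < 2"
  then have a: "nu (decode a) = 0" "mu (decode a) = \<xi>" unfolding mem_Collect_eq level_eqs_iff by auto
  obtain x \<alpha> where x: "(decode a :: 'n cotangent) = (x, \<alpha>)" by fastforce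
  \<comment> \<open>The assumed relation between the rows of the Jacobian matrix, evaluated on an
    arbitrary direction \<open>v\<close>.\<close>
  have *: "c 0 * bilinear_derivative H (x, \<alpha>) v + c 1 * bilinear_derivative E (x, \<alpha>) v = 0" for v
  proof -
    have "(\<Sum>i<2 * CARD('n). encode 0 v i * (\<Sum>j<2. c j * partial_deriv i (level_eqs \<xi> j) a)) = 0"
      by (rule sum.neutral) (use c in auto)
    then have "c 0 * (\<Sum>i<2 * CARD('n). encode 0 v i * bilinear_derivative H (x, \<alpha>) (decode (\<lambda>j. if j = i then 1 else 0)))
      + c 1 * (\<Sum>i<2 * CARD('n). encode 0 v i * bilinear_derivative E (x, \<alpha>) (decode (\<lambda>j. if j = i then 1 else 0))) = 0"
      unfolding partial_deriv_bilinear x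
      by (simp add: numeral_2_eq_2 sum_distrib_left sum.distrib[symmetric] algebra_simps)
    then show ?thesis unfolding bilinear_derivative_encode .
  qed
  \<comment> \<open>The velocity of the action annihilates \<open>mu\<close>, while by
    \<open>H_E\<close> the differential of \<open>nu\<close> takes the value
    \<open>2 * \<xi>\<close> on it.\<close>
  have "c 0 = 0"
    using *[of "(E *v x, - (\<alpha> v* E))"] a(2) assms
    by (simp add: bilinear_derivative_def pairing_simps pairing_vector_matrix H_E x mu_def)
  \<comment> \<open>On the Euler field the differential of \<open>mu\<close> takes the value
    \<open>mu\<close>, which is \<open>\<xi>\<close>.\<close>
  moreover have "c 1 = 0"
    using *[of "(x, 0)"] a(2) assms \<open>c 0 = 0\<close> by (simp add: bilinear_derivative_def x mu_def)
  ultimately show "c j = 0" using j by (auto simp: less_2_cases_iff)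
qed

end

section \<open>Tangent vectors\<close>

lemma germsI: "openin (topo X) U \<Longrightarrow> x \<in> U \<Longrightarrow> f \<in> regf X U \<Longrightarrow> f \<in> germs X x"
  unfolding germs_def by blast

lemma germsE:
  assumes "f \<in> germs X x"
  obtains U where "openin (topo X) U" "x \<in> U" "f \<in> regf X U"
  using assms unfolding germs_def by blast

lemma germs_global: "x \<in> pts X \<Longrightarrow> f \<in> regf X (pts X) \<Longrightarrow> f \<in> germs X x"
  by (rule germsI[OF openin_topspace])

lemma germs_binop:
  assumes X: "ringed_fs X" and f: "f \<in> germs X x" and g: "g \<in> germs X x"
  shows "(\<lambda>y. f y + g y) \<in> germs X x" "(\<lambda>y. f y * g y) \<in> germs X x"
proof -
  obtain U where U: "openin (topo X) U" "x \<in> U" "f \<in> regf X U" by (rule germsE[OF f])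
  obtain V where V: "openin (topo X) V" "x \<in> V" "g \<in> regf X V" by (rule germsE[OF g])
  have W: "openin (topo X) (U \<inter> V)" "x \<in> U \<inter> V" using U V by auto
  have "f \<in> regf X (U \<inter> V)" "g \<in> regf X (U \<inter> V)"
    by (rule regf_restrict[OF X U(3,1) W(1)] regf_restrict[OF X V(3,1) W(1)], blast)+
  then show "(\<lambda>y. f y + g y) \<in> germs X x" "(\<lambda>y. f y * g y) \<in> germs X x"
    by (auto intro!: germsI[OF W] regf_add[OF X W(1)] regf_mult[OF X W(1)])
qed

lemma germs_const: "ringed_fs X \<Longrightarrow> x \<in> pts X \<Longrightarrow> (\<lambda>_. c) \<in> germs X x"
  by (intro germs_global regf_const openin_topspace)

lemma germs_sum:
  assumes "ringed_fs X" "x \<in> pts X" "\<And>i. i \<in> I \<Longrightarrow> f i \<in> germs X x"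
  shows "(\<lambda>y. \<Sum>i\<in>I. f i y) \<in> germs X x"
  using assms(3)
  by (induction I rule: infinite_finite_induct) (auto intro: germs_const[OF assms(1,2)] germs_binop[OF assms(1)])

lemma germs_poly:
  assumes "ringed_fs X" "x \<in> pts X" "p \<in> poly_functions C" "\<And>c. c \<in> C \<Longrightarrow> (\<lambda>y. c (\<phi> y)) \<in> germs X x"
  shows "(\<lambda>y. p (\<phi> y)) \<in> germs X x"
  using assms(3) by induction (auto intro: assms(4) germs_const[OF assms(1,2)] germs_binop[OF assms(1)])

lemma germs_compose:
  assumes "morphism X Y \<phi>" "x \<in> pts X" "g \<in> germs Y (\<phi> x)"
  shows "(\<lambda>y. g (\<phi> y)) \<in> germs X x"
proof -
  obtain U where U: "openin (topo Y) U" "\<phi> x \<in> U" "g \<in> regf Y U" by (rule germsE[OF assms(3)])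
  show ?thesis
    by (rule germsI[OF morphism_openin[OF assms(1) U(1)] _ morphism_regf[OF assms(1) U(1,3)]])
       (use U assms(2) in auto)
qed

lemma
  assumes "D \<in> tangent X x"
  shows tangent_not_germ: "f \<notin> germs X x \<Longrightarrow> D f = 0"
    and tangent_cong: "f \<in> germs X x \<Longrightarrow> g \<in> germs X x \<Longrightarrow> openin (topo X) U \<Longrightarrow> x \<in> U \<Longrightarrow>
      (\<And>y. y \<in> U \<Longrightarrow> f y = g y) \<Longrightarrow> D f = D g"
    and tangent_add: "f \<in> germs X x \<Longrightarrow> g \<in> germs X x \<Longrightarrow> D (\<lambda>y. f y + g y) = D f + D g"
    and tangent_scale: "f \<in> germs X x \<Longrightarrow> D (\<lambda>y. c * f y) = c * D f"
    and tangent_mult: "f \<in> germs X x \<Longrightarrow> g \<in> germs X x \<Longrightarrow> D (\<lambda>y. f y * g y) = f x * D g + g x * D f"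
  using assms unfolding tangent_def by blast+

lemma tangentI:
  assumes "\<And>f. f \<notin> germs X x \<Longrightarrow> D f = 0"
    and "\<And>f g U. f \<in> germs X x \<Longrightarrow> g \<in> germs X x \<Longrightarrow> openin (topo X) U \<Longrightarrow> x \<in> U \<Longrightarrow>
      \<forall>y\<in>U. f y = g y \<Longrightarrow> D f = D g"
    and "\<And>f g. f \<in> germs X x \<Longrightarrow> g \<in> germs X x \<Longrightarrow> D (\<lambda>y. f y + g y) = D f + D g"
    and "\<And>c f. f \<in> germs X x \<Longrightarrow> D (\<lambda>y. c * f y) = c * D f"
    and "\<And>f g. f \<in> germs X x \<Longrightarrow> g \<in> germs X x \<Longrightarrow> D (\<lambda>y. f y * g y) = f x * D g + g x * D f"
  shows "D \<in> tangent X x"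
  unfolding tangent_def mem_Collect_eq
  by (intro conjI allI ballI impI; (elim exE conjE)?) (rule assms; assumption)+

lemma tangent_const:
  assumes X: "ringed_fs X" "x \<in> pts X" and D: "D \<in> tangent X x"
  shows "D (\<lambda>_. c) = 0"
proof -
  have "D (\<lambda>_. 1 * 1) = 1 * D (\<lambda>_. 1) + 1 * D (\<lambda>_. 1)" by (rule tangent_mult[OF D germs_const[OF X] germs_const[OF X]])
  then have "D (\<lambda>_. 1) = 0" by simp
  then show ?thesis using tangent_scale[OF D germs_const[OF X, of 1], of c] by simp
qed

lemma tangent_sum:
  assumes X: "ringed_fs X" "x \<in> pts X" and D: "D \<in> tangent X x" and f: "\<And>i. i \<in> I \<Longrightarrow> f i \<in> germs X x"
  shows "D (\<lambda>y. \<Sum>i\<in>I. f i y) = (\<Sum>i\<in>I. D (f i))"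
  using f
proof (induction I rule: infinite_finite_induct)
  case (insert i I)
  then show ?case using tangent_add[OF D, of "f i" "\<lambda>y. \<Sum>i\<in>I. f i y"] germs_sum[OF X, of I f] by simp
qed (simp_all add: tangent_const[OF X D])

lemma tangent_poly_zero:
  assumes X: "ringed_fs X" "x \<in> pts X" and D: "D \<in> tangent X x" and p: "p \<in> poly_functions C"
    and C: "\<And>c. c \<in> C \<Longrightarrow> (\<lambda>y. c (\<phi> y)) \<in> germs X x" "\<And>c. c \<in> C \<Longrightarrow> D (\<lambda>y. c (\<phi> y)) = 0"
  shows "D (\<lambda>y. p (\<phi> y)) = 0"
proof -
  have germs: "(\<lambda>y. p (\<phi> y)) \<in> germs X x" if "p \<in> poly_functions C" for p
    by (rule germs_poly[OF X that C(1)])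
  show ?thesis using p by induction
    (simp_all add: C(2) tangent_const[OF X D] tangent_add[OF D germs germs] tangent_mult[OF D germs germs])
qed

text \<open>This links algebraic derivations with analytic derivatives; it is needed for
  \<open>\<sigma> (t y)\<close> with a time \<open>t\<close> depending on the point.\<close>

lemma tangent_chain:
  assumes X: "ringed_fs X" "x \<in> pts X" and D: "D \<in> tangent X x" and p: "p \<in> poly_functions {\<lambda>t. t}"
    and t: "t \<in> germs X x" and "(p has_field_derivative d) (at (t x))"
  shows "D (\<lambda>y. p (t y)) = d * D t"
proof -
  note germs = germs_poly[OF X, of _ "{\<lambda>t. t}" t, simplified, OF _ t]
  \<comment> \<open>Induction yields some derivative satisfying the chain rule; uniqueness of
    derivatives identifies it with the given one.\<close>
  have "\<exists>d. (p has_field_derivative d) (at (t x)) \<and> D (\<lambda>y. p (t y)) = d * D t"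
    using p
  proof induction
    case (const c)
    show ?case by (rule exI[of _ 0]) (simp add: tangent_const[OF X D])
  next
    case (coord f)
    then show ?case by (intro exI[of _ 1]) auto
  next
    case (add f g)
    then obtain d e where "(f has_field_derivative d) (at (t x))" "D (\<lambda>y. f (t y)) = d * D t"
      "(g has_field_derivative e) (at (t x))" "D (\<lambda>y. g (t y)) = e * D t" by blast
    then show ?case
      by (intro exI[of _ "d + e"]) (auto simp: tangent_add[OF D] germs add.hyps algebra_simps intro!: DERIV_add)
  next
    case (mult f g)
    then obtain d e where "(f has_field_derivative d) (at (t x))" "D (\<lambda>y. f (t y)) = d * D t"
      "(g has_field_derivative e) (at (t x))" "D (\<lambda>y. g (t y)) = e * D t" by blast
    then show ?case
      by (intro exI[of _ "d * g (t x) + e * f (t x)"] conjI DERIV_mult)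
         (auto simp: tangent_mult[OF D] germs mult.hyps algebra_simps)
  qed
  then show ?thesis using DERIV_unique[OF assms(6)] by blast
qed

lemma push_forward_germ: "g \<in> germs Y (\<phi> x) \<Longrightarrow> push_forward Y \<phi> x D g = D (\<lambda>y. g (\<phi> y))"
  by (simp add: push_forward_def comp_def)

lemma push_forward_tangent:
  assumes X: "ringed_fs X" and Y: "ringed_fs Y" and \<phi>: "morphism X Y \<phi>" and x: "x \<in> pts X" and D: "D \<in> tangent X x"
  shows "push_forward Y \<phi> x D \<in> tangent Y (\<phi> x)"
proof (rule tangentI)
  note germs = germs_compose[OF \<phi> x]
  show "push_forward Y \<phi> x D f = 0" if "f \<notin> germs Y (\<phi> x)" for f
    using that by (simp add: push_forward_def)
  show "push_forward Y \<phi> x D f = push_forward Y \<phi> x D g"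
    if "f \<in> germs Y (\<phi> x)" "g \<in> germs Y (\<phi> x)" "openin (topo Y) U" "\<phi> x \<in> U" "\<forall>y\<in>U. f y = g y" for f g U
    unfolding push_forward_germ[of _ Y \<phi> x, OF that(1)] push_forward_germ[of _ Y \<phi> x, OF that(2)]
    by (rule tangent_cong[OF D germs germs morphism_openin[OF \<phi> that(3)]]) (use that x in auto)
  show "push_forward Y \<phi> x D (\<lambda>y. f y + g y) = push_forward Y \<phi> x D f + push_forward Y \<phi> x D g"
    "push_forward Y \<phi> x D (\<lambda>y. f y * g y) = f (\<phi> x) * push_forward Y \<phi> x D g + g (\<phi> x) * push_forward Y \<phi> x D f"
    if "f \<in> germs Y (\<phi> x)" "g \<in> germs Y (\<phi> x)" for f g
    using that germs_binop[OF Y that]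
    by (simp_all add: push_forward_germ germs tangent_add[OF D] tangent_mult[OF D])
  show "push_forward Y \<phi> x D (\<lambda>y. c * f y) = c * push_forward Y \<phi> x D f" if "f \<in> germs Y (\<phi> x)" for c f
    using that germs_binop(2)[OF Y germs_const[OF Y morphism_pts[OF \<phi> x]] that, of c]
    by (simp add: push_forward_germ germs tangent_scale[OF D])
qed

section \<open>Derivatives of vector- and matrix-valued functions along a tangent vector\<close>

definition vderiv :: "'a tvec \<Rightarrow> ('a \<Rightarrow> complex^'n) \<Rightarrow> complex^'n" where
  "vderiv D u = (\<chi> l. D (\<lambda>y. u y $ l))"

definition mderiv :: "'a tvec \<Rightarrow> ('a \<Rightarrow> complex^'n^'m) \<Rightarrow> complex^'n^'m" where
  "mderiv D A = (\<chi> i j. D (\<lambda>y. A y $ i $ j))"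

lemma vderiv_nth [simp]: "vderiv D u $ l = D (\<lambda>y. u y $ l)"
  by (simp add: vderiv_def)

lemma mderiv_nth [simp]: "mderiv D A $ i $ j = D (\<lambda>y. A y $ i $ j)"
  by (simp add: mderiv_def)

context
  fixes X :: "'a fspace" and x D
  assumes X: "ringed_fs X" "x \<in> pts X" and D: "D \<in> tangent X x"
begin

lemma vderiv_cong:
  assumes "\<And>l. (\<lambda>y. u y $ l) \<in> germs X x" "\<And>l. (\<lambda>y. v y $ l) \<in> germs X x"
    and "\<And>y. y \<in> pts X \<Longrightarrow> u y = v y"
  shows "vderiv D u = vderiv D v"
  unfolding vec_eq_iff vderiv_nth
  by (intro allI tangent_cong[OF D assms(1,2) openin_topspace X(2)]) (simp add: assms(3))

lemma tangent_pairing: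
  assumes "\<And>l. (\<lambda>y. u y $ l) \<in> germs X x" "\<And>l. (\<lambda>y. v y $ l) \<in> germs X x"
  shows "D (\<lambda>y. pairing (u y) (v y)) = pairing (vderiv D u) (v x) + pairing (u x) (vderiv D v)"
  unfolding pairing_def
  by (simp add: tangent_sum[OF X D] tangent_mult[OF D] germs_binop[OF X(1)] assms sum.distrib algebra_simps)

lemma vderiv_matrix_vector:
  assumes "\<And>i j. (\<lambda>y. A y $ i $ j) \<in> germs X x" "\<And>l. (\<lambda>y. v y $ l) \<in> germs X x"
  shows "vderiv D (\<lambda>y. A y *v v y) = A x *v vderiv D v + mderiv D A *v v x"
  by (simp add: vec_eq_iff matrix_vector_mult_def tangent_sum[OF X D] tangent_mult[OF D] germs_binop[OF X(1)]
      assms sum.distrib mult.commute)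

lemma vderiv_vector_matrix:
  assumes "\<And>i j. (\<lambda>y. A y $ i $ j) \<in> germs X x" "\<And>l. (\<lambda>y. v y $ l) \<in> germs X x"
  shows "vderiv D (\<lambda>y. v y v* A y) = vderiv D v v* A x + v x v* mderiv D A"
  by (simp add: vec_eq_iff vector_matrix_mult_def tangent_sum[OF X D] tangent_mult[OF D] germs_binop[OF X(1)]
      assms sum.distrib[symmetric] algebra_simps)

lemma tangent_bilinear:
  assumes "\<And>l. (\<lambda>y. fst (\<phi> y) $ l) \<in> germs X x" "\<And>l. (\<lambda>y. snd (\<phi> y) $ l) \<in> germs X x"
  shows "D (\<lambda>y. pairing (snd (\<phi> y)) (M *v fst (\<phi> y))) =
    bilinear_derivative M (\<phi> x) (vderiv D (\<lambda>y. fst (\<phi> y)), vderiv D (\<lambda>y. snd (\<phi> y)))"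
proof -
  have const: "(\<lambda>y. c) \<in> germs X x" for c by (rule germs_const[OF X])
  have M: "mderiv D (\<lambda>y. M) = 0" by (simp add: vec_eq_iff tangent_const[OF X D])
  have germs: "(\<lambda>y. (M *v fst (\<phi> y)) $ l) \<in> germs X x" for l
    unfolding matrix_vector_mult_def vec_lambda_beta
    by (intro germs_sum[OF X] germs_binop[OF X(1)] const assms)
  show ?thesis
    by (simp add: tangent_pairing[OF assms(2) germs] vderiv_matrix_vector[OF const assms(1)] M bilinear_derivative_def)
qed

end

lemma vderiv_push_forward:
  assumes "\<And>l. (\<lambda>y. u y $ l) \<in> germs Y (\<phi> x)"
  shows "vderiv (push_forward Y \<phi> x D) u = vderiv D (\<lambda>y. u (\<phi> y))"
  by (simp add: vec_eq_iff push_forward_germ assms)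

lemma liouville_eq:
  "liouville z D1 D2 = pairing (vderiv D1 fst) (vderiv D2 snd) - pairing (vderiv D2 fst) (vderiv D1 snd)"
  by (simp add: liouville_def wedge2_def pairing_def sum_subtractf case_prod_beta')

lemma germs_TV_fst: "(\<lambda>z. fst z $ l) \<in> germs TV z" and germs_TV_snd: "(\<lambda>z. snd z $ l) \<in> germs TV z"
  by (intro germs_global regf_TV_fst regf_TV_snd; simp)+

lemma germs_morphism_TV:
  assumes "ringed_fs X" "morphism X TV \<phi>" "x \<in> pts X"
  shows "(\<lambda>y. fst (\<phi> y) $ l) \<in> germs X x" "(\<lambda>y. snd (\<phi> y) $ l) \<in> germs X x"
  using assms morphism_TV_iff[OF assms(1), of \<phi>] by (auto intro!: germs_global)

lemma pullback_liouville_eq: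
  "pullback_form TV \<phi> liouville x D1 D2 =
     pairing (vderiv D1 (\<lambda>y. fst (\<phi> y))) (vderiv D2 (\<lambda>y. snd (\<phi> y)))
     - pairing (vderiv D2 (\<lambda>y. fst (\<phi> y))) (vderiv D1 (\<lambda>y. snd (\<phi> y)))"
  unfolding pullback_form_def liouville_eq
  by (simp add: vderiv_push_forward germs_TV_fst germs_TV_snd)

section \<open>Curves in affine space\<close>

lemma poly_curve_differentiable:
  assumes "p \<in> poly_functions C" "\<And>c. c \<in> C \<Longrightarrow> (\<lambda>t. c (\<gamma> t)) field_differentiable at s"
  shows "(\<lambda>t. p (\<gamma> t)) field_differentiable at s"
  using assms(1)
  by induction (auto intro: assms(2) field_differentiable_const field_differentiable_add field_differentiable_mult)

text \<open>A Zariski neighbourhood contains a locus \<open>p \<noteq> 0\<close>, and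
  \<open>p\<close> is continuous along the curve; so Zariski open sets behave like ordinary
  neighbourhoods here.\<close>

lemma eventually_curve_open:
  assumes W: "openin (topo (affine_space UNIV C)) W" and z: "\<gamma> s \<in> W"
    and \<gamma>: "\<And>c. c \<in> C \<Longrightarrow> (\<lambda>t. c (\<gamma> t)) field_differentiable at s"
  shows "\<forall>\<^sub>F t in nhds s. \<gamma> t \<in> W"
proof -
  let ?B = "{{x \<in> UNIV. p x \<noteq> 0} |p. p \<in> poly_functions C}"
  have Int: "a \<inter> b \<in> ?B" if a: "a \<in> ?B" and b: "b \<in> ?B" for a b
  proof -
    obtain p where "a = {x \<in> UNIV. p x \<noteq> 0} \<and> p \<in> poly_functions C" using CollectD[OF a] by (elim exE)
    moreover obtain q where "b = {x \<in> UNIV. q x \<noteq> 0} \<and> q \<in> poly_functions C" using CollectD[OF b] by (elim exE)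
    ultimately show ?thesis by (intro CollectI exI[of _ "\<lambda>x. p x * q x"]) (auto intro: poly_functions.mult)
  qed
  obtain b where "b \<in> ?B" and b: "\<gamma> s \<in> b" "b \<subseteq> W"
    by (rule openin_generated_basis[OF W[unfolded affine_space_def Let_def fspace.simps] z Int])
  then obtain p where p: "p \<in> poly_functions C" "b = {x. p x \<noteq> 0}" by auto
  have "isCont (\<lambda>t. p (\<gamma> t)) s"
    by (intro field_differentiable_imp_continuous_at poly_curve_differentiable[OF p(1) \<gamma>])
  then have "\<forall>\<^sub>F t in at s. p (\<gamma> t) \<noteq> 0"
    using b p by (intro tendsto_imp_eventually_ne) (auto simp: isCont_def)
  then have "\<forall>\<^sub>F t in nhds s. p (\<gamma> t) \<noteq> 0"
    using b p by (auto simp: eventually_at_filter elim: eventually_mono)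
  then show ?thesis by (rule eventually_mono) (use b p in auto)
qed

context slice_data begin

section \<open>The symplectic form\<close>

text \<open>The velocity of the curve at time 0, extended by 0 off the germs as
  \<open>tangent\<close> requires.\<close>

definition curve_tangent :: "complex set \<Rightarrow> (complex \<Rightarrow> 'n cotangent) \<Rightarrow> 'n cotangent tvec" where
  "curve_tangent B \<gamma> f = (if f \<in> germs (P B) (\<gamma> 0) then deriv (\<lambda>t. f (\<gamma> t)) 0 else 0)"

text \<open>A germ is locally a quotient of polynomials on the ambient space, hence differentiable
  along the curve; the laws of a derivation are then those of \<open>deriv\<close>.\<close>

lemma curve_tangent:
  assumes \<gamma>: "\<And>c. c \<in> TV_coords \<Longrightarrow> (\<lambda>t. c (\<gamma> t)) field_differentiable at 0"
    and B: "\<forall>\<^sub>F t in nhds 0. mu (\<gamma> t) \<in> B"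
  shows "curve_tangent B \<gamma> \<in> tangent (P B) (\<gamma> 0)"
proof -
  let ?z = "\<gamma> 0"
  \<comment> \<open>An open subset of the level is the trace of an ambient one; the assumption on
    \<open>mu\<close> supplies the membership in the level.\<close>
  have ev: "\<forall>\<^sub>F t in nhds 0. \<gamma> t \<in> U" if U: "openin (topo (P B)) U" "?z \<in> U" for U
  proof -
    obtain U' where U': "openin (topo TV) U'" "U = U' \<inter> {z. mu z \<in> B}"
      using U(1) by (auto simp: P_def openin_subtopology)
    then have "\<forall>\<^sub>F t in nhds 0. \<gamma> t \<in> U'"
      using U(2) by (intro eventually_curve_open[OF _ _ \<gamma>]) (auto simp: TV_eq)
    with B show ?thesis by eventually_elim (simp add: U')
  qed
  have diff: "(\<lambda>t. f (\<gamma> t)) field_differentiable at 0" if f: "f \<in> germs (P B) ?z" for f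
  proof -
    obtain U where U: "openin (topo (P B)) U" "?z \<in> U" "f \<in> regf (P B) U" by (rule germsE[OF f])
    obtain W g where W: "openin (topo TV) W" "?z \<in> W" "g \<in> regf TV W" "\<forall>y\<in>W \<inter> U. f y = g y"
      using U(3,2) unfolding P_def by (rule regf_subspaceE)
    obtain W' p q where W': "openin (topo TV) W'" "?z \<in> W'" "W' \<subseteq> W" "p \<in> poly_functions TV_coords"
      "q \<in> poly_functions TV_coords" "\<forall>y\<in>W'. q y \<noteq> 0 \<and> g y = p y / q y"
      using W(3,2) unfolding TV_eq by (rule regf_affineE)
    have "\<forall>\<^sub>F t in nhds 0. \<gamma> t \<in> W'"
      using W' by (intro eventually_curve_open[OF _ _ \<gamma>]) (auto simp: TV_eq)
    then have eq: "\<forall>\<^sub>F t in nhds 0. p (\<gamma> t) / q (\<gamma> t) = f (\<gamma> t)"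
      using ev[OF U(1,2)] by eventually_elim (use W' W in auto)
    have "(\<lambda>t. p (\<gamma> t) / q (\<gamma> t)) field_differentiable at 0"
      by (intro field_differentiable_divide poly_curve_differentiable[OF W'(4) \<gamma>] poly_curve_differentiable[OF W'(5) \<gamma>])
         (use W' in auto)
    then show ?thesis
      unfolding field_differentiable_def using DERIV_cong_ev[OF refl eq refl] by auto
  qed
  show ?thesis
  proof (rule tangentI)
    show "curve_tangent B \<gamma> f = 0" if "f \<notin> germs (P B) ?z" for f
      using that by (simp add: curve_tangent_def)
    show "curve_tangent B \<gamma> f = curve_tangent B \<gamma> g"
      if "f \<in> germs (P B) ?z" "g \<in> germs (P B) ?z" "openin (topo (P B)) U" "?z \<in> U" "\<forall>y\<in>U. f y = g y" for f g U
    proof -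
      have "\<forall>\<^sub>F t in nhds 0. f (\<gamma> t) = g (\<gamma> t)"
        using ev[OF that(3,4)] by eventually_elim (use that in auto)
      then show ?thesis using that by (simp add: curve_tangent_def deriv_cong_ev)
    qed
    show "curve_tangent B \<gamma> (\<lambda>y. f y + g y) = curve_tangent B \<gamma> f + curve_tangent B \<gamma> g"
      "curve_tangent B \<gamma> (\<lambda>y. f y * g y) = f ?z * curve_tangent B \<gamma> g + g ?z * curve_tangent B \<gamma> f"
      if "f \<in> germs (P B) ?z" "g \<in> germs (P B) ?z" for f g
      using that germs_binop[OF ringed_P that] diff[OF that(1)] diff[OF that(2)]
      by (simp_all add: curve_tangent_def)
    show "curve_tangent B \<gamma> (\<lambda>y. c * f y) = c * curve_tangent B \<gamma> f" if f: "f \<in> germs (P B) ?z" for c f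
    proof -
      obtain U where "openin (topo (P B)) U" "?z \<in> U" by (rule germsE[OF f])
      then have "?z \<in> pts (P B)" using openin_subset by blast
      then have "(\<lambda>y. c * f y) \<in> germs (P B) ?z"
        by (intro germs_binop[OF ringed_P germs_const[OF ringed_P] f])
      then show ?thesis using f diff[OF f] by (simp add: curve_tangent_def)
    qed
  qed
qed

lemma germs_P:
  assumes "z \<in> pts (P B)"
  shows "(\<lambda>y. fst y $ l) \<in> germs (P B) z" "(\<lambda>y. snd y $ l) \<in> germs (P B) z"
  by (rule germs_morphism_TV[OF ringed_P morphism_P_TV assms])+

text \<open>A tangent direction of the hypersurface \<open>mu = \<xi>\<close> is the velocity of a rational curve in it:
  move in a straight line and rescale \<open>\<alpha>\<close> to stay on the hypersurface.\<close>

lemma level_tangent_exists: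
  assumes "\<xi> \<noteq> 0" "mu z = \<xi>" and w: "bilinear_derivative E z w = 0"
  obtains D where "D \<in> tangent (P {\<xi>}) z" "vderiv D fst = fst w" "vderiv D snd = snd w"
proof -
  define k where "k = pairing (snd w) (E *v fst w)"
  \<comment> \<open>For tangent \<open>w\<close> the value of \<open>mu\<close> on the straight line
    is \<open>\<xi> + t * t * k\<close>, without linear term. Hence the correcting factor has
    derivative 0 at 0, and the rescaling does not disturb the velocity.\<close>
  define c where "c = (\<lambda>t. \<xi> / (\<xi> + t * t * k))"
  define \<gamma> where "\<gamma> = (\<lambda>t. (fst z + t *s fst w, c t *s (snd z + t *s snd w)))"
  have \<gamma>0: "\<gamma> 0 = z" using assms(1) by (simp add: \<gamma>_def c_def)
  have c: "(c has_field_derivative 0) (at 0)"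
    unfolding c_def by (rule derivative_eq_intros refl | simp add: assms(1))+
  have c0: "c 0 = 1" using assms(1) by (simp add: c_def)
  have dfst: "((\<lambda>t. fst (\<gamma> t) $ l) has_field_derivative fst w $ l) (at 0)" for l
    unfolding \<gamma>_def by (auto intro!: derivative_eq_intros)
  have dsnd: "((\<lambda>t. snd (\<gamma> t) $ l) has_field_derivative snd w $ l) (at 0)" for l
    unfolding \<gamma>_def by (auto intro!: derivative_eq_intros c simp: c0)
  have D: "curve_tangent {\<xi>} \<gamma> \<in> tangent (P {\<xi>}) (\<gamma> 0)"
  proof (rule curve_tangent)
    show "(\<lambda>t. f (\<gamma> t)) field_differentiable at 0" if "f \<in> TV_coords" for f
      using that dfst dsnd by (cases rule: TV_coords_cases) (auto simp: field_differentiable_def)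
    have "isCont (\<lambda>t. \<xi> + t * t * k) 0" by (intro continuous_intros)
    then have "\<forall>\<^sub>F t in at 0. \<xi> + t * t * k \<noteq> 0"
      using assms(1) by (intro tendsto_imp_eventually_ne[of _ \<xi>]) (auto simp: isCont_def)
    then have "\<forall>\<^sub>F t in nhds 0. \<xi> + t * t * k \<noteq> 0"
      using assms(1) by (auto simp: eventually_at_filter elim: eventually_mono)
    then show "\<forall>\<^sub>F t in nhds 0. mu (\<gamma> t) \<in> {\<xi>}"
    proof (rule eventually_mono)
      fix t assume t: "\<xi> + t * t * k \<noteq> 0"
      have "mu (\<gamma> t) = c t * (mu z + t * bilinear_derivative E z w + t * t * k)"
        by (simp add: mu_def \<gamma>_def k_def bilinear_derivative_def pairing_simps matrix_vector_right_distrib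
            matrix_vector_scale algebra_simps)
      also have "\<dots> = \<xi>" using t assms(2) w by (simp add: c_def)
      finally show "mu (\<gamma> t) \<in> {\<xi>}" by simp
    qed
  qed
  have z: "z \<in> pts (P {\<xi>})" using assms(2) by simp
  show thesis
  proof (rule that)
    show "curve_tangent {\<xi>} \<gamma> \<in> tangent (P {\<xi>}) z" using D by (simp add: \<gamma>0)
    show "vderiv (curve_tangent {\<xi>} \<gamma>) fst = fst w"
      using dfst by (simp add: vec_eq_iff curve_tangent_def \<gamma>0 germs_P[OF z] DERIV_imp_deriv)
    show "vderiv (curve_tangent {\<xi>} \<gamma>) snd = snd w"
      using dsnd by (simp add: vec_eq_iff curve_tangent_def \<gamma>0 germs_P[OF z] DERIV_imp_deriv)
  qed
qed

lemma level_tangent_mu: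
  assumes "z \<in> pts (P {\<xi>})" "D \<in> tangent (P {\<xi>}) z"
  shows "bilinear_derivative E z (vderiv D fst, vderiv D snd) = 0"
proof -
  have "bilinear_derivative E z (vderiv D fst, vderiv D snd) = D (\<lambda>y. pairing (snd y) (E *v fst y))"
    using tangent_bilinear[OF ringed_P assms, of "\<lambda>z. z" E] germs_P[OF assms(1)] by simp
  also have "\<dots> = D (\<lambda>_. \<xi>)"
    by (rule tangent_cong[OF assms(2) _ germs_const[OF ringed_P assms(1)] openin_topspace assms(1)])
       (use assms(1) in \<open>auto simp: mu_def intro!: germs_global regf_mu_compose[OF morphism_P_TV, unfolded mu_def]\<close>)
  also have "\<dots> = 0" by (rule tangent_const[OF ringed_P assms])
  finally show ?thesis .
qed

text \<open>The Liouville form on the slice, transported by the section. The formula does not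
  mention the level, so one form serves all levels and the total space.\<close>

definition Omega :: "'n cotangent set form2" where
  "Omega = pullback_form TV section_pt liouville"

lemma vderiv_sigma:
  assumes Y: "ringed_fs Y" "y \<in> pts Y" and D: "D \<in> tangent Y y" and t: "t \<in> germs Y y"
  shows "mderiv D (\<lambda>y. \<sigma> (t y)) *v v = D t *s (\<sigma> (t y) *v (E *v v))"
    and "v v* mderiv D (\<lambda>y. \<sigma> (t y)) = D t *s ((v v* E) v* \<sigma> (t y))"
proof -
  have "mderiv D (\<lambda>y. \<sigma> (t y)) $ i $ j = D t * (\<sigma> (t y) ** E) $ i $ j" for i j
    unfolding mderiv_nth by (subst tangent_chain[OF Y D sigma_poly t sigma_deriv]) simp
  then have m: "mderiv D (\<lambda>y. \<sigma> (t y)) *v v = D t *s ((\<sigma> (t y) ** E) *v v)"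
    "v v* mderiv D (\<lambda>y. \<sigma> (t y)) = D t *s (v v* (\<sigma> (t y) ** E))" for v
    by (simp_all add: vec_eq_iff matrix_vector_mult_def vector_matrix_mult_def sum_distrib_left algebra_simps)
  show "mderiv D (\<lambda>y. \<sigma> (t y)) *v v = D t *s (\<sigma> (t y) *v (E *v v))"
    by (simp add: m matrix_vector_mul_assoc)
  show "v v* mderiv D (\<lambda>y. \<sigma> (t y)) = D t *s ((v v* E) v* \<sigma> (t y))"
    by (simp add: m vector_matrix_mul_assoc E_sigma)
qed

lemma pairing_sigma: "pairing (\<sigma> (- t) *v u) (w v* \<sigma> t) = pairing u w"
  by (subst pairing_commute)
     (simp add: pairing_vector_matrix matrix_vector_mul_assoc sigma_uminus pairing_commute[of w])

lemma Omega_pullback: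
  assumes \<xi>: "\<xi> \<noteq> 0" and z: "z \<in> pts (P {\<xi>})"
    and D: "D1 \<in> tangent (P {\<xi>}) z" "D2 \<in> tangent (P {\<xi>}) z"
  shows "pullback_form (X {\<xi>}) orb Omega z D1 D2 = pullback_form TV (\<lambda>z. z) liouville z D1 D2"
proof -
  have B: "0 \<notin> {\<xi>}" using \<xi> by simp
  have tau: "(\<lambda>z. - tau z) \<in> germs (P {\<xi>}) z"
    by (intro germs_global[OF z] regf_uminus[OF ringed_P] openin_topspace regf_tau[OF B])
  \<comment> \<open>The action at time \<open>- tau\<close> applies
    \<open>\<sigma> (- (- tau z))\<close> to \<open>\<alpha>\<close>; the double negation is kept to
    match \<open>act_eq\<close>.\<close>
  have tau': "(\<lambda>z. - (- tau z)) \<in> germs (P {\<xi>}) z"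
    by (intro germs_global[OF z] regf_uminus[OF ringed_P] openin_topspace regf_tau[OF B])
  have sigma: "(\<lambda>z. \<sigma> (t z) $ i $ j) \<in> germs (P {\<xi>}) z" if "t \<in> germs (P {\<xi>}) z" for t i j
    by (rule germs_poly[OF ringed_P z sigma_poly]) (use that in simp)
  \<comment> \<open>The differential of \<open>to_slice\<close>: variation of the time
    \<open>- tau\<close> contributes \<open>- D tau\<close> times the velocity
    \<open>(E x, - \<alpha> E)\<close>, before the transport by the group.\<close>
  have push: "vderiv (push_forward (X {\<xi>}) orb z D) (\<lambda>y. fst (section_pt y)) =
        \<sigma> (- tau z) *v (vderiv D fst - D tau *s (E *v fst z))"
      "vderiv (push_forward (X {\<xi>}) orb z D) (\<lambda>y. snd (section_pt y)) =
        (vderiv D snd + D tau *s (snd z v* E)) v* \<sigma> (tau z)"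
    if D: "D \<in> tangent (P {\<xi>}) z" for D
  proof -
    have oz: "orb z \<in> pts (X {\<xi>})" using z by simp
    note g = germs_morphism_TV[OF ringed_X morphism_section_TV[OF B] oz]
    note g' = germs_morphism_TV[OF ringed_P morphism_compose[OF morphism_orb morphism_section_TV[OF B]] z]
    note g'' = germs_morphism_TV[OF ringed_P morphism_to_slice[OF B] z, unfolded to_slice_def act_eq fst_conv snd_conv]
    have Dt: "D (\<lambda>z. - tau z) = - D tau"
      using tangent_scale[OF D germs_global[OF z regf_tau[OF B]], of "-1"] by simp
    have s: "section_pt (orb y) = (\<sigma> (- tau y) *v fst y, snd y v* \<sigma> (- (- tau y)))" if "y \<in> pts (P {\<xi>})" for y
    proof -
      have "mu y \<noteq> 0" using that \<xi> by simp
      from section_pt_orb[OF this] show ?thesis by (simp only: to_slice_def act_eq)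
    qed
    have "vderiv (push_forward (X {\<xi>}) orb z D) (\<lambda>y. fst (section_pt y)) = vderiv D (\<lambda>y. \<sigma> (- tau y) *v fst y)"
      unfolding vderiv_push_forward[of _ "X {\<xi>}" orb z, OF g(1)]
      by (rule vderiv_cong[OF ringed_P z D g'(1) g''(1)]) (simp only: s fst_conv)
    also have "\<dots> = \<sigma> (- tau z) *v (vderiv D fst - D tau *s (E *v fst z))"
      unfolding vderiv_matrix_vector[OF ringed_P z D sigma[OF tau] germs_P(1)[OF z]] vderiv_sigma[OF ringed_P z D tau] Dt
      by (simp add: matrix_vector_mult_diff_distrib matrix_vector_scale vec_eq_iff)
    finally show "vderiv (push_forward (X {\<xi>}) orb z D) (\<lambda>y. fst (section_pt y)) =
        \<sigma> (- tau z) *v (vderiv D fst - D tau *s (E *v fst z))" .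
    have "vderiv (push_forward (X {\<xi>}) orb z D) (\<lambda>y. snd (section_pt y)) = vderiv D (\<lambda>y. snd y v* \<sigma> (- (- tau y)))"
      unfolding vderiv_push_forward[of _ "X {\<xi>}" orb z, OF g(2)]
      by (rule vderiv_cong[OF ringed_P z D g'(2) g''(2)]) (simp only: s snd_conv)
    also have "\<dots> = (vderiv D snd + D tau *s (snd z v* E)) v* \<sigma> (tau z)"
      unfolding vderiv_vector_matrix[OF ringed_P z D sigma[OF tau'] germs_P(2)[OF z]] vderiv_sigma[OF ringed_P z D tau']
      by (simp add: vector_matrix_left_distrib scalar_vector_matrix_assoc)
    finally show "vderiv (push_forward (X {\<xi>}) orb z D) (\<lambda>y. snd (section_pt y)) =
        (vderiv D snd + D tau *s (snd z v* E)) v* \<sigma> (tau z)" .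
  qed
  \<comment> \<open>This is \<open>d mu = 0\<close> on the level. The group elements cancel by
    \<open>pairing_sigma\<close>, and the remaining terms containing \<open>D1 tau\<close> or
    \<open>D2 tau\<close> are multiples of \<open>d mu\<close>, apart from the symmetric ones, which
    drop out by antisymmetry.\<close>
  have mu: "pairing (vderiv D snd) (E *v fst z) = - pairing (vderiv D fst) (snd z v* E)" if "D \<in> tangent (P {\<xi>}) z" for D
    using level_tangent_mu[OF z that]
    by (simp add: bilinear_derivative_def pairing_commute[of _ "snd z v* E"] pairing_vector_matrix add_eq_0_iff)
  show ?thesis
    unfolding pullback_form_def[of "X {\<xi>}"] Omega_def pullback_liouville_eq push[OF D(1)] push[OF D(2)] pairing_sigma
    using mu[OF D(1)] mu[OF D(2)]
    by (simp add: pairing_simps pairing_commute[of "E *v fst z"] algebra_simps)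
qed

section \<open>Algebraicity and closedness of the form\<close>

lemma Omega_local_expression:
  assumes "0 \<notin> B"
  shows "local_expression (X B) (pts (X B)) Omega CARD('n) (\<lambda>_ _. 1)
    (\<lambda>i y. fst (section_pt y) $ inv coord_index i) (\<lambda>i y. snd (section_pt y) $ inv coord_index i)"
  unfolding local_expression_def
proof (intro conjI allI impI ballI)
  fix y D1 D2
  let ?w = "\<lambda>l. wedge2 (\<lambda>y. fst (section_pt y) $ l) (\<lambda>y. snd (section_pt y) $ l) D1 D2"
  have "Omega y D1 D2 = (\<Sum>l\<in>UNIV. ?w l)"
    unfolding Omega_def pullback_liouville_eq by (simp add: pairing_def wedge2_def sum_subtractf)
  also have "\<dots> = (\<Sum>l::'n\<in>UNIV. ?w (inv coord_index (coord_index l)))" by simp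
  also have "\<dots> = (\<Sum>i\<in>{0..<CARD('n)}. ?w (inv coord_index i))"
    by (rule sum.reindex_bij_betw[OF bij_coord_index, of "\<lambda>i. ?w (inv coord_index i)"])
  finally show "Omega y D1 D2 = (\<Sum>i<CARD('n). 1 * wedge2 (\<lambda>y. fst (section_pt y) $ inv coord_index i)
      (\<lambda>y. snd (section_pt y) $ inv coord_index i) D1 D2)" by (simp add: atLeast0LessThan)
qed (use morphism_section_TV[OF assms] in \<open>auto simp: morphism_TV_iff[OF ringed_X] simp del: pts_X intro!: regf_const[OF ringed_X openin_topspace]\<close>)

lemma Omega_algebraic: "0 \<notin> B \<Longrightarrow> algebraic_2form (X B) Omega"
  unfolding algebraic_2form_def using Omega_local_expression openin_topspace by blast

text \<open>The coefficients of the local expression are constant, and every term of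
  \<open>wedge3\<close> contains a derivative of the coefficient.\<close>

lemma Omega_closed:
  assumes B: "0 \<notin> B"
  shows "closed_2form (X B) Omega"
  unfolding closed_2form_def has_exterior_derivative_def
proof (intro ballI exI conjI)
  show "local_expression (X B) (pts (X B)) Omega CARD('n) (\<lambda>_ _. 1)
    (\<lambda>i y. fst (section_pt y) $ inv coord_index i) (\<lambda>i y. snd (section_pt y) $ inv coord_index i)"
    by (rule Omega_local_expression[OF B])
  fix y D1 D2 D3 assume y: "y \<in> pts (X B)" and "D1 \<in> tangent (X B) y" "D2 \<in> tangent (X B) y" "D3 \<in> tangent (X B) y"
  then show "0 = (\<Sum>i<CARD('n). wedge3 (\<lambda>_. 1) (\<lambda>y. fst (section_pt y) $ inv coord_index i)
      (\<lambda>y. snd (section_pt y) $ inv coord_index i) D1 D2 D3)"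
    by (simp add: wedge3_def tangent_const[OF ringed_X y] del: pts_X)
qed (assumption | rule openin_topspace)+

section \<open>Nondegeneracy of the form\<close>

lemma push_forward_orb_section:
  assumes \<xi>: "0 \<notin> B" and y: "y \<in> pts (X B)" and D: "D \<in> tangent (X B) y"
  shows "push_forward (X B) orb (section_pt y) (push_forward (P B) section_pt y D) = D"
proof
  fix g
  have o: "orb (section_pt y) = y" by (rule orb_section_pt[OF y \<xi>])
  have z: "section_pt y \<in> pts (P B)" using mu_section_pt[OF y \<xi>] by simp
  show "push_forward (X B) orb (section_pt y) (push_forward (P B) section_pt y D) g = D g"
  proof (cases "g \<in> germs (X B) y")
    case True
    then have g: "g \<in> germs (X B) (orb (section_pt y))" by (simp add: o)
    have g': "(\<lambda>z. g (orb z)) \<in> germs (P B) (section_pt y)" by (rule germs_compose[OF morphism_orb z g])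
    have "push_forward (X B) orb (section_pt y) (push_forward (P B) section_pt y D) g = D (\<lambda>y. g (orb (section_pt y)))"
      by (simp add: push_forward_germ[of _ "X B" orb, OF g] push_forward_germ[of _ "P B" section_pt, OF g'])
    \<comment> \<open>The section is a right inverse of \<open>orb\<close>, so both functions agree
      on the whole quotient.\<close>
    also have "\<dots> = D g"
      by (rule tangent_cong[OF D germs_compose[OF morphism_section[OF \<xi>] y g'] True openin_topspace y])
         (simp add: orb_section_pt[OF _ \<xi>] del: pts_X)
    finally show ?thesis .
  next
    case False
    then show ?thesis using tangent_not_germ[OF D False] by (simp add: push_forward_def o)
  qed
qed

text \<open>Near \<open>y\<close> a germ \<open>g\<close> on the quotient equals \<open>g\<close>
  composed with \<open>orb\<close> and the section, hence a quotient \<open>p / q\<close> of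
  polynomials in the coordinates of the section. A derivation killing these coordinates kills
  \<open>p\<close> and \<open>q\<close>, and then \<open>g\<close> by the product rule for
  \<open>g * q = p\<close>.\<close>

lemma tangent_X_eq_0:
  assumes B: "0 \<notin> B" and y: "y \<in> pts (X B)" and D: "D \<in> tangent (X B) y"
    and 0: "vderiv D (\<lambda>y. fst (section_pt y)) = 0" "vderiv D (\<lambda>y. snd (section_pt y)) = 0"
  shows "D = (\<lambda>_. 0)"
proof
  fix g
  show "D g = 0"
  proof (cases "g \<in> germs (X B) y")
    case True
    have o: "orb (section_pt y) = y" by (rule orb_section_pt[OF y B])
    have z: "section_pt y \<in> pts (P B)" using mu_section_pt[OF y B] by simp
    have "(\<lambda>z. g (orb z)) \<in> germs (P B) (section_pt y)"
      by (rule germs_compose[OF morphism_orb z]) (simp add: o True)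
    then obtain U where U: "openin (topo (P B)) U" "section_pt y \<in> U" "(\<lambda>z. g (orb z)) \<in> regf (P B) U"
      by (rule germsE)
    obtain W g' where W: "openin (topo TV) W" "section_pt y \<in> W" "g' \<in> regf TV W" "\<forall>z\<in>W \<inter> U. g (orb z) = g' z"
      using U(3,2) unfolding P_def by (rule regf_subspaceE)
    obtain W' p q where W': "openin (topo TV) W'" "section_pt y \<in> W'" "W' \<subseteq> W" "p \<in> poly_functions TV_coords"
      "q \<in> poly_functions TV_coords" "\<forall>z\<in>W'. q z \<noteq> 0 \<and> g' z = p z / q z"
      using W(3,2) unfolding TV_eq by (rule regf_affineE)
    let ?V = "{y \<in> pts (X B). section_pt y \<in> W'} \<inter> {y \<in> pts (X B). section_pt y \<in> U}"
    have V: "openin (topo (X B)) ?V"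
      by (intro openin_Int morphism_openin[OF morphism_section_TV[OF B]] morphism_openin[OF morphism_section[OF B]] U W')
    have yV: "y \<in> ?V" using y U W' by simp
    have coord: "(\<lambda>y. c (section_pt y)) \<in> germs (X B) y" "D (\<lambda>y. c (section_pt y)) = 0" if "c \<in> TV_coords" for c
      using that germs_morphism_TV[OF ringed_X morphism_section_TV[OF B] y] 0
      by (auto elim!: TV_coords_cases simp: vec_eq_iff)
    have eq: "g y' * q (section_pt y') = p (section_pt y')" if "y' \<in> ?V" for y'
    proof -
      have y': "y' \<in> pts (X B)" "section_pt y' \<in> W'" "section_pt y' \<in> U" using that by auto
      then have "g (orb (section_pt y')) = p (section_pt y') / q (section_pt y')" "q (section_pt y') \<noteq> 0"
        using W(4) W'(3,6) by auto
      then show ?thesis using orb_section_pt[OF y'(1) B] by simp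
    qed
    have p: "(\<lambda>y. p (section_pt y)) \<in> germs (X B) y" and q: "(\<lambda>y. q (section_pt y)) \<in> germs (X B) y"
      by (rule germs_poly[OF ringed_X y W'(4) coord(1)] germs_poly[OF ringed_X y W'(5) coord(1)], assumption)+
    have "D (\<lambda>y. g y * q (section_pt y)) = D (\<lambda>y. p (section_pt y))"
      by (rule tangent_cong[OF D germs_binop(2)[OF ringed_X True q] p V yV eq])
    also have "\<dots> = 0" by (rule tangent_poly_zero[OF ringed_X y D W'(4) coord])
    finally have "g y * D (\<lambda>y. q (section_pt y)) + q (section_pt y) * D g = 0"
      by (simp add: tangent_mult[OF D True q])
    moreover have "D (\<lambda>y. q (section_pt y)) = 0" by (rule tangent_poly_zero[OF ringed_X y D W'(5) coord])
    ultimately show ?thesis using W'(2,6) by auto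
  qed (rule tangent_not_germ[OF D])
qed

text \<open>The symplectic complement of the kernel of \<open>d mu\<close> is spanned by the
  Hamiltonian vector field of \<open>mu\<close>, which is the velocity of the action. This is a
  Lagrange multiplier argument: a linear functional vanishing on the kernel of \<open>d mu\<close>
  is a multiple of \<open>d mu\<close>.\<close>

lemma symplectic_orthogonal_mu:
  fixes v :: "'n cotangent"
  assumes \<xi>: "mu z \<noteq> 0"
    and orth: "\<And>w. bilinear_derivative E z w = 0 \<Longrightarrow> pairing (fst v) (snd w) - pairing (fst w) (snd v) = 0"
  obtains k where "fst v = k *s (E *v fst z)" "snd v = - (k *s (snd z v* E))"
proof -
  \<comment> \<open>The Euler field \<open>(fst z, 0)\<close> is transversal to the kernel, with
    \<open>d mu\<close> equal to \<open>mu z\<close> there; the multiplier is the value of the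
    functional on it divided by \<open>mu z\<close>.\<close>
  define k where "k = - pairing (fst z) (snd v) / mu z"
  have key: "pairing (fst v) b - pairing a (snd v) = k * bilinear_derivative E z (a, b)" for a b
  proof -
    \<comment> \<open>Subtracting \<open>?c\<close> times the Euler field projects an arbitrary
      vector into the kernel.\<close>
    let ?c = "bilinear_derivative E z (a, b) / mu z"
    have "bilinear_derivative E z (a - ?c *s fst z, b) = 0"
      using \<xi> by (simp add: bilinear_derivative_def mu_def pairing_simps matrix_vector_mult_diff_distrib matrix_vector_scale)
    then have "pairing (fst v) b - pairing (a - ?c *s fst z) (snd v) = 0" using orth by fastforce
    then show ?thesis by (simp add: pairing_simps k_def)
  qed
  show thesis
  proof (rule that[of k])
    \<comment> \<open>Unit vectors for \<open>b\<close>, and below for \<open>a\<close>, read off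
      the components; in \<open>key\<close> the variable \<open>b\<close> occurs before
      \<open>a\<close> and is instantiated first.\<close>
    show "fst v = k *s (E *v fst z)"
      using key[of "axis l 1" 0 for l] by (simp add: vec_eq_iff bilinear_derivative_def pairing_axis)
    show "snd v = - (k *s (snd z v* E))"
      using key[of 0 "axis l 1" for l]
      by (simp add: vec_eq_iff bilinear_derivative_def pairing_axis pairing_vector_matrix[symmetric])
         (metis minus_minus)
  qed
qed

lemma Omega_nondegenerate:
  assumes \<xi>: "\<xi> \<noteq> 0"
  shows "nondegenerate (X {\<xi>}) Omega"
  unfolding nondegenerate_def
proof (intro ballI impI)
  have B: "0 \<notin> {\<xi>}" using \<xi> by simp
  fix y D assume y: "y \<in> pts (X {\<xi>})" and D: "D \<in> tangent (X {\<xi>}) y"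
    and orth: "\<forall>D'\<in>tangent (X {\<xi>}) y. Omega y D D' = 0"
  define z where "z = section_pt y"
  have z: "z \<in> pts (P {\<xi>})" "orb z = y" "nu z = 0"
    using mu_section_pt[OF y B] orb_section_pt[OF y B] nu_section_pt[OF y B] by (simp_all add: z_def)
  have muz: "mu z = \<xi>" using z(1) by simp
  \<comment> \<open>The lift of \<open>D\<close> to the slice, where the Liouville form and the
    curves in the level are available.\<close>
  define D1 where "D1 = push_forward (P {\<xi>}) section_pt y D"
  have D1: "D1 \<in> tangent (P {\<xi>}) z"
    unfolding D1_def z_def by (rule push_forward_tangent[OF ringed_X ringed_P morphism_section[OF B] y D])
  have push_back: "push_forward (X {\<xi>}) orb z D1 = D"
    unfolding D1_def z_def by (rule push_forward_orb_section[OF B y D])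
  have v: "vderiv D1 fst = vderiv D (\<lambda>y. fst (section_pt y))" "vderiv D1 snd = vderiv D (\<lambda>y. snd (section_pt y))"
    unfolding D1_def by (rule vderiv_push_forward; rule germs_P[OF z(1)[unfolded z_def]])+
  have "pairing (vderiv D1 fst) (snd w) - pairing (fst w) (vderiv D1 snd) = 0"
    if w: "bilinear_derivative E z w = 0" for w
  proof -
    obtain D2 where D2: "D2 \<in> tangent (P {\<xi>}) z" "vderiv D2 fst = fst w" "vderiv D2 snd = snd w"
      by (rule level_tangent_exists[OF \<xi> muz w])
    have "push_forward (X {\<xi>}) orb z D2 \<in> tangent (X {\<xi>}) y"
      using push_forward_tangent[OF ringed_P ringed_X morphism_orb z(1) D2(1)] by (simp add: z(2))
    \<comment> \<open>Pushing \<open>D1\<close> down returns \<open>D\<close>, so orthogonality on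
      the quotient applies to the image of \<open>D2\<close>.\<close>
    then have "pullback_form (X {\<xi>}) orb Omega z D1 D2 = 0"
      using orth by (simp add: pullback_form_def push_back z(2))
    then show ?thesis
      unfolding Omega_pullback[OF \<xi> z(1) D1 D2(1)] pullback_liouville_eq D2 by simp
  qed
  then obtain k where k: "vderiv D1 fst = k *s (E *v fst z)" "vderiv D1 snd = - (k *s (snd z v* E))"
    using symplectic_orthogonal_mu[of z "(vderiv D1 fst, vderiv D1 snd)"] muz \<xi> by auto
  \<comment> \<open>On the one hand \<open>nu\<close> vanishes along the section; on the other hand
    its derivative on \<open>k\<close> times the velocity is \<open>2 * k * mu z\<close>.\<close>
  have "bilinear_derivative H z (vderiv D1 fst, vderiv D1 snd) = D (\<lambda>y. nu (section_pt y))"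
    using tangent_bilinear[OF ringed_X y D germs_morphism_TV[OF ringed_X morphism_section_TV[OF B] y], of H]
    by (simp add: v nu_def z_def)
  also have "\<dots> = D (\<lambda>_. 0)"
    by (rule tangent_cong[OF D _ germs_const[OF ringed_X y] openin_topspace y])
       (auto intro!: germs_global[OF y] regf_nu_compose morphism_section_TV[OF B] nu_section_pt[OF _ B] simp del: pts_X)
  also have "\<dots> = 0" by (rule tangent_const[OF ringed_X y D])
  finally have "k * (2 * mu z) = 0"
    unfolding k by (simp add: bilinear_derivative_def pairing_simps pairing_vector_matrix matrix_vector_scale H_E mu_def algebra_simps)
  then have "k = 0" using muz \<xi> by simp
  then show "D = (\<lambda>_. 0)"
    by (intro tangent_X_eq_0[OF B y D]) (simp_all add: v[symmetric] k)
qed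

lemma symplectic_level: "\<xi> \<noteq> 0 \<Longrightarrow> algebraic_symplectic (X {\<xi>}) Omega"
  by (simp add: algebraic_symplectic_def variety_level smooth_level Omega_algebraic Omega_closed Omega_nondegenerate)

end

context slice_data begin

section \<open>The family over the punctured line and the scaling isomorphisms\<close>

lemma morphism_total_Cstar: "morphism (X (- {0})) Cstar (\<lambda>y. mu (section_pt y))"
  unfolding Cstar_def
proof (rule morphism_to_subspace[OF ringed_X])
  show "morphism (X (- {0})) Ga (\<lambda>y. mu (section_pt y))"
    unfolding Ga_def by (rule morphism_to_affine[OF ringed_X]) (auto intro!: regf_mu_compose morphism_section_TV simp del: pts_X)
  show "mu (section_pt y) \<in> - {0}" if "y \<in> pts (X (- {0}))" for y
    using that by (rule mu_section_pt) simp
qed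

text \<open>The orbits are the same sets; what has to be compared is the quotient structure of the
  level with the structure induced by the total quotient. One direction is the universal property,
  and in the other the identity factors through the level as \<open>orb\<close> after
  \<open>section_pt\<close>.\<close>

lemma level_fibre_isomorphism:
  assumes \<xi>: "\<xi> \<noteq> 0"
  shows "isomorphism (X {\<xi>}) (subspace_fs (X (- {0})) {y \<in> pts (X (- {0})). mu (section_pt y) = \<xi>}) (\<lambda>y. y)"
    (is "isomorphism _ (subspace_fs ?T ?F) _")
proof (rule isomorphismI)
  have B: "0 \<notin> {\<xi>}" "0 \<notin> - {0 :: complex}" using \<xi> by auto
  have "morphism (P {\<xi>}) (P (- {0})) (\<lambda>z. z)"
    by (rule morphism_to_P[OF ringed_P morphism_P_TV]) (use \<xi> in auto)
  then have "morphism (P {\<xi>}) ?T orb"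
    by (rule morphism_compose[OF _ morphism_orb])
  then have "morphism (X {\<xi>}) ?T (\<lambda>y. y)"
    unfolding X_def[of "{\<xi>}"] by (rule morphism_from_quotient)
  then show "morphism (X {\<xi>}) (subspace_fs ?T ?F) (\<lambda>y. y)"
    by (rule morphism_to_subspace[OF ringed_X]) (use \<xi> in \<open>auto simp: section_pt_orb\<close>)
  have F: "y \<in> ?F" if "y \<in> pts (subspace_fs ?T ?F)" for y using that by auto
  have "morphism (subspace_fs ?T ?F) (P {\<xi>}) section_pt"
    by (rule morphism_to_P[OF ringed_subspace[OF ringed_X] morphism_compose[OF morphism_inclusion morphism_section_TV[OF B(2)]]])
       (use F in blast)
  then have "morphism (subspace_fs ?T ?F) (X {\<xi>}) (\<lambda>y. orb (section_pt y))"
    by (rule morphism_compose[OF _ morphism_orb])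
  then show "morphism (subspace_fs ?T ?F) (X {\<xi>}) (\<lambda>y. y)"
    by (rule morphism_cong[OF ringed_subspace[OF ringed_X]]) (use F orb_section_pt[OF _ B(2)] in blast)
qed auto

section \<open>Scaling of the covector and of the form\<close>

definition rescale :: "complex \<Rightarrow> 'n cotangent set \<Rightarrow> 'n cotangent set" where
  "rescale k y = orb (fst (section_pt y), k *s snd (section_pt y))"

text \<open>Scaling \<open>\<alpha>\<close> multiplies both \<open>nu\<close> and \<open>mu\<close>
  by \<open>k\<close>, so the slice is preserved and the scaled point is again the slice
  representative of its orbit.\<close>

lemma section_pt_rescale:
  assumes "k \<noteq> 0" "0 \<notin> B" "y \<in> pts (X B)"
  shows "section_pt (rescale k y) = (fst (section_pt y), k *s snd (section_pt y))"
proof -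
  let ?z = "section_pt y"
  have "nu (fst ?z, k *s snd ?z) = 0" "mu (fst ?z, k *s snd ?z) = k * mu ?z"
    using nu_section_pt[OF assms(3,2)] by (simp_all add: nu_def mu_def pairing_simps)
  moreover have "mu ?z \<noteq> 0" using mu_section_pt[OF assms(3,2)] assms(2) by auto
  ultimately show ?thesis
    using assms(1) unfolding rescale_def by (simp only: section_pt_orb to_slice_id mult_eq_0_iff simp_thms)
qed

lemma morphism_rescale:
  assumes "k \<noteq> 0" "0 \<notin> B"
  shows "morphism (X B) (X ((\<lambda>\<xi>. k * \<xi>) ` B)) (rescale k)"
  unfolding rescale_def[abs_def]
proof (rule morphism_compose[OF morphism_to_P morphism_orb])
  show "ringed_fs (X B)" by (rule ringed_X)
  show "morphism (X B) TV (\<lambda>y. (fst (section_pt y), k *s snd (section_pt y)))"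
    using morphism_section_TV[OF assms(2)] unfolding morphism_TV_iff[OF ringed_X]
    by (auto intro!: regf_mult[OF ringed_X openin_topspace] regf_const[OF ringed_X openin_topspace] simp del: pts_X)
  fix y assume "y \<in> pts (X B)"
  then show "mu (fst (section_pt y), k *s snd (section_pt y)) \<in> (\<lambda>\<xi>. k * \<xi>) ` B"
    using mu_section_pt[OF _ assms(2), of y] by (auto simp: mu_def pairing_simps)
qed

lemma rescale_inverse:
  assumes "k \<noteq> 0" "0 \<notin> B" "y \<in> pts (X B)" "k' * k = 1"
  shows "rescale k' (rescale k y) = y"
  unfolding rescale_def[of k'] section_pt_rescale[OF assms(1-3)]
  using assms(4) orb_section_pt[OF assms(3,2)] by simp

lemma isomorphism_rescale:
  assumes "k \<noteq> 0" "\<xi> \<noteq> 0"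
  shows "isomorphism (X {\<xi>}) (X {k * \<xi>}) (rescale k)"
proof (rule isomorphismI)
  have B: "0 \<notin> {\<xi>}" "0 \<notin> {k * \<xi>}" "inverse k \<noteq> 0" using assms by auto
  show "morphism (X {\<xi>}) (X {k * \<xi>}) (rescale k)" using morphism_rescale[OF assms(1) B(1)] by simp
  show "morphism (X {k * \<xi>}) (X {\<xi>}) (rescale (inverse k))"
    using morphism_rescale[OF B(3,2)] assms(1) by (simp add: mult.assoc[symmetric])
  show "rescale (inverse k) (rescale k y) = y" if "y \<in> pts (X {\<xi>})" for y
    using rescale_inverse[OF assms(1) B(1) that] assms(1) by simp
  show "rescale k (rescale (inverse k) y) = y" if "y \<in> pts (X {k * \<xi>})" for y
    using rescale_inverse[OF B(3,2) that] assms(1) by simp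
qed

text \<open>In slice coordinates the map scales \<open>\<alpha>\<close> alone, and the Liouville
  form is linear in the differentials of \<open>\<alpha>\<close>.\<close>

lemma Omega_rescale:
  assumes k: "k \<noteq> 0" and B: "0 \<notin> B" and y: "y \<in> pts (X B)" and D: "D1 \<in> tangent (X B) y" "D2 \<in> tangent (X B) y"
  shows "pullback_form (X ((\<lambda>\<xi>. k * \<xi>) ` B)) (rescale k) Omega y D1 D2 = k * Omega y D1 D2"
proof -
  let ?B = "(\<lambda>\<xi>. k * \<xi>) ` B"
  have B': "0 \<notin> ?B" using k B by auto
  note mor = morphism_rescale[OF k B]
  note g = germs_morphism_TV[OF ringed_X morphism_section_TV[OF B'] morphism_pts[OF mor y]]
  note g' = germs_morphism_TV[OF ringed_X morphism_compose[OF mor morphism_section_TV[OF B']] y]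
  note g'' = germs_morphism_TV[OF ringed_X morphism_section_TV[OF B] y]
  have push: "vderiv (push_forward (X ?B) (rescale k) y D) (\<lambda>y. fst (section_pt y)) = vderiv D (\<lambda>y. fst (section_pt y))"
    "vderiv (push_forward (X ?B) (rescale k) y D) (\<lambda>y. snd (section_pt y)) = k *s vderiv D (\<lambda>y. snd (section_pt y))"
    if D: "D \<in> tangent (X B) y" for D
  proof -
    show "vderiv (push_forward (X ?B) (rescale k) y D) (\<lambda>y. fst (section_pt y)) = vderiv D (\<lambda>y. fst (section_pt y))"
      unfolding vderiv_push_forward[of _ "X ?B" "rescale k" y, OF g(1)]
      by (rule vderiv_cong[OF ringed_X y D g'(1) g''(1)]) (simp only: section_pt_rescale[OF k B] fst_conv)
    have s: "(\<lambda>y. (k *s snd (section_pt y)) $ l) \<in> germs (X B) y" for l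
      using germs_binop(2)[OF ringed_X germs_const[OF ringed_X y] g''(2), of k l] by simp
    have "vderiv (push_forward (X ?B) (rescale k) y D) (\<lambda>y. snd (section_pt y)) = vderiv D (\<lambda>y. k *s snd (section_pt y))"
      unfolding vderiv_push_forward[of _ "X ?B" "rescale k" y, OF g(2)]
      by (rule vderiv_cong[OF ringed_X y D g'(2) s]) (simp only: section_pt_rescale[OF k B] snd_conv)
    also have "\<dots> = k *s vderiv D (\<lambda>y. snd (section_pt y))"
      by (simp add: vec_eq_iff tangent_scale[OF D g''(2)])
    finally show "vderiv (push_forward (X ?B) (rescale k) y D) (\<lambda>y. snd (section_pt y)) = k *s vderiv D (\<lambda>y. snd (section_pt y))" .
  qed
  show ?thesis
    unfolding pullback_form_def[of "X ?B"] Omega_def pullback_liouville_eq push[OF D(1)] push[OF D(2)]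
    by (simp add: pairing_simps algebra_simps)
qed

end

section \<open>The semisimple element\<close>

definition torus :: "complex \<Rightarrow> complex^2^2" where
  "torus a = vector [vector [a, 0], vector [0, inverse a]]"

lemma det_torus: "a \<noteq> 0 \<Longrightarrow> det (torus a) = 1" and det_unip: "det (unip t) = 1"
  by (simp_all add: det_2 torus_def unip_def)

lemma torus_1: "torus 1 = mat 1"
  by (simp add: vec_eq_iff forall_2 torus_def mat_def)

lemma torus_unip: "a \<noteq> 0 \<Longrightarrow> torus a ** unip t = unip (a * a * t) ** torus a"
  by (simp add: vec_eq_iff forall_2 torus_def unip_def matrix_matrix_mult_def sum_2)

text \<open>The element \<open>H\<close> is the derivative of the torus at 1; differentiating
  \<open>torus a ** unip t = unip (a\<^sup>2 t) ** torus a\<close> there gives its commutation relation with \<open>\<sigma> t\<close>.\<close>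

lemma slice_data_SL2:
  fixes \<sigma> :: "complex \<Rightarrow> complex^'n::finite^'n"
  assumes \<sigma>: "linear_Ga_action \<sigma>" and \<rho>: "SL2_representation \<rho>" and ext: "\<forall>t. \<rho> (unip t) = \<sigma> t"
  obtains H where "slice_data \<sigma> (rho_E \<rho>) H"
proof -
  define E where "E = rho_E \<rho>"
  define H where "H = (\<chi> i j. deriv (\<lambda>a. \<rho> (torus a) $ i $ j) 1)"
  have s0: "\<sigma> 0 = mat 1" and sadd: "\<sigma> (s + t) = \<sigma> s ** \<sigma> t"
    and spoly: "(\<lambda>t. \<sigma> t $ i $ j) \<in> poly_functions {\<lambda>t. t}" for s t i j
    using \<sigma> by (auto simp: linear_Ga_action_def)
  have r1: "\<rho> (mat 1) = mat 1" and rmult: "det g = 1 \<Longrightarrow> det h = 1 \<Longrightarrow> \<rho> (g ** h) = \<rho> g ** \<rho> h" for g h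
    using \<rho> by (auto simp: SL2_representation_def)
  have E0: "((\<lambda>t. \<sigma> t $ i $ j) has_field_derivative E $ i $ j) (at 0)" for i j
  proof -
    have "(\<lambda>t. \<sigma> t $ i $ j) field_differentiable at 0"
      by (rule poly_curve_differentiable[OF spoly, of "\<lambda>t. t"]) auto
    then show ?thesis by (simp add: E_def rho_E_def ext DERIV_deriv_iff_field_differentiable)
  qed
  \<comment> \<open>Both sides of \<open>\<sigma> s ** \<sigma> (t - s) = \<sigma> (t - s) **
    \<sigma> s\<close> are expressions for \<open>\<sigma> t\<close>; differentiating each at
    \<open>t = s\<close> gives the two forms, whose comparison shows that \<open>E\<close> commutes
    with the group.\<close>
  have deriv: "((\<lambda>t. \<sigma> t $ i $ j) has_field_derivative (\<sigma> s ** E) $ i $ j) (at s)"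
    "((\<lambda>t. \<sigma> t $ i $ j) has_field_derivative (E ** \<sigma> s) $ i $ j) (at s)" for i j s
  proof -
    have shift: "((\<lambda>t. \<sigma> (t - s) $ k $ l) has_field_derivative E $ k $ l) (at s)" for k l
    proof -
      have "((\<lambda>t. t - s) has_field_derivative 1) (at s)" by (auto intro!: derivative_eq_intros)
      then show ?thesis using DERIV_chain2[of "\<lambda>t. \<sigma> t $ k $ l" "E $ k $ l" "\<lambda>t. t - s" s 1] E0 by simp
    qed
    have 1: "\<sigma> t $ i $ j = (\<Sum>k\<in>UNIV. \<sigma> s $ i $ k * \<sigma> (t - s) $ k $ j)" for t
      using sadd[of s "t - s"] by (simp add: matrix_matrix_mult_def)
    have 2: "\<sigma> t $ i $ j = (\<Sum>k\<in>UNIV. \<sigma> (t - s) $ i $ k * \<sigma> s $ k $ j)" for t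
      using sadd[of "t - s" s] by (simp add: matrix_matrix_mult_def)
    show "((\<lambda>t. \<sigma> t $ i $ j) has_field_derivative (\<sigma> s ** E) $ i $ j) (at s)"
      unfolding 1 matrix_matrix_mult_def vec_lambda_beta by (intro DERIV_sum DERIV_cmult DERIV_cmult_right shift)
    show "((\<lambda>t. \<sigma> t $ i $ j) has_field_derivative (E ** \<sigma> s) $ i $ j) (at s)"
      unfolding 2 matrix_matrix_mult_def vec_lambda_beta by (intro DERIV_sum DERIV_cmult DERIV_cmult_right shift)
  qed
  have comm: "E ** \<sigma> t = \<sigma> t ** E" for t
    using DERIV_unique[OF deriv(2) deriv(1)] by (simp add: vec_eq_iff)
  have H_deriv: "((\<lambda>a. \<rho> (torus a) $ i $ j) has_field_derivative H $ i $ j) (at 1)" for i j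
  proof -
    obtain p where p: "p \<in> poly_functions {(\<lambda>g. g $ a $ b) |a b. True}" "\<And>g. det g = 1 \<Longrightarrow> \<rho> g $ i $ j = p g"
      using \<rho> unfolding SL2_representation_def by meson
    have "(\<lambda>a. p (torus a)) field_differentiable at 1"
    proof (rule poly_curve_differentiable[OF p(1)])
      fix c :: "complex^2^2 \<Rightarrow> complex" assume "c \<in> {(\<lambda>g. g $ a $ b) |a b. True}"
      then obtain a b where c: "c = (\<lambda>g. g $ a $ b)" by auto
      \<comment> \<open>The torus has an entry \<open>inverse a\<close>, which is not a polynomial
        in \<open>a\<close> but is differentiable at 1.\<close>
      have "(\<lambda>t. inverse t) field_differentiable at (1 :: complex)"
        by (rule field_differentiable_inverse) simp_all
      then show "(\<lambda>t. c (torus t)) field_differentiable at 1"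
        using exhaust_2[of a] exhaust_2[of b] by (auto simp: c torus_def)
    qed
    \<comment> \<open>The polynomial represents \<open>\<rho>\<close> only at determinant 1, that is
      for \<open>a \<noteq> 0\<close>; this holds near 1, which is enough for the
      derivative.\<close>
    moreover have ev: "\<forall>\<^sub>F a in nhds 1. p (torus a) = \<rho> (torus a) $ i $ j"
      using t1_space_nhds[of 1 0] by (rule eventually_mono) (simp_all add: p(2) det_torus)
    ultimately have "(\<lambda>a. \<rho> (torus a) $ i $ j) field_differentiable at 1"
      unfolding field_differentiable_def using DERIV_cong_ev[OF refl ev refl] by simp
    then show ?thesis by (simp add: H_def DERIV_deriv_iff_field_differentiable)
  qed
  have Hs: "(H ** \<sigma> t) $ i $ j = (\<sigma> t ** H) $ i $ j + 2 * t * (E ** \<sigma> t) $ i $ j" for t i j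
  proof -
    let ?R = "\<lambda>a. \<rho> (torus a)"
    have "?R a ** \<sigma> t = \<sigma> (a * a * t) ** ?R a" if "a \<noteq> 0" for a
      using rmult[OF det_torus[OF that] det_unip[of t]] rmult[OF det_unip[of "a * a * t"] det_torus[OF that]]
      by (simp add: torus_unip[OF that] ext)
    then have eq: "(\<Sum>k\<in>UNIV. ?R a $ i $ k * \<sigma> t $ k $ j) = (\<Sum>k\<in>UNIV. \<sigma> (a * a * t) $ i $ k * ?R a $ k $ j)" if "a \<noteq> 0" for a
      using that by (simp add: vec_eq_iff matrix_matrix_mult_def)
    have L: "((\<lambda>a. \<Sum>k\<in>UNIV. ?R a $ i $ k * \<sigma> t $ k $ j) has_field_derivative (H ** \<sigma> t) $ i $ j) (at 1)"
      unfolding matrix_matrix_mult_def vec_lambda_beta by (intro DERIV_sum DERIV_cmult_right H_deriv)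
    \<comment> \<open>The inner derivative of \<open>a * a * t\<close> at 1 is \<open>2 * t\<close>;
      this is the origin of the factor 2 throughout.\<close>
    have s: "((\<lambda>a. \<sigma> (a * a * t) $ i $ k) has_field_derivative 2 * t * (E ** \<sigma> t) $ i $ k) (at 1)" for k
    proof -
      have "((\<lambda>a. a * a * t) has_field_derivative 2 * t) (at 1)" by (auto intro!: derivative_eq_intros)
      then show ?thesis
        using DERIV_chain2[of "\<lambda>t. \<sigma> t $ i $ k" "(E ** \<sigma> t) $ i $ k" "\<lambda>a. a * a * t" 1 "2 * t"] deriv(2)[of i k t]
        by (simp add: mult.commute)
    qed
    have prod: "((\<lambda>a. \<sigma> (a * a * t) $ i $ k * ?R a $ k $ j) has_field_derivative
       2 * t * (E ** \<sigma> t) $ i $ k * mat 1 $ k $ j + H $ k $ j * \<sigma> t $ i $ k) (at 1)" for k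
      using DERIV_mult[OF s[of k] H_deriv[of k j]] by (simp add: torus_1 r1)
    have "((\<lambda>a. \<Sum>k\<in>UNIV. \<sigma> (a * a * t) $ i $ k * ?R a $ k $ j) has_field_derivative
       (\<Sum>k\<in>UNIV. 2 * t * (E ** \<sigma> t) $ i $ k * mat 1 $ k $ j + H $ k $ j * \<sigma> t $ i $ k)) (at 1)"
      by (intro DERIV_sum prod)
    moreover have "(\<Sum>k\<in>UNIV. 2 * t * (E ** \<sigma> t) $ i $ k * mat 1 $ k $ j + H $ k $ j * \<sigma> t $ i $ k) =
        (\<sigma> t ** H) $ i $ j + 2 * t * (E ** \<sigma> t) $ i $ j"
    proof -
      have "(\<Sum>k\<in>UNIV. 2 * t * (E ** \<sigma> t) $ i $ k * mat 1 $ k $ j) = 2 * t * (E ** \<sigma> t) $ i $ j"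
        by (simp add: mat_def if_distrib cong: if_cong)
      moreover have "(\<Sum>k\<in>UNIV. H $ k $ j * \<sigma> t $ i $ k) = (\<sigma> t ** H) $ i $ j"
        by (simp add: matrix_matrix_mult_def mult.commute)
      ultimately show ?thesis unfolding sum.distrib by simp
    qed
    ultimately have R: "((\<lambda>a. \<Sum>k\<in>UNIV. \<sigma> (a * a * t) $ i $ k * ?R a $ k $ j) has_field_derivative
       (\<sigma> t ** H) $ i $ j + 2 * t * (E ** \<sigma> t) $ i $ j) (at 1)" by simp
    have "\<forall>\<^sub>F a in nhds 1. (\<Sum>k\<in>UNIV. ?R a $ i $ k * \<sigma> t $ k $ j) = (\<Sum>k\<in>UNIV. \<sigma> (a * a * t) $ i $ k * ?R a $ k $ j)"
      using t1_space_nhds[of 1 0] by (rule eventually_mono) (simp_all add: eq)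
    from DERIV_cong_ev[OF refl this refl] L R show ?thesis using DERIV_unique by blast
  qed
  have Hv: "H *v (\<sigma> t *v x) = \<sigma> t *v (H *v x) + (2 * t) *s (E *v (\<sigma> t *v x))" for t x
    unfolding matrix_vector_mul_assoc
    by (simp add: vec_eq_iff matrix_vector_mult_def Hs sum.distrib sum_distrib_left algebra_simps)
  have dv: "((\<lambda>t. (A *v (\<sigma> t *v x)) $ i) has_field_derivative (A *v (E *v x)) $ i) (at 0)" for A :: "complex^'n^'n" and x i
    unfolding matrix_vector_mult_def vec_lambda_beta
    by (intro DERIV_sum DERIV_cmult DERIV_cmult_right E0)
  have HE: "H *v (E *v x) = E *v (H *v x) + 2 *s (E *v x)" for x
  proof -
    have "(H *v (E *v x)) $ i = (E *v (H *v x)) $ i + 2 * (E *v x) $ i" for i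
    proof -
      \<comment> \<open>Differentiating \<open>Hv\<close> at \<open>t = 0\<close> gives the
        infinitesimal relation. The factor \<open>mat 1\<close> brings the first term into the shape
        required by \<open>dv\<close>.\<close>
      have "((\<lambda>t. (mat 1 *v (\<sigma> t *v (H *v x))) $ i + 2 * t * (E *v (\<sigma> t *v x)) $ i) has_field_derivative
          (mat 1 *v (E *v (H *v x))) $ i + 2 * (E *v x) $ i) (at 0)"
        by (auto intro!: derivative_eq_intros dv simp: s0 simp del: matrix_vector_mul_lid) (simp add: s0)
      then have "((\<lambda>t. (H *v (\<sigma> t *v x)) $ i) has_field_derivative (E *v (H *v x)) $ i + 2 * (E *v x) $ i) (at 0)"
        by (simp add: Hv)
      then show ?thesis using DERIV_unique[OF dv] by blast
    qed
    then show ?thesis by (simp add: vec_eq_iff)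
  qed
  have "slice_data \<sigma> E H"
    by unfold_locales (rule s0 sadd spoly deriv(1) comm Hv HE)+
  then show thesis using that unfolding E_def by blast
qed

theorem theorem3p14:
  fixes \<sigma> :: "complex \<Rightarrow> complex^'n::finite^'n"
    and \<rho> :: "complex^2^2 \<Rightarrow> complex^'n^'n"
  assumes "linear_Ga_action \<sigma>"
    and "\<exists>t. \<sigma> t \<noteq> mat 1"
    and "SL2_representation \<rho>"
    and "\<forall>t. \<rho> (unip t) = \<sigma> t"
  shows "\<exists>\<Omega> :: complex \<Rightarrow> 'n cotangent set form2.
    (\<forall>\<xi>. \<xi> \<noteq> 0 \<longrightarrow>
       locally_trivial_Ga_torsor (cotangent_lift \<sigma>) (H_level \<rho> \<xi>) (X_level \<sigma> \<rho> \<xi>) (Ga_orbit \<sigma>) \<and>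
       algebraic_symplectic (X_level \<sigma> \<rho> \<xi>) (\<Omega> \<xi>) \<and>
       (\<forall>z\<in>pts (H_level \<rho> \<xi>). \<forall>D1\<in>tangent (H_level \<rho> \<xi>) z. \<forall>D2\<in>tangent (H_level \<rho> \<xi>) z.
          pullback_form (X_level \<sigma> \<rho> \<xi>) (Ga_orbit \<sigma>) (\<Omega> \<xi>) z D1 D2
            = pullback_form TV (\<lambda>z. z) liouville z D1 D2)) \<and>
    variety (X_total \<sigma> \<rho>) \<and>
    trivial_Ga_torsor (cotangent_lift \<sigma>) (H_Cstar \<rho>) (X_total \<sigma> \<rho>) (Ga_orbit \<sigma>) \<and>
    (\<exists>p. morphism (X_total \<sigma> \<rho>) Cstar p \<and>
       (\<forall>z\<in>pts (H_Cstar \<rho>). p (Ga_orbit \<sigma> z) = moment \<rho> z) \<and>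
       (\<forall>\<xi>. \<xi> \<noteq> 0 \<longrightarrow>
          isomorphism (X_level \<sigma> \<rho> \<xi>)
            (subspace_fs (X_total \<sigma> \<rho>) {y \<in> pts (X_total \<sigma> \<rho>). p y = \<xi>}) (\<lambda>y. y))) \<and>
    (\<forall>\<xi>1 \<xi>2. \<xi>1 \<noteq> 0 \<and> \<xi>2 \<noteq> 0 \<longrightarrow>
       (\<exists>\<Phi>. isomorphism (X_level \<sigma> \<rho> \<xi>1) (X_level \<sigma> \<rho> \<xi>2) \<Phi> \<and>
          (\<forall>y\<in>pts (X_level \<sigma> \<rho> \<xi>1). \<forall>D1\<in>tangent (X_level \<sigma> \<rho> \<xi>1) y. \<forall>D2\<in>tangent (X_level \<sigma> \<rho> \<xi>1) y.
             \<xi>2 * \<Omega> \<xi>1 y D1 D2 = \<xi>1 * pullback_form (X_level \<sigma> \<rho> \<xi>2) \<Phi> (\<Omega> \<xi>2) y D1 D2)))"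
proof -
  obtain H where "slice_data \<sigma> (rho_E \<rho>) H"
    using assms(1,3,4) by (rule slice_data_SL2)
  then interpret slice_data \<sigma> "rho_E \<rho>" H .
  have moment: "moment \<rho> = mu"
    by (rule ext) (simp add: moment_def mu_def pairing_def case_prod_beta)
  have level: "H_level \<rho> \<xi> = P {\<xi>}" "X_level \<sigma> \<rho> \<xi> = X {\<xi>}" for \<xi>
    by (simp_all add: H_level_def X_level_def P_def X_def moment)
  have total: "H_Cstar \<rho> = P (- {0})" "X_total \<sigma> \<rho> = X (- {0})"
    by (simp_all add: H_Cstar_def X_total_def P_def X_def moment)
  show ?thesis
    unfolding level total
  proof (intro exI[of _ "\<lambda>_. Omega"] conjI allI impI ballI)
    fix \<xi> :: complex assume \<xi>: "\<xi> \<noteq> 0"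
    show "locally_trivial_Ga_torsor act (P {\<xi>}) (X {\<xi>}) orb" by (rule locally_trivial_torsor) (use \<xi> in simp)
    show "algebraic_symplectic (X {\<xi>}) Omega" by (rule symplectic_level[OF \<xi>])
    show "pullback_form (X {\<xi>}) orb Omega z D1 D2 = pullback_form TV (\<lambda>z. z) liouville z D1 D2"
      if "z \<in> pts (P {\<xi>})" "D1 \<in> tangent (P {\<xi>}) z" "D2 \<in> tangent (P {\<xi>}) z" for z D1 D2
      by (rule Omega_pullback[OF \<xi> that])
  next
    show "variety (X (- {0}))" by (rule variety_total)
    show "trivial_Ga_torsor act (P (- {0})) (X (- {0})) orb" by (rule trivial_torsor) simp
    show "\<exists>p. morphism (X (- {0})) Cstar p \<and> (\<forall>z\<in>pts (P (- {0})). p (orb z) = moment \<rho> z) \<and>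
       (\<forall>\<xi>. \<xi> \<noteq> 0 \<longrightarrow> isomorphism (X {\<xi>}) (subspace_fs (X (- {0})) {y \<in> pts (X (- {0})). p y = \<xi>}) (\<lambda>y. y))"
      by (intro exI[of _ "\<lambda>y. mu (section_pt y)"] conjI morphism_total_Cstar allI impI level_fibre_isomorphism)
         (simp_all add: section_pt_orb moment)
  next
    fix \<xi>1 \<xi>2 :: complex assume "\<xi>1 \<noteq> 0 \<and> \<xi>2 \<noteq> 0"
    then have \<xi>: "\<xi>1 \<noteq> 0" "\<xi>2 \<noteq> 0" by auto
    \<comment> \<open>Scaling \<open>\<alpha>\<close> by this ratio takes the level
      \<open>\<xi>1\<close> of \<open>mu\<close> to the level \<open>\<xi>2\<close> and multiplies
      the form by the same ratio.\<close>
    let ?k = "\<xi>2 / \<xi>1"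
    have k: "?k \<noteq> 0" "?k * \<xi>1 = \<xi>2" using \<xi> by auto
    show "\<exists>\<Phi>. isomorphism (X {\<xi>1}) (X {\<xi>2}) \<Phi> \<and>
          (\<forall>y\<in>pts (X {\<xi>1}). \<forall>D1\<in>tangent (X {\<xi>1}) y. \<forall>D2\<in>tangent (X {\<xi>1}) y.
             \<xi>2 * Omega y D1 D2 = \<xi>1 * pullback_form (X {\<xi>2}) \<Phi> Omega y D1 D2)"
    proof (intro exI conjI ballI)
      show "isomorphism (X {\<xi>1}) (X {\<xi>2}) (rescale ?k)"
        using isomorphism_rescale[OF k(1) \<xi>(1)] unfolding k(2) .
      fix y D1 D2
      assume "y \<in> pts (X {\<xi>1})" "D1 \<in> tangent (X {\<xi>1}) y" "D2 \<in> tangent (X {\<xi>1}) y"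
      from Omega_rescale[OF k(1) _ this] \<xi>(1)
      have "pullback_form (X {\<xi>2}) (rescale ?k) Omega y D1 D2 = ?k * Omega y D1 D2"
        by (simp del: pts_X)
      then show "\<xi>2 * Omega y D1 D2 = \<xi>1 * pullback_form (X {\<xi>2}) (rescale ?k) Omega y D1 D2"
        using \<xi>(1) by simp
    qed
  qed
qed

end
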